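(* Let $p$ be a prime, $q=p^t$ with $t\geq 1$, and let $V(q)$ be a vector space of dimension $n\geq 4$ over $\mathbf{F}_q$ carrying a nondegenerate quadratic form. Let $A_{11}$ be the incidence matrix between the singular one-dimensional subspaces of $V(q)$ and their polar hyperplanes. The following hold. (a) Assume $p=2$. Then $$\mathrm{rank}_p A_{11}=\begin{cases}1+n^t, & \text{if $n$ is even},\\ 1+(n-1)^t, & \text{if $n$ is odd.}\end{cases}$$ (b) Assume $p>2$. Then the $p$-rank depends on whether there exists a positive integer $u$ such that $$u\equiv n+1\pmod 2\quad\text{and}\quad n-3\leq up\leq p+n-5.$$ If $u$ exists then $$\mathrm{rank}_pA_{11}=1+\left[\binom{n+p-2}{n-1}-\binom{n+p-4}{n-1}-\binom{up+2}{n-1}+\binom{up}{n-1}\right]^t.$$ Otherwise, $$\mathrm{rank}_pA_{11}=1+\left[\binom{n+p-2}{n-1}-\binom{n+p-4}{n-1}\right]^t.$$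
   Context: A quadratic form is nondegenerate if it does not vanish at any nonzero vector of the radical of its associated bilinear (polar) form. Let $P$ be the set of singular one-dimensional subspaces of $V(q)$ (those on which the quadratic form vanishes), and let $P^*$ be the set of polar hyperplanes $\langle v\rangle^\perp$, $\langle v\rangle\in P$, where $\perp$ is taken with respect to the associated bilinear form. $A_{11}$ is the $0$-$1$ matrix with rows indexed by $P$ and columns indexed by $P^*$, whose entry is $1$ exactly when the one-dimensional subspace is contained in the hyperplane. $\mathrm{rank}_p$ is the rank of the matrix regarded as having entries in the field of $p$ elements. Binomial coefficients $\binom{a}{b}$ with $0\le a<b$ are $0$. *)

theory Defs
  imports "Jordan_Normal_Form.DL_Rank" "HOL-Number_Theory.Cong" "HOL-Library.Cardinality"
begin

definition polar_form :: "('v::ab_group_add \<Rightarrow> 'a::ab_group_add) \<Rightarrow> 'v \<Rightarrow> 'v \<Rightarrow> 'a" where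
  "polar_form Q v w = Q (v + w) - Q v - Q w"

definition quadratic_form ::
  "('a::field \<Rightarrow> 'v::ab_group_add \<Rightarrow> 'v) \<Rightarrow> ('v \<Rightarrow> 'a) \<Rightarrow> bool" where
  "quadratic_form scale Q \<longleftrightarrow>
     (\<forall>c v. Q (scale c v) = c\<^sup>2 * Q v) \<and>
     (\<forall>v. Vector_Spaces.linear scale (*) (polar_form Q v)) \<and>
     (\<forall>w. Vector_Spaces.linear scale (*) (\<lambda>v. polar_form Q v w))"

definition perp :: "('v::ab_group_add \<Rightarrow> 'a::ab_group_add) \<Rightarrow> 'v set \<Rightarrow> 'v set" where
  "perp Q S = {w. \<forall>v\<in>S. polar_form Q v w = 0}"

text \<open>In characteristic 2 the radical \<open>perp Q UNIV\<close> of the polar form of a nondegenerate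
  form may be nonzero.\<close>

definition nondegenerate :: "('v::ab_group_add \<Rightarrow> 'a::ab_group_add) \<Rightarrow> bool" where
  "nondegenerate Q \<longleftrightarrow> (\<forall>v\<in>perp Q UNIV. v \<noteq> 0 \<longrightarrow> Q v \<noteq> 0)"

definition singular_points ::
  "('a::field \<Rightarrow> 'v::ab_group_add \<Rightarrow> 'v) \<Rightarrow> ('v \<Rightarrow> 'a) \<Rightarrow> 'v set set" where
  "singular_points scale Q =
     {L. module.subspace scale L \<and> vector_space.dim scale L = 1 \<and> (\<forall>v\<in>L. Q v = 0)}"

definition polar_hyperplanes ::
  "('a::field \<Rightarrow> 'v::ab_group_add \<Rightarrow> 'v) \<Rightarrow> ('v \<Rightarrow> 'a) \<Rightarrow> 'v set set" where
  "polar_hyperplanes scale Q = perp Q ` singular_points scale Q"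

text \<open>Library matrices have rows and columns numbered from 0, so a matrix indexed by finite sets
  is taken with respect to duplicate-free lists \<open>Ps\<close>, \<open>Hs\<close> enumerating the index sets.\<close>

definition incidence_mat :: "'v set list \<Rightarrow> 'v set list \<Rightarrow> 'k::field mat" where
  "incidence_mat Ps Hs =
     mat (length Ps) (length Hs) (\<lambda>(i, j). if Ps ! i \<subseteq> Hs ! j then 1 else 0)"

text \<open>The parameter of \<^const>\<open>vec_space.rank\<close> is the dimension of the space containing the
  columns.\<close>

definition mat_rank :: "'k::field mat \<Rightarrow> nat" where
  "mat_rank A = vec_space.rank (dim_row A) A"

end

theory Submission
  imports Defs "HOL-Library.Function_Algebras" "HOL-Computational_Algebra.Computational_Algebra"
begin

text \<open>
  Over \<open>F = GF(q)\<close> the incidence of \<open>\<langle>x\<rangle>\<close> with the polar hyperplane of \<open>\<langle>y\<rangle>\<close> is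
  \<open>1 - B(x, y)\<^sup>q\<^sup>-\<^sup>1\<close>, with \<open>B\<close> the polar form; the constant contributes 1 to the rank. If there is a
  totally singular line, choose a hyperbolic pair \<open>e1, e2\<close> and a basis \<open>S\<close> of
  \<open>\<langle>e1, e2\<rangle>\<^sup>\<bottom>\<close> consisting of singular vectors. On the chart of singular vectors
  \<open>e2 + w - Q(w) e1\<close> the form \<open>B\<close> is affine in each \<open>S\<close>-coordinate of either argument, so
  \<open>B\<^sup>p\<^sup>-\<^sup>1\<close> has degree at most \<open>p - 1\<close> in each coordinate. As \<open>q - 1 = (p - 1)(1 + p + \<dots>)\<close>,
  uniqueness of \<open>p\<close>-adic digits exhibits the coefficient matrix of \<open>B\<^sup>q\<^sup>-\<^sup>1\<close> as a Kronecker product of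
  Frobenius twists of that of \<open>B\<^sup>p\<^sup>-\<^sup>1\<close>, which gives the \<open>t\<close>-th power.

  The rank of \<open>B\<^sup>p\<^sup>-\<^sup>1\<close> on the chart is that of an alternating form if \<open>p = 2\<close>. For odd \<open>p\<close> the
  functions \<open>B(x, -)\<^sup>p\<^sup>-\<^sup>1\<close> with \<open>x\<close> singular span the harmonic forms of degree \<open>p - 1\<close>, and a form of
  that degree vanishing on the chart is divisible by \<open>Q\<close>. So the rank is the dimension of the
  harmonic forms modulo the harmonic multiples of \<open>Q\<close>, which the commutation relation of the
  Laplacian with multiplication by \<open>Q\<close> determines. All dimensions are obtained by counting elements
  of finite vector spaces.

  Without a totally singular line, \<open>n = 4\<close> and the incidence matrix is a permutation matrix.
\<close>

section \<open>Rank factorizations\<close>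

text \<open>The entries lie in GF(p) while the geometry lives over GF(q); ranks are kept as
  certificates because these survive the embedding of fields. The obstacle to a digit argument is
  carrying: the exponents in B^(p-1) must stay below p, and the monomials must be independent as
  functions. In coordinates of the whole space the second condition fails on the quadric; on the
  chart, with an arbitrary basis of the complement, the squares in Q could push exponents up to
  2(p-1). A singular basis removes the squares, and it exists as soon as the complement contains one
  nonzero singular vector.

  The number u comes from commuting the Laplacian past Q^j on forms of degree p-1-2j: the scalar is
  j(n+2p-2j-4). As 0 < j < p, it vanishes modulo p iff n+2p-2j-4 = p(u+1) for some u, and the range
  of j becomes the range and parity of u. The difference of the two binomials containing u is the
  dimension of the harmonic forms of degree p-1-2j. For n = 4 no u is admissible and the bracket
  equals p^2, in agreement with the q^2+1 points of a quadric without lines.\<close>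

text \<open>
  A rank factorization is certified by one-sided inverses \<open>l\<close>, \<open>m\<close> of its two factors. Unlike linear
  independence, such certificates are visibly transported by field homomorphisms and Kronecker products.
\<close>

definition rank_factors where
  "rank_factors A B k r u v l m \<longleftrightarrow>
     (\<forall>a\<in>A. \<forall>b\<in>B. k a b = (\<Sum>i<r. u a i * v i b)) \<and>
     (\<forall>i<r. \<forall>j<r. (\<Sum>a\<in>A. l i a * u a j) = (if i = j then 1 else 0)) \<and>
     (\<forall>i<r. \<forall>j<r. (\<Sum>b\<in>B. v i b * m b j) = (if i = j then 1 else 0))"

definition has_rank :: "'i set \<Rightarrow> 'j set \<Rightarrow> ('i \<Rightarrow> 'j \<Rightarrow> 'f::field) \<Rightarrow> nat \<Rightarrow> bool" where
  "has_rank A B k r \<longleftrightarrow> (\<exists>u v l m. rank_factors A B k r u v l m)"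

lemma rank_factorsD:
  assumes "rank_factors A B k r u v l m"
  shows "\<And>a b. a \<in> A \<Longrightarrow> b \<in> B \<Longrightarrow> k a b = (\<Sum>i<r. u a i * v i b)"
    and "\<And>i j. i < r \<Longrightarrow> j < r \<Longrightarrow> (\<Sum>a\<in>A. l i a * u a j) = (if i = j then 1 else 0)"
    and "\<And>i j. i < r \<Longrightarrow> j < r \<Longrightarrow> (\<Sum>b\<in>B. v i b * m b j) = (if i = j then 1 else 0)"
  using assms unfolding rank_factors_def by blast+

lemma has_rankI:
  fixes k :: "'i \<Rightarrow> 'j \<Rightarrow> 'f::field"
  assumes fin: "finite I" and r: "card I = r"
    and k: "\<And>a b. a \<in> A \<Longrightarrow> b \<in> B \<Longrightarrow> k a b = (\<Sum>i\<in>I. u a i * v i b)"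
    and l: "\<And>i j. i \<in> I \<Longrightarrow> j \<in> I \<Longrightarrow> (\<Sum>a\<in>A. l i a * u a j) = (if i = j then 1 else 0)"
    and m: "\<And>i j. i \<in> I \<Longrightarrow> j \<in> I \<Longrightarrow> (\<Sum>b\<in>B. v i b * m b j) = (if i = j then 1 else 0)"
  shows "has_rank A B k r"
proof -
  obtain h where h: "bij_betw h {..<r} I"
    using ex_bij_betw_nat_finite[OF fin] r by (auto simp: atLeast0LessThan)
  have hI: "h i \<in> I" if "i < r" for i using h that by (auto simp: bij_betw_def)
  have inj: "h i = h j \<longleftrightarrow> i = j" if "i < r" "j < r" for i j
    using h that by (auto simp: bij_betw_def inj_on_def)
  show ?thesis
    unfolding has_rank_def rank_factors_def
  proof (intro exI conjI ballI allI impI)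
    fix a b assume "a \<in> A" "b \<in> B"
    then show "k a b = (\<Sum>i<r. (\<lambda>a i. u a (h i)) a i * (\<lambda>i. v (h i)) i b)"
      by (simp add: k sum.reindex_bij_betw[OF h, of "\<lambda>i. u a i * v i b", symmetric])
  next
    fix i j assume "i < r" "j < r"
    then show "(\<Sum>a\<in>A. (\<lambda>i. l (h i)) i a * (\<lambda>a i. u a (h i)) a j) = (if i = j then 1 else 0)"
      by (simp add: l hI inj)
  next
    fix i j assume "i < r" "j < r"
    then show "(\<Sum>b\<in>B. (\<lambda>i. v (h i)) i b * (\<lambda>b j. m b (h j)) b j) = (if i = j then 1 else 0)"
      by (simp add: m hI inj)
  qed
qed

lemma has_rank_cong_imp:
  assumes "has_rank A B k r" and "\<And>a b. a \<in> A \<Longrightarrow> b \<in> B \<Longrightarrow> k' a b = k a b"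
  shows "has_rank A B k' r"
proof -
  from assms(1) obtain u v l m where "rank_factors A B k r u v l m"
    unfolding has_rank_def by blast
  note * = rank_factorsD[OF this]
  show ?thesis
    by (rule has_rankI[of "{..<r}" r _ _ _ u v l m]) (auto simp: * assms(2))
qed

lemma has_rank_transpose:
  assumes "has_rank A B k r"
  shows "has_rank B A (\<lambda>b a. k a b) r"
proof -
  from assms obtain u v l m where "rank_factors A B k r u v l m"
    unfolding has_rank_def by blast
  note * = rank_factorsD[OF this]
  have "(\<Sum>b\<in>B. m b i * v j b) = (if i = j then 1 else 0)" if "i < r" "j < r" for i j
    using *(3)[OF that(2,1)] by (auto simp: mult.commute[of "m _ _"])
  moreover have "(\<Sum>a\<in>A. u a i * l j a) = (if i = j then 1 else 0)" if "i < r" "j < r" for i j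
    using *(2)[OF that(2,1)] by (auto simp: mult.commute[of "u _ _"])
  ultimately show ?thesis
    by (intro has_rankI[of "{..<r}" r _ _ _ "\<lambda>b i. v i b" "\<lambda>i a. u a i" "\<lambda>i b. m b i" "\<lambda>a i. l i a"])
       (auto simp: *(1) mult.commute[of "v _ _"])
qed

lemma has_rank_hom:
  fixes h :: "'f::field \<Rightarrow> 'g::field"
  assumes add: "\<And>x y. h (x + y) = h x + h y" and mult: "\<And>x y. h (x * y) = h x * h y"
    and one: "h 1 = 1" and rk: "has_rank A B k r"
  shows "has_rank A B (\<lambda>a b. h (k a b)) r"
proof -
  have zero: "h 0 = 0" by (metis add add.right_neutral add_left_cancel)
  have sum: "h (sum f S) = (\<Sum>x\<in>S. h (f x))" for f :: "'z \<Rightarrow> 'f" and S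
    by (induction S rule: infinite_finite_induct) (auto simp: zero add)
  from rk obtain u v l m where "rank_factors A B k r u v l m"
    unfolding has_rank_def by blast
  note * = rank_factorsD[OF this]
  have "(\<Sum>a\<in>A. h (l i a) * h (u a j)) = (if i = j then 1 else 0)" if "i < r" "j < r" for i j
    using arg_cong[OF *(2)[OF that], of h] by (simp add: sum mult one zero)
  moreover have "(\<Sum>b\<in>B. h (v i b) * h (m b j)) = (if i = j then 1 else 0)" if "i < r" "j < r" for i j
    using arg_cong[OF *(3)[OF that], of h] by (simp add: sum mult one zero)
  ultimately show ?thesis
    by (intro has_rankI[of "{..<r}" r _ _ _ "\<lambda>a i. h (u a i)" "\<lambda>i b. h (v i b)" "\<lambda>i b. h (l i b)"
        "\<lambda>a i. h (m a i)"]) (auto simp: * sum mult)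
qed

lemma has_rank_prod:
  assumes "has_rank A B k r" "has_rank A' B' k' r'"
  shows "has_rank (A \<times> A') (B \<times> B') (\<lambda>a b. k (fst a) (fst b) * k' (snd a) (snd b)) (r * r')"
proof -
  from assms(1) obtain u v l m where "rank_factors A B k r u v l m"
    unfolding has_rank_def by blast
  note * = rank_factorsD[OF this]
  from assms(2) obtain u' v' l' m' where "rank_factors A' B' k' r' u' v' l' m'"
    unfolding has_rank_def by blast
  note ** = rank_factorsD[OF this]
  have prodsum: "(\<Sum>x\<in>S \<times> T. (f (fst x) * g (snd x)) * (f' (fst x) * g' (snd x))) =
      (\<Sum>x\<in>S. f x * f' x) * (\<Sum>x\<in>T. g x * g' x)" 
    for S :: "'x set" and T :: "'y set" and f f' :: "'x \<Rightarrow> 'w::comm_semiring_1" and g g' :: "'y \<Rightarrow> 'w"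
    by (simp add: sum_product sum.cartesian_product case_prod_beta mult_ac)
  show ?thesis
  proof (rule has_rankI[of "{..<r} \<times> {..<r'}" _ _ _ _
        "\<lambda>a i. u (fst a) (fst i) * u' (snd a) (snd i)" "\<lambda>i a. v (fst i) (fst a) * v' (snd i) (snd a)"
        "\<lambda>i a. l (fst i) (fst a) * l' (snd i) (snd a)" "\<lambda>a i. m (fst a) (fst i) * m' (snd a) (snd i)"])
    fix a b assume "a \<in> A \<times> A'" "b \<in> B \<times> B'"
    then show "k (fst a) (fst b) * k' (snd a) (snd b) = (\<Sum>i\<in>{..<r} \<times> {..<r'}.
        u (fst a) (fst i) * u' (snd a) (snd i) * (v (fst i) (fst b) * v' (snd i) (snd b)))"
      by (subst prodsum) (auto simp: * ** split: if_splits)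
  next
    fix i j assume "i \<in> {..<r} \<times> {..<r'}" "j \<in> {..<r} \<times> {..<r'}"
    then show "(\<Sum>a\<in>A \<times> A'. l (fst i) (fst a) * l' (snd i) (snd a) * (u (fst a) (fst j) * u' (snd a) (snd j))) =
       (if i = j then 1 else 0)"
      by (subst prodsum) (auto simp: * ** split: if_splits)
  next
    fix i j assume "i \<in> {..<r} \<times> {..<r'}" "j \<in> {..<r} \<times> {..<r'}"
    then show "(\<Sum>b\<in>B \<times> B'. v (fst i) (fst b) * v' (snd i) (snd b) * (m (fst b) (fst j) * m' (snd b) (snd j))) =
       (if i = j then 1 else 0)"
      by (subst prodsum) (auto simp: * ** split: if_splits)
  qed auto
qed

text \<open>A left inverse \<open>E'\<close> of \<open>E\<close> turns a left inverse of
  \<open>u\<close> into one of the product \<open>E u\<close>. Repeating rows, adding dependent rows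
  and evaluating monomials at points are all instances.\<close>

lemma has_rank_mult_left:
  assumes rk: "has_rank A B k r" and fin: "finite A"
    and E: "\<And>i j. i \<in> A \<Longrightarrow> j \<in> A \<Longrightarrow> (\<Sum>a\<in>A'. E' i a * E a j) = (if i = j then 1 else 0)"
    and k': "\<And>a b. a \<in> A' \<Longrightarrow> b \<in> B \<Longrightarrow> k' a b = (\<Sum>i\<in>A. E a i * k i b)"
  shows "has_rank A' B k' r"
proof -
  from rk obtain u v l m where "rank_factors A B k r u v l m"
    unfolding has_rank_def by blast
  note * = rank_factorsD[OF this]
  show ?thesis
  proof (rule has_rankI[of "{..<r}" r _ _ _ "\<lambda>a i. \<Sum>e\<in>A. E a e * u e i" v
         "\<lambda>i a. \<Sum>e\<in>A. l i e * E' e a" m])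
    fix a b assume ab: "a \<in> A'" "b \<in> B"
    have "k' a b = (\<Sum>e\<in>A. \<Sum>i<r. E a e * (u e i * v i b))"
      unfolding k'[OF ab] by (intro sum.cong refl) (simp add: * ab sum_distrib_left)
    also have "\<dots> = (\<Sum>i<r. (\<Sum>e\<in>A. E a e * u e i) * v i b)"
      by (subst sum.swap) (simp add: sum_distrib_left sum_distrib_right mult_ac)
    finally show "k' a b = (\<Sum>i<r. (\<Sum>e\<in>A. E a e * u e i) * v i b)" .
  next
    fix i j assume ij: "i \<in> {..<r}" "j \<in> {..<r}"
    have "(\<Sum>a\<in>A'. (\<Sum>e\<in>A. l i e * E' e a) * (\<Sum>e\<in>A. E a e * u e j)) =
        (\<Sum>a\<in>A'. \<Sum>e\<in>A. \<Sum>f\<in>A. l i e * u f j * (E' e a * E a f))"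
      unfolding sum_product by (intro sum.cong refl) (simp add: mult_ac)
    also have "\<dots> = (\<Sum>e\<in>A. \<Sum>f\<in>A. l i e * u f j * (\<Sum>a\<in>A'. E' e a * E a f))"
      by (subst sum.swap, rule sum.cong[OF refl], subst sum.swap) (simp add: sum_distrib_left)
    also have "\<dots> = (\<Sum>e\<in>A. \<Sum>f\<in>A. if e = f then l i e * u f j else 0)"
      by (intro sum.cong refl) (simp add: E)
    also have "\<dots> = (\<Sum>e\<in>A. l i e * u e j)" using fin by simp
    finally show "(\<Sum>a\<in>A'. (\<Sum>e\<in>A. l i e * E' e a) * (\<Sum>e\<in>A. E a e * u e j)) = (if i = j then 1 else 0)"
      using ij by (simp add: *)
  qed (auto simp: *)
qed

lemma has_rank_surj_left:
  assumes rk: "has_rank (f ` A) B k r" and fin: "finite A"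
  shows "has_rank A B (\<lambda>a b. k (f a) b) r"
proof (rule has_rank_mult_left[OF rk, where A' = A and E' = "\<lambda>i a. if a = inv_into A f i then 1 else 0"
      and E = "\<lambda>a j. if f a = j then 1 else 0"])
  fix i j assume ij: "i \<in> f ` A" "j \<in> f ` A"
  have "(\<Sum>a\<in>A. (if a = inv_into A f i then 1 else 0) * (if f a = j then 1 else (0::'c)))
    = (\<Sum>a\<in>A. if a = inv_into A f i then (if f a = j then 1 else 0) else 0)"
    by (intro sum.cong) auto
  also have "\<dots> = (if i = j then 1 else 0)"
    using ij fin by (simp add: inv_into_into f_inv_into_f)
  finally show "(\<Sum>a\<in>A. (if a = inv_into A f i then 1 else 0) * (if f a = j then 1 else (0::'c))) =
    (if i = j then 1 else 0)" .
next
  fix a b assume "a \<in> A" "b \<in> B"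
  have "(\<Sum>i\<in>f ` A. (if f a = i then 1 else 0) * k i b) = (\<Sum>i\<in>f ` A. if f a = i then k i b else 0)"
    by (intro sum.cong) auto
  then show "k (f a) b = (\<Sum>i\<in>f ` A. (if f a = i then 1 else 0) * k i b)"
    using fin \<open>a \<in> A\<close> by simp
qed (use fin in auto)

lemma has_rank_surj:
  assumes rk: "has_rank (f ` A) (g ` B) k r" and fin: "finite A" "finite B"
  shows "has_rank A B (\<lambda>a b. k (f a) (g b)) r"
  using has_rank_transpose[OF has_rank_surj_left[OF has_rank_transpose[OF
        has_rank_surj_left[OF rk fin(1)]] fin(2)]] .

lemma has_rank_extend_left:
  fixes k :: "'i \<Rightarrow> 'j \<Rightarrow> 'f::field"
  assumes rk: "has_rank A B k r" and AA': "A \<subseteq> A'" and fin: "finite A'"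
    and dep: "\<And>a. a \<in> A' \<Longrightarrow> \<exists>\<tau>. \<forall>b\<in>B. k a b = (\<Sum>c\<in>A. \<tau> c * k c b)"
  shows "has_rank A' B k r"
proof -
  have fA: "finite A" using AA' fin finite_subset by auto
  \<comment> \<open>The coefficients are normalised to the Kronecker delta on \<open>A\<close>, so
    that the inclusion of \<open>A\<close> in \<open>A'\<close> provides the left inverse.\<close>
  have "\<exists>\<tau>. \<forall>a\<in>A'. (\<forall>b\<in>B. k a b = (\<Sum>c\<in>A. \<tau> a c * k c b)) \<and> (a \<in> A \<longrightarrow> \<tau> a = (\<lambda>c. if c = a then 1 else 0))"
  proof (rule bchoice, rule ballI)
    fix a assume a: "a \<in> A'"
    show "\<exists>t. (\<forall>b\<in>B. k a b = (\<Sum>c\<in>A. t c * k c b)) \<and> (a \<in> A \<longrightarrow> t = (\<lambda>c. if c = a then 1 else 0))"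
    proof (cases "a \<in> A")
      case True
      have "k a b = (\<Sum>c\<in>A. (if c = a then 1 else 0) * k c b)" for b
      proof -
        have "(\<Sum>c\<in>A. (if c = a then 1 else 0) * k c b) = (\<Sum>c\<in>A. if c = a then k c b else 0)"
          by (intro sum.cong) auto
        then show ?thesis using True fA by simp
      qed
      then show ?thesis by (intro exI[of _ "\<lambda>c. if c = a then 1 else 0"]) auto
    next
      case False
      then show ?thesis using dep[OF a] by blast
    qed
  qed
  then obtain \<tau> where *: "\<forall>a\<in>A'. (\<forall>b\<in>B. k a b = (\<Sum>c\<in>A. \<tau> a c * k c b)) \<and>
      (a \<in> A \<longrightarrow> \<tau> a = (\<lambda>c. if c = a then 1 else 0))" by blast
  have \<tau>: "k a b = (\<Sum>c\<in>A. \<tau> a c * k c b)" if "a \<in> A'" "b \<in> B" for a b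
    using * that by blast
  have \<tau>A: "\<tau> a c = (if c = a then 1 else 0)" if "a \<in> A" for a c
    using * that AA' by (auto dest: subsetD)
  show ?thesis
  proof (rule has_rank_mult_left[OF rk fA, where A' = A' and E' = "\<lambda>i a. if a = i then 1 else 0" and E = \<tau>])
    fix i j assume ij: "i \<in> A" "j \<in> A"
    have "(\<Sum>a\<in>A'. (if a = i then 1 else 0) * \<tau> a j) = (\<Sum>a\<in>A'. if a = i then \<tau> a j else 0)"
      by (intro sum.cong) auto
    also have "\<dots> = \<tau> i j" using ij AA' fin by auto
    finally show "(\<Sum>a\<in>A'. (if a = i then 1 else 0) * \<tau> a j) = (if i = j then 1 else 0)"
      using \<tau>A[OF ij(1), of j] by auto
  qed (use \<tau> in auto)
qed

lemma has_rank_extend: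
  fixes k :: "'i \<Rightarrow> 'i \<Rightarrow> 'f::field"
  assumes rk: "has_rank A A k r" and "A \<subseteq> A'" "finite A'"
    and sym: "\<And>a b. k a b = k b a"
    and dep: "\<And>a. a \<in> A' \<Longrightarrow> \<exists>\<tau>. \<forall>b. k a b = (\<Sum>c\<in>A. \<tau> c * k c b)"
  shows "has_rank A' A' k r"
proof -
  have 1: "has_rank A' A k r"
    by (rule has_rank_extend_left[OF rk assms(2,3)]) (use dep in blast)
  have 2: "has_rank A A' (\<lambda>b a. k a b) r" by (rule has_rank_transpose[OF 1])
  have 3: "has_rank A A' k r" by (rule has_rank_cong_imp[OF 2]) (rule sym)
  show ?thesis
    by (rule has_rank_extend_left[OF 3 assms(2,3)]) (use dep in blast)
qed

lemma has_rank_exists: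
  fixes k :: "'i \<Rightarrow> 'j \<Rightarrow> 'f::field"
  assumes "finite A" "finite B"
  shows "\<exists>r. has_rank A B k r"
  using assms
proof (induction "card A" arbitrary: A B k rule: less_induct)
  case less
  show ?case
  proof (cases "\<forall>a\<in>A. \<forall>b\<in>B. k a b = 0")
    case True
    then have "has_rank A B k 0" by (auto simp: has_rank_def rank_factors_def)
    then show ?thesis by blast
  next
    case False
    then obtain a0 b0 where ab0: "a0 \<in> A" "b0 \<in> B" and nz: "k a0 b0 \<noteq> 0" by blast
    \<comment> \<open>Elimination with pivot \<open>k a0 b0\<close>: the Schur complement
      \<open>k'\<close> vanishes on the pivot row and the pivot column.\<close>
    define k' where "k' a b = k a b - k a b0 * k a0 b / k a0 b0" for a b
    have "card (A - {a0}) < card A" using ab0 less by (metis card_Diff1_less)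
    from less(1)[OF this] less(2,3) obtain r where "has_rank (A - {a0}) (B - {b0}) k' r"
      by blast
    then obtain u v l m where "rank_factors (A - {a0}) (B - {b0}) k' r u v l m"
    unfolding has_rank_def by blast
  note * = rank_factorsD[OF this]
    define u' where "u' a i = (if i = r then k a b0 / k a0 b0 else if a = a0 then 0 else u a i)" for a i
    define v' where "v' i b = (if i = r then k a0 b else if b = b0 then 0 else v i b)" for i b
    \<comment> \<open>The entry at \<open>a0\<close> makes the old left inverses orthogonal to the
      new column \<open>r\<close>, whose value at \<open>a0\<close> is 1. In \<open>m'\<close> the
      entry at \<open>b0\<close> does the same for the new row, whose value there is
      \<open>k a0 b0\<close>.\<close>
    define l' where "l' i a = (if i = r then (if a = a0 then 1 else 0) else
        if a = a0 then - (\<Sum>a\<in>A - {a0}. l i a * u' a r) else l i a)" for i a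
    define m' where "m' b i = (if i = r then (if b = b0 then 1 / k a0 b0 else 0) else
        if b = b0 then - (\<Sum>b\<in>B - {b0}. v' r b * m b i) / k a0 b0 else m b i)" for i b
    have splitA: "sum f A = f a0 + sum f (A - {a0})" for f :: "'i \<Rightarrow> 'f"
      using ab0 less by (simp add: sum.remove)
    have splitB: "sum f B = f b0 + sum f (B - {b0})" for f :: "'j \<Rightarrow> 'f"
      using ab0 less by (simp add: sum.remove)
    have "has_rank A B k (Suc r)"
    proof (rule has_rankI[of "{..<Suc r}" _ _ _ _ u' v' l' m'])
      fix a b assume ab: "a \<in> A" "b \<in> B"
      have "(\<Sum>i<Suc r. u' a i * v' i b) = k a b0 * k a0 b / k a0 b0 + (\<Sum>i<r. u' a i * v' i b)"
        by (simp add: u'_def v'_def)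
      also have "(\<Sum>i<r. u' a i * v' i b) = k' a b"
      proof (cases "a = a0 \<or> b = b0")
        case True
        then have "(\<Sum>i<r. u' a i * v' i b) = 0"
          by (intro sum.neutral) (auto simp: u'_def v'_def)
        moreover have "k' a b = 0" using True nz by (auto simp: k'_def)
        ultimately show ?thesis by simp
      next
        case False
        then show ?thesis using ab * by (simp add: u'_def v'_def)
      qed
      finally show "k a b = (\<Sum>i<Suc r. u' a i * v' i b)" by (simp add: k'_def)
    next
      fix i j assume "i \<in> {..<Suc r}" "j \<in> {..<Suc r}"
      then consider "i = r" "j = r" | "i = r" "j < r" | "i < r" "j = r" | "i < r" "j < r" by force
      then show "(\<Sum>a\<in>A. l' i a * u' a j) = (if i = j then 1 else 0)"
      proof cases
        case 1
        then show ?thesis using nz by (simp add: splitA l'_def u'_def)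
      next
        case 2
        then show ?thesis by (simp add: splitA l'_def u'_def)
      next
        case 3
        have "(\<Sum>a\<in>A - {a0}. l' i a * u' a j) = (\<Sum>a\<in>A - {a0}. l i a * u' a r)"
          using 3 by (intro sum.cong) (auto simp: l'_def)
        moreover have "l' i a0 * u' a0 j = - (\<Sum>a\<in>A - {a0}. l i a * u' a r)"
          using 3 nz by (simp add: l'_def u'_def)
        ultimately show ?thesis using 3 by (simp add: splitA)
      next
        case 4
        have "(\<Sum>a\<in>A - {a0}. l' i a * u' a j) = (\<Sum>a\<in>A - {a0}. l i a * u a j)"
          using 4 by (intro sum.cong) (auto simp: l'_def u'_def)
        moreover have "u' a0 j = 0" using 4 by (simp add: u'_def)
        ultimately show ?thesis using 4 * by (simp add: splitA)
      qed
    next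
      fix i j assume "i \<in> {..<Suc r}" "j \<in> {..<Suc r}"
      then consider "i = r" "j = r" | "i = r" "j < r" | "i < r" "j = r" | "i < r" "j < r" by force
      then show "(\<Sum>b\<in>B. v' i b * m' b j) = (if i = j then 1 else 0)"
      proof cases
        case 1
        then show ?thesis using nz by (simp add: splitB m'_def v'_def)
      next
        case 2
        have "(\<Sum>b\<in>B - {b0}. v' i b * m' b j) = (\<Sum>b\<in>B - {b0}. v' r b * m b j)"
          using 2 by (intro sum.cong) (auto simp: m'_def)
        moreover have "v' i b0 * m' b0 j = - (\<Sum>b\<in>B - {b0}. v' r b * m b j)"
          using 2 nz by (simp add: m'_def v'_def)
        ultimately show ?thesis using 2 by (simp add: splitB)
      next
        case 3
        then show ?thesis by (simp add: splitB m'_def v'_def)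
      next
        case 4
        have "(\<Sum>b\<in>B - {b0}. v' i b * m' b j) = (\<Sum>b\<in>B - {b0}. v i b * m b j)"
          using 4 by (intro sum.cong) (auto simp: m'_def v'_def)
        moreover have "v' i b0 = 0" using 4 by (simp add: v'_def)
        ultimately show ?thesis using 4 * by (simp add: splitB)
      qed
    qed auto
    then show ?thesis by blast
  qed
qed

text \<open>A functional \<open>la\<close> that annihilates the columns of \<open>k\<close> but not
  the constant column shows that the constant lies outside the column space; \<open>mu\<close> does
  the same for rows. Hence the constant raises the rank by exactly one.\<close>

lemma has_rank_one_minus:
  fixes k :: "'i \<Rightarrow> 'j \<Rightarrow> 'f::field"
  assumes rk: "has_rank A B k r" and fin: "finite A" "finite B"
    and lA: "(\<Sum>a\<in>A. la a) = 1" "\<And>b. b \<in> B \<Longrightarrow> (\<Sum>a\<in>A. la a * k a b) = 0"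
    and mB: "(\<Sum>b\<in>B. mu b) = 1" "\<And>a. a \<in> A \<Longrightarrow> (\<Sum>b\<in>B. k a b * mu b) = 0"
  shows "has_rank A B (\<lambda>a b. 1 - k a b) (Suc r)"
proof -
  from rk obtain u v l m where "rank_factors A B k r u v l m"
    unfolding has_rank_def by blast
  note * = rank_factorsD[OF this]
  \<comment> \<open>The columns of \<open>u\<close> are combinations of columns of \<open>k\<close>,
    namely \<open>k m\<close>, so \<open>la\<close> annihilates them as well.\<close>
  have lu: "(\<Sum>a\<in>A. la a * u a j) = 0" if j: "j < r" for j
  proof -
    have "0 = (\<Sum>b\<in>B. (\<Sum>a\<in>A. la a * k a b) * m b j)" using lA by simp
    also have "\<dots> = (\<Sum>b\<in>B. \<Sum>a\<in>A. \<Sum>i<r. la a * u a i * (v i b * m b j))"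
      by (intro sum.cong refl) (simp add: * sum_distrib_left sum_distrib_right mult_ac)
    also have "\<dots> = (\<Sum>a\<in>A. \<Sum>i<r. la a * u a i * (\<Sum>b\<in>B. v i b * m b j))"
      by (subst sum.swap, rule sum.cong[OF refl], subst sum.swap) (simp add: sum_distrib_left)
    also have "\<dots> = (\<Sum>a\<in>A. \<Sum>i<r. if i = j then la a * u a i else 0)"
      using j by (intro sum.cong refl) (simp add: *)
    also have "\<dots> = (\<Sum>a\<in>A. la a * u a j)" using j by simp
    finally show ?thesis by simp
  qed
  have vm: "(\<Sum>b\<in>B. v j b * mu b) = 0" if j: "j < r" for j
  proof -
    have "0 = (\<Sum>a\<in>A. l j a * (\<Sum>b\<in>B. k a b * mu b))" using mB by simp
    also have "\<dots> = (\<Sum>a\<in>A. \<Sum>b\<in>B. \<Sum>i<r. v i b * mu b * (l j a * u a i))"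
      by (intro sum.cong refl) (simp add: * sum_distrib_left sum_distrib_right mult_ac)
    also have "\<dots> = (\<Sum>b\<in>B. \<Sum>i<r. v i b * mu b * (\<Sum>a\<in>A. l j a * u a i))"
      by (subst sum.swap, rule sum.cong[OF refl], subst sum.swap) (simp add: sum_distrib_left)
    also have "\<dots> = (\<Sum>b\<in>B. \<Sum>i<r. if j = i then v i b * mu b else 0)"
      using j by (intro sum.cong refl) (simp add: *)
    also have "\<dots> = (\<Sum>b\<in>B. v j b * mu b)" using j by simp
    finally show ?thesis by simp
  qed
  show ?thesis
  \<comment> \<open>The multiples of \<open>la\<close> and \<open>mu\<close> cancel the pairing of
    the old inverses with the constant; the minus sign before \<open>l i a\<close> answers the one
    before \<open>u a i\<close>.\<close>
  proof (rule has_rankI[of "{..<Suc r}" _ _ _ _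
        "\<lambda>a i. if i = r then 1 else - u a i" "\<lambda>i b. if i = r then 1 else v i b"
        "\<lambda>i a. if i = r then la a else (\<Sum>a\<in>A. l i a) * la a - l i a"
        "\<lambda>b i. if i = r then mu b else m b i - (\<Sum>b\<in>B. m b i) * mu b"])
    fix a b assume "a \<in> A" "b \<in> B"
    then show "1 - k a b = (\<Sum>i<Suc r. (if i = r then 1 else - u a i) * (if i = r then 1 else v i b))"
      by (simp add: * sum_negf)
  next
    fix i j assume "i \<in> {..<Suc r}" "j \<in> {..<Suc r}"
    then consider "i = r" "j = r" | "i = r" "j < r" | "i < r" "j = r" | "i < r" "j < r" by force
    then show "(\<Sum>a\<in>A. (if i = r then la a else (\<Sum>a\<in>A. l i a) * la a - l i a) *
        (if j = r then 1 else - u a j)) = (if i = j then 1 else 0)"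
    proof cases
      case 3
      then show ?thesis by (simp add: sum_subtractf sum_distrib_left[symmetric] lA)
    next
      case 4
      then have "(\<Sum>a\<in>A. ((\<Sum>a\<in>A. l i a) * la a - l i a) * - u a j)
        = (\<Sum>a\<in>A. l i a * u a j) - (\<Sum>a\<in>A. l i a) * (\<Sum>a\<in>A. la a * u a j)"
        by (simp add: algebra_simps sum_subtractf sum_distrib_left sum_negf)
      then show ?thesis using 4 lu * by simp
    qed (auto simp: lA lu sum_negf)
  next
    fix i j assume "i \<in> {..<Suc r}" "j \<in> {..<Suc r}"
    then consider "i = r" "j = r" | "i = r" "j < r" | "i < r" "j = r" | "i < r" "j < r" by force
    then show "(\<Sum>b\<in>B. (if i = r then 1 else v i b) *
        (if j = r then mu b else m b j - (\<Sum>b\<in>B. m b j) * mu b)) = (if i = j then 1 else 0)"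
    proof cases
      case 2
      then show ?thesis by (simp add: sum_subtractf sum_distrib_left[symmetric] mB)
    next
      case 4
      then have "(\<Sum>b\<in>B. v i b * (m b j - (\<Sum>b\<in>B. m b j) * mu b))
        = (\<Sum>b\<in>B. v i b * m b j) - (\<Sum>b\<in>B. m b j) * (\<Sum>b\<in>B. v i b * mu b)"
        by (simp add: algebra_simps sum_subtractf sum_distrib_left)
      then show ?thesis using 4 vm * by simp
    qed (auto simp: mB vm)
  qed auto
qed

section \<open>Row spaces, their cardinality, and the library rank\<close>

definition row_span :: "'i set \<Rightarrow> 'j set \<Rightarrow> ('i \<Rightarrow> 'j \<Rightarrow> 'f::field) \<Rightarrow> ('j \<Rightarrow> 'f) set" where
  "row_span A B k = range (\<lambda>c b. if b \<in> B then \<Sum>a\<in>A. c a * k a b else 0)"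

text \<open>Coefficients over the rows of \<open>v\<close> are unique because \<open>m\<close>
  inverts \<open>v\<close>, and all of them occur because \<open>l\<close> inverts \<open>u\<close>.
  Dimensions thus become exponents of cardinalities.\<close>

lemma card_row_span:
  fixes k :: "'i \<Rightarrow> 'j \<Rightarrow> 'f::field"
  assumes rk: "has_rank A B k r" and fin: "finite A" "finite B"
  shows "card (row_span A B k) = CARD('f) ^ r"
proof -
  from rk obtain u v l m where "rank_factors A B k r u v l m"
    unfolding has_rank_def by blast
  note * = rank_factorsD[OF this]
  define V where "V d b = (if b \<in> B then \<Sum>i<r. d i * v i b else 0)" for d b
  have *: "bij_betw V ({..<r} \<rightarrow>\<^sub>E UNIV) (row_span A B k)"
    unfolding bij_betw_def
  proof
    have rec: "(\<Sum>b\<in>B. V d b * m b j) = d j" if "j < r" for d j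
    proof -
      have "(\<Sum>b\<in>B. V d b * m b j) = (\<Sum>b\<in>B. \<Sum>i<r. d i * (v i b * m b j))"
        by (intro sum.cong refl) (simp add: V_def sum_distrib_left sum_distrib_right mult_ac)
      also have "\<dots> = (\<Sum>i<r. d i * (\<Sum>b\<in>B. v i b * m b j))"
        by (subst sum.swap) (simp add: sum_distrib_left)
      also have "\<dots> = (\<Sum>i<r. if i = j then d i else 0)"
        using that by (intro sum.cong refl) (simp add: *)
      finally show ?thesis using that by simp
    qed
    show "inj_on V ({..<r} \<rightarrow>\<^sub>E UNIV)"
    proof (rule inj_onI)
      fix d e assume de: "d \<in> {..<r} \<rightarrow>\<^sub>E UNIV" "e \<in> {..<r} \<rightarrow>\<^sub>E (UNIV::'f set)" "V d = V e"
      have "d j = e j" if "j < r" for j using rec[OF that, of d] rec[OF that, of e] de(3) by simp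
      then show "d = e" using de by (intro PiE_ext[of d "{..<r}" _ e]) auto
    qed
    show "V ` ({..<r} \<rightarrow>\<^sub>E UNIV) = row_span A B k"
    proof (intro equalityI subsetI)
      fix f assume "f \<in> V ` ({..<r} \<rightarrow>\<^sub>E UNIV)"
      then obtain d where d: "f = V d" by blast
      define c where "c a = (\<Sum>j<r. d j * l j a)" for a
      have "f b = (if b \<in> B then \<Sum>a\<in>A. c a * k a b else 0)" for b
      proof (cases "b \<in> B")
        case True
        have "(\<Sum>a\<in>A. c a * k a b) = (\<Sum>a\<in>A. \<Sum>j<r. \<Sum>i<r. d j * v i b * (l j a * u a i))"
          using True by (intro sum.cong refl) (simp add: * c_def sum_product mult_ac)
        also have "\<dots> = (\<Sum>j<r. \<Sum>i<r. d j * v i b * (\<Sum>a\<in>A. l j a * u a i))"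
          by (subst sum.swap, rule sum.cong[OF refl], subst sum.swap) (simp add: sum_distrib_left)
        also have "\<dots> = (\<Sum>j<r. \<Sum>i<r. if j = i then d j * v i b else 0)"
          by (intro sum.cong refl) (simp add: *)
        also have "\<dots> = f b" using True by (simp add: d V_def)
        finally show ?thesis using True by simp
      qed (simp add: d V_def)
      then show "f \<in> row_span A B k" unfolding row_span_def by blast
    next
      fix f assume "f \<in> row_span A B k"
      then obtain c where c: "f = (\<lambda>b. if b \<in> B then \<Sum>a\<in>A. c a * k a b else 0)"
        unfolding row_span_def by blast
      define d where "d = restrict (\<lambda>i. \<Sum>a\<in>A. c a * u a i) {..<r}"
      have "(\<Sum>a\<in>A. c a * k a b) = (\<Sum>i<r. d i * v i b)" if "b \<in> B" for b
      proof -
        have "(\<Sum>a\<in>A. c a * k a b) = (\<Sum>a\<in>A. \<Sum>i<r. c a * u a i * v i b)"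
          using that by (intro sum.cong refl) (simp add: * sum_distrib_left mult_ac)
        also have "\<dots> = (\<Sum>i<r. d i * v i b)"
          by (subst sum.swap) (simp add: d_def sum_distrib_right)
        finally show ?thesis .
      qed
      then have "f = V d" by (auto simp: c V_def)
      then show "f \<in> V ` ({..<r} \<rightarrow>\<^sub>E UNIV)" by (auto simp: d_def)
    qed
  qed
  have "card (row_span A B k) = card ({..<r} \<rightarrow>\<^sub>E (UNIV::'f set))"
    using bij_betw_same_card[OF *] by simp
  then show ?thesis by (simp add: card_funcsetE)
qed

text \<open>\<open>K = U V\<close> and \<open>V M = 1\<close> give \<open>K\<close> and
  \<open>U\<close> the same column space; \<open>L U = 1\<close> makes the columns of
  \<open>U\<close> distinct and independent.\<close>

lemma mat_rank_eqI:
  fixes k :: "nat \<Rightarrow> nat \<Rightarrow> 'f::field"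
  assumes rk: "has_rank {..<nr} {..<nc} k r"
  shows "mat_rank (mat nr nc (\<lambda>(i, j). k i j)) = r"
proof -
  from rk obtain u v l m where "rank_factors {..<nr} {..<nc} k r u v l m"
    unfolding has_rank_def by blast
  note * = rank_factorsD[OF this]
  define K where "K = mat nr nc (\<lambda>(i, j). k i j)"
  define U where "U = mat nr r (\<lambda>(i, j). u i j)"
  define V where "V = mat r nc (\<lambda>(i, j). v i j)"
  define L where "L = mat r nr (\<lambda>(i, j). l i j)"
  define M where "M = mat nc r (\<lambda>(i, j). m i j)"
  have carr [simp]: "K \<in> carrier_mat nr nc" "U \<in> carrier_mat nr r" "V \<in> carrier_mat r nc"
    "L \<in> carrier_mat r nr" "M \<in> carrier_mat nc r"
    by (auto simp: K_def U_def V_def L_def M_def)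
  have KUV: "K = U * V"
    by (rule eq_matI) (auto simp: K_def U_def V_def scalar_prod_def * atLeast0LessThan)
  have LU: "L * U = 1\<^sub>m r"
    by (rule eq_matI) (auto simp: L_def U_def scalar_prod_def * atLeast0LessThan)
  have VM: "V * M = 1\<^sub>m r"
    by (rule eq_matI) (auto simp: V_def M_def scalar_prod_def * atLeast0LessThan)
  interpret vec_space "TYPE('f)" nr .
  have dimK: "dim_row K = nr" "dim_col K = nc" "dim_row U = nr" "dim_col U = r"
    by (auto simp: K_def U_def)
  have "col_space K = col_space U"
  proof -
    have "\<exists>y\<in>carrier_vec r. U *\<^sub>v y = K *\<^sub>v x" if x: "x \<in> carrier_vec nc" for x
    proof (rule bexI)
      show "U *\<^sub>v (V *\<^sub>v x) = K *\<^sub>v x" unfolding KUV by (rule assoc_mult_mat_vec[OF carr(2,3) x, symmetric])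
    qed (rule mult_mat_vec_carrier[OF carr(3) x])
    moreover have "\<exists>y\<in>carrier_vec nc. K *\<^sub>v y = U *\<^sub>v x" if x: "x \<in> carrier_vec r" for x
    proof (rule bexI[of _ "M *\<^sub>v x"])
      have "K *\<^sub>v (M *\<^sub>v x) = U *\<^sub>v (V *\<^sub>v (M *\<^sub>v x))"
        unfolding KUV by (rule assoc_mult_mat_vec[OF carr(2,3) mult_mat_vec_carrier[OF carr(5) x]])
      also have "V *\<^sub>v (M *\<^sub>v x) = (V * M) *\<^sub>v x"
        by (rule assoc_mult_mat_vec[OF carr(3,5) x, symmetric])
      also have "\<dots> = x" using x by (simp add: VM)
      finally show "K *\<^sub>v (M *\<^sub>v x) = U *\<^sub>v x" .
    qed (rule mult_mat_vec_carrier[OF carr(5) x])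
    ultimately show ?thesis
      unfolding col_space_eq[OF carr(1)] col_space_eq[OF carr(2)] dimK by (auto 0 3)
  qed
  then have "rank K = rank U" by (simp add: rank_def col_space_def)
  also have "\<dots> = r"
  proof (rule lin_indpt_full_rank[OF carr(2)])
    have inj: "y = 0\<^sub>v r" if "U *\<^sub>v y = 0\<^sub>v nr" "y \<in> carrier_vec r" for y
    proof -
      have "y = (L * U) *\<^sub>v y" using that by (simp add: LU)
      also have "\<dots> = L *\<^sub>v (U *\<^sub>v y)" by (rule assoc_mult_mat_vec[OF carr(4,2) that(2)])
      also have "\<dots> = 0\<^sub>v r" using that by (auto simp: L_def)
      finally show ?thesis .
    qed
    show d: "distinct (cols U)"
      unfolding distinct_conv_nth
    proof (intro allI impI notI)
      fix i j assume ij: "i < length (cols U)" "j < length (cols U)" "i \<noteq> j" "cols U ! i = cols U ! j"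
      then have ij': "i < r" "j < r" by (auto simp: dimK)
      have "col U i = col U j" using ij by (simp add: dimK)
      then have "\<And>a. a < nr \<Longrightarrow> u a i = u a j"
        using ij' by (metis (no_types, lifting) U_def index_col index_mat(1) dimK(3,4) old.prod.case)
      then have "(\<Sum>a<nr. l i a * u a i) = (\<Sum>a<nr. l i a * u a j)" by simp
      then show False using *(2)[of i i] *(2)[of i j] ij ij' by simp
    qed
    show "lin_indpt (set (cols U))"
    proof
      assume "lin_dep (set (cols U))"
      from lin_depE[OF carr(2) this d] obtain y where "y \<in> carrier_vec r" "y \<noteq> 0\<^sub>v r" "U *\<^sub>v y = 0\<^sub>v nr" .
      with inj show False by blast
    qed
  qed
  finally show ?thesis unfolding mat_rank_def K_def[symmetric] dimK .
qed

section \<open>Monomials over a finite field and Kronecker powers\<close>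

text \<open>Polynomials are treated as functions, so that their spaces are finite sets that can be
  counted. The price is that monomials are independent only for exponents below q.\<close>

interpretation fs: vector_space "\<lambda>(c::'a::field) (f::'b \<Rightarrow> 'a) x. c * f x"
  by unfold_locales (auto simp: fun_eq_iff algebra_simps)

lemma sum_fun_apply: "(\<Sum>i\<in>A. f i) x = (\<Sum>i\<in>A. f i x :: 'a::comm_monoid_add)"
  by (induction A rule: infinite_finite_induct) auto

section \<open>Power sums over a finite field\<close>

lemma finite_field_card_pos:
  assumes "finite (UNIV :: 'a::field set)"
  shows "CARD('a) > 1"
proof -
  have "card {0, 1::'a} \<le> CARD('a)" by (rule card_mono) (use assms in auto)
  then show ?thesis by simp
qed

lemma finite_field_of_nat_card:
  assumes "finite (UNIV :: 'a::field set)"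
  shows "of_nat CARD('a) = (0::'a)"
proof -
  have "(\<Sum>x\<in>UNIV. x) = (\<Sum>x\<in>(UNIV::'a set). x + 1)"
    by (rule sum.reindex_bij_witness[of _ "\<lambda>x. x + 1" "\<lambda>x. x - 1"]) auto
  also have "\<dots> = (\<Sum>x\<in>UNIV. x) + of_nat CARD('a)" by (simp add: sum.distrib)
  finally show ?thesis by simp
qed

lemma finite_field_CHAR:
  assumes "finite (UNIV :: 'a::field set)" "CARD('a) = p ^ t" "prime p"
  shows "CHAR('a) = p"
proof -
  have "(of_nat p :: 'a) ^ t = 0"
    using finite_field_of_nat_card[OF assms(1)] assms(2) by simp
  then have "of_nat p = (0::'a)" by simp
  then have "CHAR('a) dvd p" by (simp add: of_nat_eq_0_iff_char_dvd)
  moreover have "CHAR('a) \<noteq> 1" by simp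
  ultimately show ?thesis using assms(3) by (metis prime_nat_iff)
qed

lemma finite_field_power_card_minus_1:
  fixes x :: "'a::field"
  assumes fin: "finite (UNIV :: 'a set)" and "x \<noteq> 0"
  shows "x ^ (CARD('a) - 1) = 1"
proof -
  have "(\<Prod>y\<in>UNIV - {0}. y) = (\<Prod>y\<in>UNIV - {0}. x * y)"
    by (rule prod.reindex_bij_witness[of _ "\<lambda>y. x * y" "\<lambda>y. y / x"]) (use assms in auto)
  also have "\<dots> = x ^ card (UNIV - {0::'a}) * (\<Prod>y\<in>UNIV - {0}. y)" by (simp add: prod.distrib)
  finally have "x ^ card (UNIV - {0::'a}) = 1" using fin by simp
  then show ?thesis using fin by (simp add: card_Diff_singleton)
qed

lemma finite_field_sum_power:
  assumes fin: "finite (UNIV :: 'a::field set)"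
  shows "(\<Sum>c\<in>UNIV. (c::'a) ^ k) = (if k > 0 \<and> (CARD('a) - 1) dvd k then - 1 else 0)"
proof -
  let ?q = "CARD('a)"
  have q1: "?q > 1" by (rule finite_field_card_pos[OF fin])
  consider "k = 0" | "k > 0" "(?q - 1) dvd k" | "\<not> (?q - 1) dvd k" by blast
  then show ?thesis
  proof cases
    case 1
    then show ?thesis using finite_field_of_nat_card[OF fin] by simp
  next
    case 2
    then obtain m where m: "k = (?q - 1) * m" by blast
    have "(\<Sum>c\<in>UNIV. (c::'a) ^ k) = (\<Sum>c\<in>UNIV - {0}. c ^ k)"
      using fin 2 by (simp add: sum.remove[of UNIV "0::'a"] power_0_left)
    also have "\<dots> = (\<Sum>c\<in>UNIV - {0::'a}. 1)"
      by (intro sum.cong refl) (simp add: m power_mult finite_field_power_card_minus_1[OF fin] del: One_nat_def)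
    also have "\<dots> = of_nat (?q - 1)" using fin by (simp add: card_Diff_singleton)
    also have "\<dots> = - 1" using q1 finite_field_of_nat_card[OF fin] by (simp add: of_nat_diff)
    finally show ?thesis using 2 by simp
  next
    case 3
    define r where "r = k mod (?q - 1)"
    have r: "0 < r" "r < ?q - 1" using 3 q1 by (auto simp: r_def mod_greater_zero_iff_not_dvd)
    \<comment> \<open>\<open>X^r - 1\<close> has at most r < q-1 roots, which yields a nonzero
      \<open>g\<close> with \<open>g^k\<close> different from 1 without a generator of the
      multiplicative group. Rescaling the sum by \<open>g\<close> then forces it to be 0.\<close>
    define P where "P = monom 1 r - (1 :: 'a poly)"
    have "coeff P r = 1" using r by (simp add: P_def)
    then have P0: "P \<noteq> 0" by auto
    have "degree P \<le> r" unfolding P_def by (intro degree_diff_le) (auto simp: degree_monom_le)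
    then have "card {x. poly P x = 0} \<le> r" using card_poly_roots_bound[OF P0] by simp
    then have "\<not> UNIV - {0} \<subseteq> {x. poly P x = 0}"
    proof (intro notI)
      assume le: "card {x. poly P x = 0} \<le> r" and sub: "UNIV - {0} \<subseteq> {x. poly P x = 0}"
      have "card (UNIV - {0::'a}) \<le> card {x. poly P x = 0}"
        by (rule card_mono) (use fin sub in \<open>auto intro: finite_subset\<close>)
      then show False using le r fin by (simp add: card_Diff_singleton)
    qed
    then obtain g :: 'a where g: "g \<noteq> 0" "g ^ r \<noteq> 1" by (auto simp: P_def poly_monom)
    have "g ^ k = g ^ ((?q - 1) * (k div (?q - 1)) + r)" by (simp add: r_def)
    also have "\<dots> = g ^ r"
      by (simp add: power_add power_mult finite_field_power_card_minus_1[OF fin g(1)] del: One_nat_def)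
    finally have gk: "g ^ k \<noteq> 1" using g by simp
    have "(\<Sum>c\<in>UNIV. c ^ k) = (\<Sum>c\<in>UNIV. (g * c) ^ k)"
      by (rule sum.reindex_bij_witness[of _ "\<lambda>c. g * c" "\<lambda>c. c / g"]) (use g in auto)
    also have "\<dots> = g ^ k * (\<Sum>c\<in>UNIV. c ^ k)" by (simp add: power_mult_distrib sum_distrib_left)
    finally have "(g ^ k - 1) * (\<Sum>c\<in>UNIV. c ^ k) = 0" by (simp add: algebra_simps)
    then show ?thesis using gk 3 by auto
  qed
qed

text \<open>With \<open>j > 0\<close> all exponents q-1-j+i stay below 2(q-1), so the only positive
  multiple of q-1 is reached at i = j, and an exponent 0 contributes q = 0. For j = 0 the constant
  and the top coefficient would be mixed up.\<close>

lemma sum_poly_coeff: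
  fixes P :: "'a::field poly"
  assumes fin: "finite (UNIV :: 'a set)" and deg: "degree P \<le> CARD('a) - 1"
    and j: "0 < j" "j \<le> CARD('a) - 1"
  shows "(\<Sum>s\<in>UNIV. s ^ (CARD('a) - 1 - j) * poly P s) = - coeff P j"
proof -
  let ?q = "CARD('a)"
  have P: "poly P s = (\<Sum>i\<le>?q - 1. coeff P i * s ^ i)" for s
    unfolding poly_altdef by (rule sum.mono_neutral_left) (use deg in \<open>auto simp: not_le intro: coeff_eq_0\<close>)
  have "(\<Sum>s\<in>UNIV. s ^ (?q - 1 - j) * poly P s) =
      (\<Sum>s\<in>UNIV. \<Sum>i\<le>?q - 1. coeff P i * s ^ (?q - 1 - j + i))"
    by (intro sum.cong refl) (simp add: P sum_distrib_left power_add mult_ac)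
  also have "\<dots> = (\<Sum>i\<le>?q - 1. coeff P i * (\<Sum>s\<in>UNIV. s ^ (?q - 1 - j + i)))"
    by (subst sum.swap) (simp add: sum_distrib_left)
  also have "\<dots> = (\<Sum>i\<le>?q - 1. if i = j then - coeff P i else 0)"
  proof (intro sum.cong refl)
    fix i assume i: "i \<in> {..?q - 1}"
    have "?q - 1 - j + i > 0 \<and> (?q - 1) dvd (?q - 1 - j + i) \<longleftrightarrow> i = j"
    proof
      assume *: "?q - 1 - j + i > 0 \<and> (?q - 1) dvd (?q - 1 - j + i)"
      then obtain m where m: "?q - 1 - j + i = (?q - 1) * m" by blast
      have "m \<noteq> 0" using * m by (metis mult_0_right not_gr_zero)
      moreover have "?q - 1 - j + i < (?q - 1) * 2" using i j by auto
      then have "m < 2" using m by (metis mult_less_cancel1)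
      ultimately have "m = 1" by simp
      then show "i = j" using m j by simp
    qed (use j in auto)
    then show "coeff P i * (\<Sum>s\<in>UNIV. s ^ (?q - 1 - j + i)) = (if i = j then - coeff P i else 0)"
      by (simp add: finite_field_sum_power[OF fin] del: neq0_conv)
  qed
  also have "\<dots> = - coeff P j" using j by simp
  finally show ?thesis .
qed

definition monomial_fun :: "'i set \<Rightarrow> ('i \<Rightarrow> nat) \<Rightarrow> ('i \<Rightarrow> 'a::comm_monoid_mult) \<Rightarrow> 'a" where
  "monomial_fun I e c = (\<Prod>i\<in>I. c i ^ e i)"

text \<open>
  A basis dual to the monomials with exponents below \<open>q\<close>. Exponent 0 needs the indicator of 0: the
  power sum against \<open>-x\<^sup>q\<^sup>-\<^sup>1\<close> does not tell \<open>x\<^sup>q\<^sup>-\<^sup>1\<close> from the constant 1.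
\<close>

definition dual_fun :: "'i set \<Rightarrow> ('i \<Rightarrow> nat) \<Rightarrow> ('i \<Rightarrow> 'a::field) \<Rightarrow> 'a" where
  "dual_fun I e c = (\<Prod>i\<in>I. if e i = 0 then (if c i = 0 then 1 else 0) else - (c i ^ (CARD('a) - 1 - e i)))"

lemma sum_dual_monomial:
  assumes fin: "finite (UNIV :: 'a::field set)" and I: "finite I"
    and e: "\<And>i. i \<in> I \<Longrightarrow> e i < CARD('a)" and e': "\<And>i. i \<in> I \<Longrightarrow> e' i < CARD('a)"
  shows "(\<Sum>c\<in>I \<rightarrow>\<^sub>E (UNIV::'a set). dual_fun I e c * monomial_fun I e' c) = (if \<forall>i\<in>I. e i = e' i then 1 else 0)"
proof -
  let ?q = "CARD('a)"
  let ?f = "\<lambda>i s. (if e i = 0 then (if s = 0 then 1 else 0) else - (s ^ (?q - 1 - e i))) * (s::'a) ^ e' i"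
  have one: "(\<Sum>s\<in>UNIV. ?f i s) = (if e i = e' i then 1 else 0)" if i: "i \<in> I" for i
  proof (cases "e i = 0")
    case True
    have "(\<Sum>s\<in>UNIV. ?f i s) = (\<Sum>s\<in>(UNIV::'a set). if s = 0 then (0::'a) ^ e' i else 0)"
      using True by (intro sum.cong) auto
    then show ?thesis using True fin by (auto simp: power_0_left)
  next
    case False
    have "(\<Sum>s\<in>UNIV. ?f i s) = - (\<Sum>s\<in>UNIV. s ^ (?q - 1 - e i) * poly (monom 1 (e' i)) s)"
      using False by (simp add: sum_negf poly_monom)
    also have "\<dots> = coeff (monom 1 (e' i)) (e i)"
      using False e[OF i] e'[OF i] by (subst sum_poly_coeff[OF fin]) (auto simp: degree_monom_eq)
    finally show ?thesis by auto
  qed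
  have "(\<Sum>c\<in>I \<rightarrow>\<^sub>E (UNIV::'a set). dual_fun I e c * monomial_fun I e' c) =
      (\<Sum>c\<in>I \<rightarrow>\<^sub>E UNIV. \<Prod>i\<in>I. ?f i (c i))"
    by (simp add: dual_fun_def monomial_fun_def prod.distrib)
  also have "\<dots> = (\<Prod>i\<in>I. \<Sum>s\<in>UNIV. ?f i s)"
    by (rule prod_sum_PiE[symmetric]) (use I fin in auto)
  also have "\<dots> = (\<Prod>i\<in>I. if e i = e' i then 1 else 0)" using one by simp
  also have "\<dots> = (if \<forall>i\<in>I. e i = e' i then 1 else 0)"
    using I by (induction I rule: finite_induct) auto
  finally show ?thesis .
qed

lemma sum_dual_monomial_PiE:
  assumes fin: "finite (UNIV :: 'a::field set)" and I: "finite I" and "b \<le> CARD('a)"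
    and e: "e \<in> I \<rightarrow>\<^sub>E {..<b}" "e' \<in> I \<rightarrow>\<^sub>E {..<b}"
  shows "(\<Sum>c\<in>I \<rightarrow>\<^sub>E (UNIV::'a set). dual_fun I e c * monomial_fun I e' c) = (if e = e' then 1 else 0)"
proof -
  have "e i < CARD('a)" "e' i < CARD('a)" if "i \<in> I" for i using e assms(3) that by (auto dest!: PiE_mem)
  moreover have "(\<forall>i\<in>I. e i = e' i) \<longleftrightarrow> e = e'"
    using e by (metis PiE_ext)
  ultimately show ?thesis using sum_dual_monomial[OF fin I, of e e'] by simp
qed

text \<open>The evaluation matrix of the monomials has \<open>dual_fun\<close> as a left inverse, so
  passing from coefficients to values, first in one argument and then in the other, preserves the
  rank.\<close>

lemma has_rank_monomial_expansion:
  fixes k :: "('i \<Rightarrow> 'a::field) \<Rightarrow> ('i \<Rightarrow> 'a) \<Rightarrow> 'a"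
  assumes fin: "finite (UNIV :: 'a set)" and I: "finite I" and b: "b \<le> CARD('a)"
    and rk: "has_rank (I \<rightarrow>\<^sub>E {..<b}) (I \<rightarrow>\<^sub>E {..<b}) a r"
    and k: "\<And>c d. k c d = (\<Sum>e\<in>I \<rightarrow>\<^sub>E {..<b}. \<Sum>e'\<in>I \<rightarrow>\<^sub>E {..<b}. a e e' * monomial_fun I e c * monomial_fun I e' d)"
  shows "has_rank (I \<rightarrow>\<^sub>E UNIV) (I \<rightarrow>\<^sub>E UNIV) k r"
proof -
  let ?E = "I \<rightarrow>\<^sub>E {..<b}" and ?C = "I \<rightarrow>\<^sub>E (UNIV::'a set)"
  have fE: "finite ?E" using I by (intro finite_PiE) auto
  define k1 where "k1 c e' = (\<Sum>e\<in>?E. monomial_fun I e c * a e e')" for c e'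
  have 1: "has_rank ?C ?E k1 r"
    by (rule has_rank_mult_left[OF rk fE, where E' = "dual_fun I" and E = "\<lambda>c e. monomial_fun I e c"])
       (auto simp: sum_dual_monomial_PiE[OF fin I b] k1_def)
  have "has_rank ?C ?C (\<lambda>d c. k c d) r"
  proof (rule has_rank_mult_left[OF has_rank_transpose[OF 1] fE, where E' = "dual_fun I" and E = "\<lambda>c e. monomial_fun I e c"])
    fix c d
    show "k d c = (\<Sum>e'\<in>?E. monomial_fun I e' c * k1 d e')"
      unfolding k k1_def sum_distrib_left by (subst sum.swap) (simp add: mult_ac)
  qed (auto simp: sum_dual_monomial_PiE[OF fin I b])
  from has_rank_transpose[OF this] show ?thesis .
qed

lemma has_rank_unique:
  fixes k :: "'i \<Rightarrow> 'j \<Rightarrow> 'a::field"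
  assumes "finite (UNIV :: 'a set)" "finite A" "finite B" "has_rank A B k r" "has_rank A B k r'"
  shows "r = r'"
proof -
  have "CARD('a) ^ r = CARD('a) ^ r'"
    using card_row_span[OF assms(4,2,3)] card_row_span[OF assms(5,2,3)] by simp
  then show ?thesis using finite_field_card_pos[OF assms(1)] by (simp add: power_inject_exp)
qed

section \<open>Base p digits of exponents and Frobenius twists\<close>

lemma digit_split:
  fixes p m :: nat
  assumes p: "p > 0" and s: "e \<in> I \<rightarrow>\<^sub>E {..<p * m}"
  shows "restrict (\<lambda>i. e i mod p) I \<in> I \<rightarrow>\<^sub>E {..<p}" "restrict (\<lambda>i. e i div p) I \<in> I \<rightarrow>\<^sub>E {..<m}"
  using assms by (auto dest!: PiE_mem simp: less_mult_imp_div_less mult.commute)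

lemma bij_betw_digits:
  fixes p m :: nat
  assumes p: "p > 0"
  shows "bij_betw (\<lambda>e. (restrict (\<lambda>i. e i mod p) I, restrict (\<lambda>i. e i div p) I))
    (I \<rightarrow>\<^sub>E {..<p * m}) ((I \<rightarrow>\<^sub>E {..<p}) \<times> (I \<rightarrow>\<^sub>E {..<m}))"
proof (rule bij_betw_byWitness[where f' = "\<lambda>(f, g). restrict (\<lambda>i. f i + p * g i) I"])
  show "\<forall>e\<in>I \<rightarrow>\<^sub>E {..<p * m}. (case (restrict (\<lambda>i. e i mod p) I, restrict (\<lambda>i. e i div p) I) of
      (f, g) \<Rightarrow> restrict (\<lambda>i. f i + p * g i) I) = e"
    by (auto simp: fun_eq_iff restrict_def PiE_def extensional_def)
  show "\<forall>z\<in>(I \<rightarrow>\<^sub>E {..<p}) \<times> (I \<rightarrow>\<^sub>E {..<m}).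
       (restrict (\<lambda>i. (case z of (f, g) \<Rightarrow> restrict (\<lambda>i. f i + p * g i) I) i mod p) I,
        restrict (\<lambda>i. (case z of (f, g) \<Rightarrow> restrict (\<lambda>i. f i + p * g i) I) i div p) I) = z"
  proof clarify
    fix f g assume f: "f \<in> I \<rightarrow>\<^sub>E {..<p}" and g: "g \<in> I \<rightarrow>\<^sub>E {..<m}"
    have fi: "f i < p" if "i \<in> I" for i using f that by (auto dest: PiE_mem)
    have "restrict (\<lambda>i. restrict (\<lambda>i. f i + p * g i) I i mod p) I = f"
      by (rule extensionalityI[of _ I]) (use f fi in \<open>auto simp: PiE_iff\<close>)
    moreover have "restrict (\<lambda>i. restrict (\<lambda>i. f i + p * g i) I i div p) I = g"
      by (rule extensionalityI[of _ I]) (use g fi p in \<open>auto simp: PiE_iff\<close>)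
    ultimately show "restrict (\<lambda>i. restrict (\<lambda>i. f i + p * g i) I i mod p) I = f \<and>
      restrict (\<lambda>i. restrict (\<lambda>i. f i + p * g i) I i div p) I = g" by blast
  qed
  show "(\<lambda>e. (restrict (\<lambda>i. e i mod p) I, restrict (\<lambda>i. e i div p) I)) ` (I \<rightarrow>\<^sub>E {..<p * m})
    \<subseteq> (I \<rightarrow>\<^sub>E {..<p}) \<times> (I \<rightarrow>\<^sub>E {..<m})"
    by (intro image_subsetI SigmaI digit_split[OF p])
  have less: "a + p * b < p * m" if "a < p" "b < m" for a b
  proof -
    have "a + p * b < p * Suc b" using that by simp
    also have "\<dots> \<le> p * m" using that by (intro mult_le_mono2) simp
    finally show ?thesis .
  qed
  show "(\<lambda>(f, g). restrict (\<lambda>i. f i + p * g i) I) ` ((I \<rightarrow>\<^sub>E {..<p}) \<times> (I \<rightarrow>\<^sub>E {..<m})) \<subseteq> I \<rightarrow>\<^sub>E {..<p * m}"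
  proof clarify
    fix f g assume "f \<in> I \<rightarrow>\<^sub>E {..<p}" "g \<in> I \<rightarrow>\<^sub>E {..<m}"
    then have "f i + p * g i < p * m" if "i \<in> I" for i
      using less[of "f i" "g i"] that by (auto dest: PiE_mem)
    then show "restrict (\<lambda>i. f i + p * g i) I \<in> I \<rightarrow>\<^sub>E {..<p * m}"
      by (simp add: restrict_PiE_iff)
  qed
qed

lemma monomial_fun_digits:
  fixes c :: "'i \<Rightarrow> 'a::comm_semiring_1"
  shows "monomial_fun I (restrict (\<lambda>i. e i mod p) I) c * monomial_fun I (restrict (\<lambda>i. e i div p) I) c ^ p
    = monomial_fun I e c"
proof -
  have "monomial_fun I (restrict (\<lambda>i. e i mod p) I) c * monomial_fun I (restrict (\<lambda>i. e i div p) I) c ^ p =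
    (\<Prod>i\<in>I. c i ^ (e i mod p) * (c i ^ (e i div p)) ^ p)"
    by (simp add: monomial_fun_def prod.distrib prod_power_distrib)
  also have "\<dots> = monomial_fun I e c"
    unfolding monomial_fun_def
    by (intro prod.cong refl) (simp flip: power_mult power_add)
  finally show ?thesis .
qed

text \<open>The i-th twist contributes p^i times an exponent below p in every coordinate. Distinct
  tuples of digits give distinct exponents, so no two terms of the expanded product merge and each
  coefficient is one product of Frobenius images of entries of \<open>a\<close>.\<close>

lemma has_rank_twist_product:
  fixes k :: "('i \<Rightarrow> 'a::field) \<Rightarrow> ('i \<Rightarrow> 'a) \<Rightarrow> 'a"
  assumes fin: "finite (UNIV :: 'a set)" and I: "finite I" and p: "prime p" and q: "CARD('a) = p ^ t" "t \<ge> 1"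
    and rk: "has_rank (I \<rightarrow>\<^sub>E UNIV) (I \<rightarrow>\<^sub>E UNIV) k r"
    and k: "\<And>c d. k c d = (\<Sum>e\<in>I \<rightarrow>\<^sub>E {..<p}. \<Sum>e'\<in>I \<rightarrow>\<^sub>E {..<p}. a e e' * monomial_fun I e c * monomial_fun I e' d)"
  shows "has_rank (I \<rightarrow>\<^sub>E UNIV) (I \<rightarrow>\<^sub>E UNIV) (\<lambda>c d. \<Prod>i<t. k c d ^ (p ^ i)) (r ^ t)"
proof -
  have char: "CHAR('a) = p" by (rule finite_field_CHAR[OF fin q(1) p])
  have pc: "prime CHAR('a)" using p char by simp
  have p0: "p > 0" using p prime_gt_0_nat by blast
  have fE: "finite (I \<rightarrow>\<^sub>E {..<b::nat})" for b using I by (intro finite_PiE) auto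
  \<comment> \<open>The Kronecker product is formed from the coefficient array \<open>a\<close>; the
    monomial expansion and uniqueness show that its rank is \<open>r\<close> too.\<close>
  obtain r' where r': "has_rank (I \<rightarrow>\<^sub>E {..<p}) (I \<rightarrow>\<^sub>E {..<p}) a r'"
    using has_rank_exists[OF fE fE] by blast
  have "p \<le> CARD('a)" using q p0 by (metis power_one_right power_increasing Suc_leI One_nat_def)
  then have "has_rank (I \<rightarrow>\<^sub>E UNIV) (I \<rightarrow>\<^sub>E UNIV) k r'"
    by (rule has_rank_monomial_expansion[OF fin I _ r' k])
  then have rr: "r' = r" using has_rank_unique[OF fin _ _ _ rk] I fin by (simp add: finite_PiE)
  have *: "\<exists>b. has_rank (I \<rightarrow>\<^sub>E {..<p ^ s}) (I \<rightarrow>\<^sub>E {..<p ^ s}) b (r ^ s) \<and>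
     (\<forall>c d. (\<Prod>i<s. k c d ^ (p ^ i)) = (\<Sum>e\<in>I \<rightarrow>\<^sub>E {..<p ^ s}. \<Sum>e'\<in>I \<rightarrow>\<^sub>E {..<p ^ s}.
        b e e' * monomial_fun I e c * monomial_fun I e' d))" for s
  proof (induction s)
    case 0
    have E0: "I \<rightarrow>\<^sub>E {..<Suc 0} = {restrict (\<lambda>_. 0) I}"
      by (auto simp: PiE_def Pi_def extensional_def fun_eq_iff restrict_def)
    have "has_rank {x} {x} (\<lambda>_ _. 1 :: 'a) 1" for x :: "'i \<Rightarrow> nat"
      by (rule has_rankI[of "{()}" _ _ _ _ "\<lambda>_ _. 1" "\<lambda>_ _. 1" "\<lambda>_ _. 1" "\<lambda>_ _. 1"]) auto
    then show ?case
      by (intro exI[of _ "\<lambda>_ _. 1"]) (simp add: E0 monomial_fun_def)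
  next
    case (Suc s)
    then obtain b where b: "has_rank (I \<rightarrow>\<^sub>E {..<p ^ s}) (I \<rightarrow>\<^sub>E {..<p ^ s}) b (r ^ s)"
      and bk: "\<And>c d. (\<Prod>i<s. k c d ^ (p ^ i)) = (\<Sum>e\<in>I \<rightarrow>\<^sub>E {..<p ^ s}. \<Sum>e'\<in>I \<rightarrow>\<^sub>E {..<p ^ s}.
        b e e' * monomial_fun I e c * monomial_fun I e' d)" by blast
    define h where "h e = (restrict (\<lambda>i. e i mod p) I, restrict (\<lambda>i. e i div p) I)" for e :: "'i \<Rightarrow> nat"
    have bij: "bij_betw h (I \<rightarrow>\<^sub>E {..<p ^ Suc s}) ((I \<rightarrow>\<^sub>E {..<p}) \<times> (I \<rightarrow>\<^sub>E {..<p ^ s}))"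
      unfolding h_def power_Suc by (rule bij_betw_digits[OF p0])
    define B where "B e e' = a (fst (h e)) (fst (h e')) * b (snd (h e)) (snd (h e')) ^ p" for e e'
    have "has_rank (I \<rightarrow>\<^sub>E {..<p ^ s}) (I \<rightarrow>\<^sub>E {..<p ^ s}) (\<lambda>e e'. b e e' ^ p) (r ^ s)"
      by (rule has_rank_hom[OF _ _ _ b]) (auto simp: power_mult_distrib freshmans_dream[OF pc] char)
    from has_rank_prod[OF r' this]
    have "has_rank (I \<rightarrow>\<^sub>E {..<p ^ Suc s}) (I \<rightarrow>\<^sub>E {..<p ^ Suc s}) B (r' * r ^ s)"
      unfolding B_def bij_betw_imp_surj_on[OF bij, symmetric] by (rule has_rank_surj[OF _ fE fE])
    moreover have "(\<Prod>i<Suc s. k c d ^ (p ^ i)) = (\<Sum>e\<in>I \<rightarrow>\<^sub>E {..<p ^ Suc s}. \<Sum>e'\<in>I \<rightarrow>\<^sub>E {..<p ^ Suc s}.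
        B e e' * monomial_fun I e c * monomial_fun I e' d)" for c d
    proof -
      let ?P = "(I \<rightarrow>\<^sub>E {..<p}) \<times> (I \<rightarrow>\<^sub>E {..<p ^ s})"
      \<comment> \<open>Splitting off the factor i = 0 leaves the p-th power of the previous
        product: \<open>k\<close> governs the lowest digit, the Frobenius image of \<open>b\<close>
        the higher ones.\<close>
      have "(\<Prod>i<Suc s. k c d ^ (p ^ i)) = k c d * (\<Prod>i<s. k c d ^ (p ^ i)) ^ p"
        unfolding prod.lessThan_Suc_shift prod_power_distrib by (simp add: power_mult[symmetric] mult.commute)
      also have "(\<Prod>i<s. k c d ^ (p ^ i)) ^ p = (\<Sum>e\<in>I \<rightarrow>\<^sub>E {..<p ^ s}. \<Sum>e'\<in>I \<rightarrow>\<^sub>E {..<p ^ s}.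
        b e e' ^ p * monomial_fun I e c ^ p * monomial_fun I e' d ^ p)"
        unfolding bk freshmans_dream_sum[OF pc char[symmetric]] by (simp add: power_mult_distrib)
      also have "k c d * \<dots> = (\<Sum>x\<in>?P. (\<Sum>e'\<in>I \<rightarrow>\<^sub>E {..<p}. a (fst x) e' * monomial_fun I (fst x) c * monomial_fun I e' d)
          * (\<Sum>e'\<in>I \<rightarrow>\<^sub>E {..<p ^ s}. b (snd x) e' ^ p * monomial_fun I (snd x) c ^ p * monomial_fun I e' d ^ p))"
        unfolding k by (subst sum_product, subst sum.cartesian_product) (simp add: case_prod_beta)
      also have "\<dots> = (\<Sum>x\<in>?P. \<Sum>y\<in>?P. a (fst x) (fst y) * monomial_fun I (fst x) c * monomial_fun I (fst y) d
          * (b (snd x) (snd y) ^ p * monomial_fun I (snd x) c ^ p * monomial_fun I (snd y) d ^ p))"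
        by (intro sum.cong refl) (simp add: sum_product sum.cartesian_product case_prod_beta)
      also have "\<dots> = (\<Sum>e\<in>I \<rightarrow>\<^sub>E {..<p ^ Suc s}. \<Sum>e'\<in>I \<rightarrow>\<^sub>E {..<p ^ Suc s}.
          a (fst (h e)) (fst (h e')) * monomial_fun I (fst (h e)) c * monomial_fun I (fst (h e')) d
          * (b (snd (h e)) (snd (h e')) ^ p * monomial_fun I (snd (h e)) c ^ p * monomial_fun I (snd (h e')) d ^ p))"
        by (subst sum.reindex_bij_betw[OF bij, symmetric], rule sum.cong[OF refl],
            subst sum.reindex_bij_betw[OF bij, symmetric], rule refl)
      also have "\<dots> = (\<Sum>e\<in>I \<rightarrow>\<^sub>E {..<p ^ Suc s}. \<Sum>e'\<in>I \<rightarrow>\<^sub>E {..<p ^ Suc s}.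
        B e e' * (monomial_fun I (fst (h e)) c * monomial_fun I (snd (h e)) c ^ p)
          * (monomial_fun I (fst (h e')) d * monomial_fun I (snd (h e')) d ^ p))"
        by (intro sum.cong refl) (simp add: B_def mult_ac)
      finally show ?thesis by (simp add: h_def monomial_fun_digits)
    qed
    ultimately show ?case using rr by (intro exI[of _ B]) simp
  qed
  from *[of t] obtain b where b: "has_rank (I \<rightarrow>\<^sub>E {..<p ^ t}) (I \<rightarrow>\<^sub>E {..<p ^ t}) b (r ^ t)"
     "\<And>c d. (\<Prod>i<t. k c d ^ (p ^ i)) = (\<Sum>e\<in>I \<rightarrow>\<^sub>E {..<p ^ t}. \<Sum>e'\<in>I \<rightarrow>\<^sub>E {..<p ^ t}.
        b e e' * monomial_fun I e c * monomial_fun I e' d)" by blast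
  show ?thesis
    by (rule has_rank_monomial_expansion[OF fin I _ b]) (simp add: q)
qed

lemma prod_power_twists:
  fixes x :: "'a::comm_monoid_mult"
  assumes "p > (0::nat)"
  shows "(\<Prod>i<t. (x ^ (p - 1)) ^ (p ^ i)) = x ^ (p ^ t - 1)"
proof -
  have "Suc ((p - 1) * (\<Sum>i<t. p ^ i)) = p ^ t"
  proof (induction t)
    case (Suc t)
    have "Suc ((p - 1) * (\<Sum>i<Suc t. p ^ i)) = p ^ t + (p - 1) * p ^ t"
      by (simp add: distrib_left Suc[symmetric])
    also have "\<dots> = (1 + (p - 1)) * p ^ t" by (simp add: distrib_right)
    finally show ?case using assms by simp
  qed simp
  then have "(p - 1) * (\<Sum>i<t. p ^ i) = p ^ t - 1" by simp
  moreover have "(\<Prod>i<t. (x ^ (p - 1)) ^ (p ^ i)) = x ^ ((p - 1) * (\<Sum>i<t. p ^ i))"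
    by (simp add: power_sum power_mult)
  ultimately show ?thesis by simp
qed

section \<open>Counting in finite vector spaces\<close>

text \<open>Each fibre is a translate of the kernel. This counting form takes the place of
  rank-nullity throughout.\<close>

lemma card_image_kernel:
  fixes f :: "'x::ab_group_add \<Rightarrow> 'y::ab_group_add"
  assumes fin: "finite A" and ne: "A \<noteq> {}" and diff: "\<And>x y. x \<in> A \<Longrightarrow> y \<in> A \<Longrightarrow> x - y \<in> A"
    and f: "\<And>x y. x \<in> A \<Longrightarrow> y \<in> A \<Longrightarrow> f (x - y) = f x - f y"
  shows "card A = card (f ` A) * card {x \<in> A. f x = 0}"
proof -
  have zero: "0 \<in> A" using ne diff by fastforce
  have add: "x + y \<in> A" if "x \<in> A" "y \<in> A" for x y
    using diff[OF that(1) diff[OF zero that(2)]] by simp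
  have fadd: "f (x + y) = f x + f y" if "x \<in> A" "y \<in> A" for x y
    using f[OF add[OF that] that(2)] by simp
  have "card A = (\<Sum>y\<in>f ` A. card {x \<in> A. f x = y})"
    using sum.image_gen[OF fin, of "\<lambda>_. 1 :: nat" f] by simp
  also have "\<dots> = (\<Sum>y\<in>f ` A. card {x \<in> A. f x = 0})"
  proof (intro sum.cong refl)
    fix y assume "y \<in> f ` A"
    then obtain a where a: "a \<in> A" "y = f a" by blast
    show "card {x \<in> A. f x = y} = card {x \<in> A. f x = 0}"
      by (rule bij_betw_same_card[of "\<lambda>x. x - a"], rule bij_betw_byWitness[where f' = "\<lambda>x. x + a"])
         (use a diff add f fadd in auto)
  qed
  finally show ?thesis by simp
qed

context vector_space
begin

lemma span_image_eq:
  assumes "finite E"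
  shows "span (g ` E) = range (\<lambda>a. \<Sum>e\<in>E. scale (a e) (g e))"
proof
  have "range (\<lambda>a. \<Sum>e\<in>E. scale (a e) (g e)) \<subseteq> span (g ` E)"
    by (intro image_subsetI span_sum span_scale span_base) auto
  then show "range (\<lambda>a. \<Sum>e\<in>E. scale (a e) (g e)) \<subseteq> span (g ` E)" .
  show "span (g ` E) \<subseteq> range (\<lambda>a. \<Sum>e\<in>E. scale (a e) (g e))"
  proof (rule span_minimal)
    show "g ` E \<subseteq> range (\<lambda>a. \<Sum>e\<in>E. scale (a e) (g e))"
    proof (rule image_subsetI)
      fix x assume x: "x \<in> E"
      have "(\<Sum>e\<in>E. scale (if e = x then 1 else 0) (g e)) = (\<Sum>e\<in>E. if e = x then g e else 0)"
        by (intro sum.cong refl) simp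
      also have "\<dots> = g x" using x assms by simp
      finally show "g x \<in> range (\<lambda>a. \<Sum>e\<in>E. scale (a e) (g e))"
        by (intro image_eqI[of _ _ "\<lambda>e. if e = x then 1 else 0"]) auto
    qed
    show "subspace (range (\<lambda>a. \<Sum>e\<in>E. scale (a e) (g e)))"
    proof (rule subspaceI)
      show "0 \<in> range (\<lambda>a. \<Sum>e\<in>E. scale (a e) (g e))"
        by (intro image_eqI[of _ _ "\<lambda>_. 0"]) auto
    next
      fix x y assume "x \<in> range (\<lambda>a. \<Sum>e\<in>E. scale (a e) (g e))" "y \<in> range (\<lambda>a. \<Sum>e\<in>E. scale (a e) (g e))"
      then obtain a b where "x = (\<Sum>e\<in>E. scale (a e) (g e))" "y = (\<Sum>e\<in>E. scale (b e) (g e))" by blast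
      then show "x + y \<in> range (\<lambda>a. \<Sum>e\<in>E. scale (a e) (g e))"
        by (intro image_eqI[of _ _ "\<lambda>e. a e + b e"]) (auto simp: scale_left_distrib sum.distrib)
    next
      fix c x assume "x \<in> range (\<lambda>a. \<Sum>e\<in>E. scale (a e) (g e))"
      then obtain a where "x = (\<Sum>e\<in>E. scale (a e) (g e))" by blast
      then show "scale c x \<in> range (\<lambda>a. \<Sum>e\<in>E. scale (a e) (g e))"
        by (intro image_eqI[of _ _ "\<lambda>e. c * a e"]) (auto simp: scale_sum_right)
    qed
  qed
qed

lemma card_span_family:
  assumes fin: "finite (UNIV :: 'a set)" and E: "finite E"
    and ind: "\<And>a e. (\<Sum>e\<in>E. scale (a e) (g e)) = 0 \<Longrightarrow> e \<in> E \<Longrightarrow> a e = 0"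
  shows "card (span (g ` E)) = CARD('a) ^ card E"
proof -
  let ?F = "\<lambda>a. \<Sum>e\<in>E. scale (a e) (g e)"
  have "bij_betw ?F (E \<rightarrow>\<^sub>E UNIV) (span (g ` E))"
    unfolding bij_betw_def
  proof
    show "inj_on ?F (E \<rightarrow>\<^sub>E UNIV)"
    proof (rule inj_onI)
      fix a b assume ab: "a \<in> E \<rightarrow>\<^sub>E UNIV" "b \<in> E \<rightarrow>\<^sub>E (UNIV::'a set)" "?F a = ?F b"
      have "(\<Sum>e\<in>E. scale (a e - b e) (g e)) = 0"
        using ab(3) by (simp add: scale_left_diff_distrib sum_subtractf)
      from ind[OF this] have "a e = b e" if "e \<in> E" for e using that by fastforce
      then show "a = b" using ab by (intro PiE_ext[of a E _ b]) auto
    qed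
    have "?F a \<in> ?F ` (E \<rightarrow>\<^sub>E UNIV)" for a
      by (intro image_eqI[of _ _ "restrict a E"]) auto
    then show "?F ` (E \<rightarrow>\<^sub>E UNIV) = span (g ` E)"
      unfolding span_image_eq[OF E] by auto
  qed
  from bij_betw_same_card[OF this] show ?thesis
    using E by (simp add: card_funcsetE)
qed

lemma card_span_independent:
  assumes "finite (UNIV :: 'a set)" "finite S" "independent S"
  shows "card (span S) = CARD('a) ^ card S"
proof -
  have "card (span ((\<lambda>x. x) ` S)) = CARD('a) ^ card S"
    by (rule card_span_family) (use assms independentD[OF assms(3,2) subset_refl] in auto)
  then show ?thesis by simp
qed

end

lemma span_fun_mult:
  fixes A B C :: "('b \<Rightarrow> 'a::field) set"
  assumes f: "f \<in> fs.span A" and g: "g \<in> fs.span B"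
    and AB: "\<And>a b. a \<in> A \<Longrightarrow> b \<in> B \<Longrightarrow> (\<lambda>x. a x * b x) \<in> fs.span C"
  shows "(\<lambda>x. f x * g x) \<in> fs.span C"
  using f
proof (induction rule: fs.span_induct_alt)
  case base
  then show ?case using fs.span_zero[of C] by (simp add: zero_fun_def)
next
  case (step c a y)
  have "(\<lambda>x. a x * g x) \<in> fs.span C"
    using g
  proof (induction rule: fs.span_induct_alt)
    case base
    then show ?case using fs.span_zero[of C] by (simp add: zero_fun_def)
  next
    case (step d b z)
    have "(\<lambda>x. d * (a x * b x)) + (\<lambda>x. a x * z x) \<in> fs.span C"
      by (intro fs.span_add fs.span_scale AB step \<open>a \<in> A\<close>)
    then show ?case by (simp add: plus_fun_def algebra_simps)
  qed
  then have "(\<lambda>x. c * (a x * g x)) + (\<lambda>x. y x * g x) \<in> fs.span C"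
    by (intro fs.span_add fs.span_scale step)
  then show ?case by (simp add: plus_fun_def algebra_simps)
qed

lemma span_fun_comp:
  fixes A :: "('b \<Rightarrow> 'a::field) set"
  assumes f: "f \<in> fs.span A" and A: "\<And>a. a \<in> A \<Longrightarrow> (\<lambda>x. a (h x)) \<in> fs.span C"
  shows "(\<lambda>x. f (h x)) \<in> fs.span C"
  using f
proof (induction rule: fs.span_induct_alt)
  case base
  then show ?case using fs.span_zero[of C] by (simp add: zero_fun_def)
next
  case (step c a y)
  have "(\<lambda>x. c * a (h x)) + (\<lambda>x. y (h x)) \<in> fs.span C"
    by (intro fs.span_add fs.span_scale A step)
  then show ?case by (simp add: plus_fun_def)
qed

lemma monomial_fun_mult:
  fixes c :: "'i \<Rightarrow> 'a::comm_semiring_1"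
  shows "monomial_fun I e c * monomial_fun I e' c = monomial_fun I (restrict (\<lambda>i. e i + e' i) I) c"
  by (simp add: monomial_fun_def power_add prod.distrib)

lemma monomial_fun_unit:
  fixes c :: "'i \<Rightarrow> 'a::comm_semiring_1"
  assumes "finite I" "s \<in> I"
  shows "monomial_fun I (restrict (\<lambda>i. if i = s then 1 else 0) I) c = c s"
proof -
  have "monomial_fun I (restrict (\<lambda>i. if i = s then 1 else 0) I) c = (\<Prod>i\<in>I. if i = s then c i else 1)"
    unfolding monomial_fun_def by (intro prod.cong) auto
  then show ?thesis using assms by simp
qed

text \<open>Two bounds are tracked together: the bound \<open>b\<close> on single exponents, to be
  kept below q, makes monomials independent as functions, and the total degree \<open>j\<close>
  separates homogeneous components.\<close>

definition homog_exps :: "'i set \<Rightarrow> nat \<Rightarrow> nat \<Rightarrow> ('i \<Rightarrow> nat) set" where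
  "homog_exps I b j = {e \<in> I \<rightarrow>\<^sub>E {..b}. sum e I = j}"

abbreviation homog_span :: "'i set \<Rightarrow> nat \<Rightarrow> nat \<Rightarrow> (('i \<Rightarrow> 'a::field) \<Rightarrow> 'a) set" where
  "homog_span I b j \<equiv> fs.span (monomial_fun I ` homog_exps I b j)"

lemma finite_homog_exps: "finite I \<Longrightarrow> finite (homog_exps I b j)"
  unfolding homog_exps_def by (intro finite_subset[OF _ finite_PiE[of I "\<lambda>_. {..b}"]]) auto

lemma homog_span_mult:
  assumes "f \<in> homog_span I b j" "g \<in> homog_span I b' j'"
  shows "(\<lambda>x. f x * g x) \<in> homog_span I (b + b') (j + j')"
  using assms
proof (rule span_fun_mult)
  fix u v :: "('a \<Rightarrow> 'b) \<Rightarrow> 'b"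
  assume "u \<in> monomial_fun I ` homog_exps I b j" "v \<in> monomial_fun I ` homog_exps I b' j'"
  then obtain e e' where e: "e \<in> homog_exps I b j" "u = monomial_fun I e"
    and e': "e' \<in> homog_exps I b' j'" "v = monomial_fun I e'" by blast
  have "restrict (\<lambda>i. e i + e' i) I \<in> homog_exps I (b + b') (j + j')"
    using e e' by (auto simp: homog_exps_def sum.distrib PiE_iff add_mono)
  then show "(\<lambda>x. u x * v x) \<in> homog_span I (b + b') (j + j')"
    by (auto simp: e e' monomial_fun_mult intro!: fs.span_base)
qed

lemma homog_span_one: "(\<lambda>x. 1) \<in> homog_span I 0 0"
proof -
  have "restrict (\<lambda>_. 0) I \<in> homog_exps I 0 0" by (auto simp: homog_exps_def)
  moreover have "(\<lambda>x. 1) = monomial_fun I (restrict (\<lambda>_. 0) I)" by (auto simp: monomial_fun_def)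
  ultimately show ?thesis by (intro fs.span_base) auto
qed

lemma homog_span_power:
  assumes "f \<in> homog_span I b j"
  shows "(\<lambda>x. f x ^ k) \<in> homog_span I (k * b) (k * j)"
proof (induction k)
  case 0
  then show ?case using homog_span_one by simp
next
  case (Suc k)
  then show ?case using homog_span_mult[OF assms Suc] by simp
qed

lemma homog_span_coord:
  assumes I: "finite I" "s \<in> I"
  shows "(\<lambda>c. c s :: 'a::field) \<in> homog_span I 1 1"
proof -
  let ?e = "restrict (\<lambda>i. if i = s then 1 else 0) I"
  have "?e \<in> homog_exps I 1 1" using I by (auto simp: homog_exps_def)
  then have "monomial_fun I ?e \<in> (homog_span I 1 1 :: (_ \<Rightarrow> 'a) set)"
    by (intro fs.span_base imageI)
  also have "monomial_fun I ?e = (\<lambda>c. c s :: 'a)"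
    by (intro ext) (rule monomial_fun_unit[OF I])
  finally show ?thesis .
qed

text \<open>Distinct coordinates keep every single exponent at most 1 although the total degree is
  2.\<close>

lemma homog_span_coord2:
  assumes I: "finite I" "s \<in> I" "s' \<in> I" "s \<noteq> s'"
  shows "(\<lambda>c. c s * c s' :: 'a::field) \<in> homog_span I 1 2"
proof -
  let ?e = "\<lambda>s. restrict (\<lambda>i. if i = s then 1 else 0) I :: _ \<Rightarrow> nat"
  let ?f = "restrict (\<lambda>i. ?e s i + ?e s' i) I"
  have "?f \<in> homog_exps I 1 2" using I by (auto simp: homog_exps_def sum.distrib)
  then have "monomial_fun I ?f \<in> (homog_span I 1 2 :: (_ \<Rightarrow> 'a) set)"
    by (intro fs.span_base imageI)
  also have "monomial_fun I ?f = (\<lambda>c. c s * c s' :: 'a)"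
    unfolding monomial_fun_mult[symmetric] by (simp only: monomial_fun_unit[OF I(1,2)] monomial_fun_unit[OF I(1,3)])
  finally show ?thesis .
qed

lemma homog_span_mono:
  assumes "b \<le> b'"
  shows "homog_span I b j \<subseteq> homog_span I b' j"
  by (intro fs.span_mono image_mono) (use assms in \<open>fastforce simp: homog_exps_def PiE_iff\<close>)

lemma monomials_independent:
  fixes a :: "('i \<Rightarrow> nat) \<Rightarrow> 'a::field"
  assumes fin: "finite (UNIV :: 'a set)" and I: "finite I" and E: "E \<subseteq> I \<rightarrow>\<^sub>E {..<CARD('a)}"
    and 0: "\<And>c. (\<Sum>e\<in>E. a e * monomial_fun I e c) = 0" and e: "e \<in> E"
  shows "a e = 0"
proof -
  have fE: "finite E" by (rule finite_subset[OF E]) (use I in \<open>auto intro: finite_PiE\<close>)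
  have "0 = (\<Sum>c\<in>I \<rightarrow>\<^sub>E (UNIV::'a set). dual_fun I e c * (\<Sum>e'\<in>E. a e' * monomial_fun I e' c))"
    using 0 by simp
  also have "\<dots> = (\<Sum>e'\<in>E. a e' * (\<Sum>c\<in>I \<rightarrow>\<^sub>E (UNIV::'a set). dual_fun I e c * monomial_fun I e' c))"
    unfolding sum_distrib_left by (subst sum.swap) (simp add: mult_ac)
  also have "\<dots> = (\<Sum>e'\<in>E. if e = e' then a e' else 0)"
    using sum_dual_monomial_PiE[OF fin I order_refl] E e by (intro sum.cong refl) (auto simp: subset_iff)
  also have "\<dots> = a e" using e fE by simp
  finally show ?thesis by simp
qed

section \<open>Quadratic spaces over finite fields\<close>

locale quadric = vector_space scale
  for scale :: "'a::field \<Rightarrow> 'v::ab_group_add \<Rightarrow> 'v" (infixr "*s" 75) +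
  fixes Q :: "'v \<Rightarrow> 'a"
  assumes qf: "quadratic_form scale Q" and nondeg: "nondegenerate Q"
    and finF: "finite (UNIV :: 'a set)" and finV: "finite (UNIV :: 'v set)"
begin

abbreviation B where "B \<equiv> polar_form Q"

lemma finite_V [simp]: "finite (A :: 'v set)"
  by (rule finite_subset[OF subset_UNIV finV])

lemma Q_scale: "Q (c *s v) = c\<^sup>2 * Q v" using qf by (simp add: quadratic_form_def)

lemma
  shows B_add_right: "B v (w + w') = B v w + B v w'"
    and B_scale_right: "B v (c *s w) = c * B v w"
    and B_add_left: "B (w + w') v = B w v + B w' v"
    and B_scale_left: "B (c *s w) v = c * B w v"
  using qf unfolding quadratic_form_def Vector_Spaces.linear_iff by auto

lemma B_sym: "B v w = B w v" by (simp add: polar_form_def add.commute)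

lemma B_zero [simp]: "B v 0 = 0" "B 0 v = 0"
  using B_scale_right[of v 0 0] B_scale_left[of 0 0 v] by auto

lemma B_minus [simp]: "B v (- w) = - B v w" "B (- v) w = - B v w"
  using B_scale_right[of v "- 1" w] B_scale_left[of "- 1" v w] by auto

lemma B_diff: "B v (w - w') = B v w - B v w'" "B (w - w') v = B w v - B w' v"
  using B_add_right[of v w "- w'"] B_add_left[of w "- w'" v] by auto

lemma B_sum: "B v (\<Sum>i\<in>I. f i) = (\<Sum>i\<in>I. B v (f i))" "B (\<Sum>i\<in>I. f i) v = (\<Sum>i\<in>I. B (f i) v)"
  by (induction I rule: infinite_finite_induct) (auto simp: B_add_right B_add_left)

lemmas B_lin = B_add_right B_add_left B_scale_right B_scale_left B_diff

lemma Q_add: "Q (v + w) = Q v + Q w + B v w" by (simp add: polar_form_def)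

lemma Q_zero [simp]: "Q 0 = 0" using Q_scale[of 0 0] by simp

lemma Q_minus [simp]: "Q (- v) = Q v" using Q_scale[of "- 1" v] by simp

lemma Q_diff: "Q (v - w) = Q v + Q w - B v w" using Q_add[of v "- w"] by simp

lemma B_self: "B v v = 2 * Q v"
proof -
  have "v + v = 2 *s v" using scale_left_distrib[of 1 1 v] by simp
  then show ?thesis using Q_scale[of 2 v] by (simp add: polar_form_def)
qed

lemma nonradical:
  assumes "Q x = 0" "x \<noteq> 0" shows "\<exists>y. B x y \<noteq> 0"
proof (rule ccontr)
  assume "\<not> ?thesis"
  then have "x \<in> perp Q UNIV" by (simp add: perp_def B_sym[of _ x])
  then show False using nondeg assms by (auto simp: nondegenerate_def)
qed

lemma hyperbolic_partner:
  assumes "Q x = 0" "x \<noteq> 0" obtains y where "Q y = 0" "B x y = 1"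
proof -
  from nonradical[OF assms] obtain w where w: "B x w \<noteq> 0" by blast
  define w' where "w' = (1 / B x w) *s w"
  have w': "B x w' = 1" using w by (simp add: w'_def B_lin)
  \<comment> \<open>Subtracting \<open>Q w' *s x\<close> cancels the value of \<open>Q\<close> and,
    as \<open>x\<close> is singular, leaves the pairing with \<open>x\<close> unchanged.\<close>
  have "Q (w' - Q w' *s x) = 0"
    using w' assms by (simp add: Q_diff Q_scale B_lin B_sym[of w' x])
  moreover have "B x (w' - Q w' *s x) = 1" using w' assms by (simp add: B_lin B_self)
  ultimately show thesis using that by blast
qed

lemma card_functional_kernel:
  assumes "subspace U" and "card U \<ge> CARD('a) ^ Suc k"
  shows "card {w \<in> U. B v w = 0} \<ge> CARD('a) ^ k"
proof -
  have "card U = card (B v ` U) * card {w \<in> U. B v w = 0}"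
    by (rule card_image_kernel) (use assms in \<open>auto simp: B_lin subspace_diff dest: subspace_0\<close>)
  also have "\<dots> \<le> CARD('a) * card {w \<in> U. B v w = 0}"
    by (intro mult_le_mono1 card_mono finF) auto
  finally have "card U \<le> CARD('a) * card {w \<in> U. B v w = 0}" .
  from order_trans[OF assms(2) this] have "CARD('a) * CARD('a) ^ k \<le> CARD('a) * card {w \<in> U. B v w = 0}"
    by (simp only: power_Suc)
  then show ?thesis using finite_field_card_pos[OF finF] by simp
qed

lemma card_gt_exists:
  assumes "card U > card T" "finite T" shows "\<exists>u\<in>U. u \<notin> T"
  using assms by (metis card_mono leD subsetI)

lemma card_line_le: "card (range (\<lambda>a. a *s v)) \<le> CARD('a)"
  by (rule card_image_le[OF finF])

text \<open>Each nonzero square has at most two roots, so more than half of the field consists of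
  squares; the values of \<open>b x^2\<close> and of \<open>d - c y^2\<close> therefore
  overlap.\<close>

lemma sum_of_two_squares:
  assumes "b \<noteq> 0" "c \<noteq> (0::'a)"
  shows "\<exists>x y. b * x\<^sup>2 + c * y\<^sup>2 = d"
proof -
  let ?S = "range (\<lambda>x::'a. x\<^sup>2)"
  have "card (\<Union>s\<in>?S - {0}. {x. x\<^sup>2 = s}) \<le> (\<Sum>s\<in>?S - {0}. card {x. x\<^sup>2 = s})"
    by (rule card_UN_le) (use finF in auto)
  also have "\<dots> \<le> (\<Sum>s\<in>?S - {0}. 2)"
  proof (rule sum_mono)
    fix s assume "s \<in> ?S - {0}"
    then obtain x where "s = x\<^sup>2" by blast
    then have "{x. x\<^sup>2 = s} \<subseteq> {x, - x}" by (auto simp: power2_eq_iff)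
    then have "card {x. x\<^sup>2 = s} \<le> card {x, - x}" by (intro card_mono) auto
    also have "\<dots> \<le> 2" by (simp add: card_insert_if)
    finally show "card {x. x\<^sup>2 = s} \<le> 2" .
  qed
  also have "(\<Union>s\<in>?S - {0}. {x. x\<^sup>2 = s}) = UNIV - {0}" by auto
  finally have "CARD('a) - 1 \<le> 2 * (card ?S - 1)"
    using finF by (simp add: card_Diff_singleton image_iff)
  moreover have "card ?S > 0" using finF by (auto simp: card_gt_0_iff)
  ultimately have S: "CARD('a) < 2 * card ?S" using finite_field_card_pos[OF finF] by linarith
  let ?L = "(\<lambda>s. b * s) ` ?S" and ?R = "(\<lambda>s. d - c * s) ` ?S"
  have "card ?L = card ?S" "card ?R = card ?S"
    by (rule card_image, use assms in \<open>auto simp: inj_on_def\<close>)+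
  moreover have "card ?L + card ?R = card (?L \<union> ?R) + card (?L \<inter> ?R)"
    by (rule card_Un_Int) (use finF in auto)
  moreover have "card (?L \<union> ?R) \<le> CARD('a)" by (rule card_mono[OF finF]) auto
  ultimately have "card (?L \<inter> ?R) > 0" using S by linarith
  then have "?L \<inter> ?R \<noteq> {}" by (auto simp: card_gt_0_iff)
  then obtain x y where "b * x\<^sup>2 = d - c * y\<^sup>2" by auto
  then show ?thesis by (metis add.commute diff_add_cancel)
qed

lemma char2_square:
  assumes "(2::'a) = 0" shows "\<exists>x. x\<^sup>2 = (d::'a)"
proof -
  have "inj (\<lambda>x::'a. x\<^sup>2)"
  proof (rule injI)
    fix x y :: 'a assume "x\<^sup>2 = y\<^sup>2"
    then have "x = y \<or> x = - y" by (simp add: power2_eq_iff)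
    moreover have "- y = y" using assms by (metis add_eq_0_iff mult_2 mult_zero_left)
    ultimately show "x = y" by auto
  qed
  then have "surj (\<lambda>x::'a. x\<^sup>2)" by (rule finite_UNIV_inj_surj[OF finF])
  then show ?thesis by (metis surjD)
qed

text \<open>The case of one quadratic form in three variables of Chevalley's theorem. In
  characteristic 2 every element is a square and two orthogonal vectors suffice. Otherwise the
  values on the plane of \<open>v\<close> and \<open>w\<close> include \<open>- Q u\<close> for a
  third orthogonal vector \<open>u\<close>, and pairing with \<open>u\<close> shows that the
  resulting vector is nonzero.\<close>

lemma exists_singular:
  assumes U: "subspace U" and card: "card U \<ge> CARD('a) ^ 3"
  shows "\<exists>x\<in>U. x \<noteq> 0 \<and> Q x = 0"
proof (rule ccontr)
  assume no: "\<not> ?thesis"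
  let ?q = "CARD('a)"
  have q: "?q > 1" by (rule finite_field_card_pos[OF finF])
  have "?q ^ 3 > 1" by (rule one_less_power[OF q]) simp
  then have "\<exists>v\<in>U. v \<notin> {0}" using card by (intro card_gt_exists) auto
  then obtain v where v: "v \<in> U" "v \<noteq> 0" by blast
  define U1 where "U1 = {w \<in> U. B v w = 0}"
  have sU1: "subspace U1"
    using U unfolding U1_def subspace_def by (auto simp: B_lin)
  have c1: "card U1 \<ge> ?q ^ 2" unfolding U1_def
    by (rule card_functional_kernel[OF U]) (use card in \<open>simp add: numeral_3_eq_3 numeral_2_eq_2\<close>)
  have "?q ^ 1 < ?q ^ 2" using q by (intro power_strict_increasing) auto
  then have "\<exists>w\<in>U1. w \<notin> range (\<lambda>a. a *s v)"
    using c1 card_line_le[of v] finF by (intro card_gt_exists) auto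
  then obtain w where w: "w \<in> U1" "w \<notin> range (\<lambda>a. a *s v)" by blast
  have w0: "w \<noteq> 0" using w(2) by (metis rangeI scale_zero_left)
  have wU: "w \<in> U" "B v w = 0" using w by (auto simp: U1_def)
  have Qv: "Q v \<noteq> 0" and Qw: "Q w \<noteq> 0" using no v wU w0 by auto
  show False
  proof (cases "(2::'a) = 0")
    case True
    obtain a where a: "a\<^sup>2 = - Q w / Q v" using char2_square[OF True] by blast
    have "Q (a *s v + w) = 0" using a Qv wU by (simp add: Q_add Q_scale B_lin)
    moreover have "a *s v + w \<noteq> 0"
    proof
      assume "a *s v + w = 0"
      then have "w = (- a) *s v" by (simp add: add_eq_0_iff)
      then show False using w(2) by blast
    qed
    moreover have "a *s v + w \<in> U" using v wU U by (simp add: subspace_add subspace_scale)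
    ultimately show False using no by blast
  next
    case False
    define U2 where "U2 = {u \<in> U1. B w u = 0}"
    have "card U2 \<ge> ?q ^ 1" unfolding U2_def
      by (rule card_functional_kernel[OF sU1]) (use c1 in \<open>simp add: numeral_2_eq_2\<close>)
    then have "\<exists>u\<in>U2. u \<notin> {0}" using q by (intro card_gt_exists) auto
    then obtain u where u: "u \<in> U2" "u \<noteq> 0" by blast
    have uU: "u \<in> U" "B v u = 0" "B w u = 0" using u by (auto simp: U2_def U1_def)
    obtain a b where ab: "Q v * a\<^sup>2 + Q w * b\<^sup>2 = - Q u"
      using sum_of_two_squares[OF Qv Qw] by blast
    let ?x = "a *s v + b *s w + u"
    have "Q ?x = Q v * a\<^sup>2 + Q w * b\<^sup>2 + Q u" using wU uU by (simp add: Q_add Q_scale B_lin)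
    then have "Q ?x = 0" using ab by simp
    moreover have "?x \<in> U" using v wU uU U by (simp add: subspace_add subspace_scale)
    moreover have "B ?x u = 2 * Q u" using uU by (simp add: B_lin B_self)
    moreover have "Q u \<noteq> 0" using no uU u by blast
    ultimately show False using no False by (metis B_zero(2) mult_eq_0_iff)
  qed
qed

text \<open>Vectors stand in for points: every point occurs q-1 times, and repeated rows and columns
  do not change a rank.\<close>

definition X where "X = {x. x \<noteq> 0 \<and> Q x = 0}"

definition hperp :: "'v \<Rightarrow> 'v \<Rightarrow> 'v set" where
  "hperp x y = {w. B x w = 0 \<and> B y w = 0}"

lemma subspace_hperp: "subspace (hperp x y)"
  unfolding subspace_def hperp_def by (auto simp: B_lin)

lemma hyperbolic_decomp:
  assumes "Q x = 0" "Q y = 0" "B x y = 1"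
  shows "v - B y v *s x - B x v *s y \<in> hperp x y"
  using assms by (simp add: hperp_def B_lin B_self B_sym[of y x])

lemma card_hperp:
  assumes "Q x = 0" "Q y = 0" "B x y = 1"
  shows "CARD('v) = CARD('a)\<^sup>2 * card (hperp x y)"
proof -
  have "bij_betw (\<lambda>(a, b, w). a *s x + b *s y + w) (UNIV \<times> UNIV \<times> hperp x y) UNIV"
    by (rule bij_betw_byWitness[where f' = "\<lambda>v. (B y v, B x v, v - B y v *s x - B x v *s y)"])
       (use assms hyperbolic_decomp[OF assms] in \<open>auto simp: hperp_def B_lin B_self B_sym[of y x] algebra_simps\<close>)
  from bij_betw_same_card[OF this] show ?thesis
    by (simp add: card_cartesian_product power2_eq_square)
qed

lemma hperp_partner:
  assumes xy: "Q x = 0" "Q y = 0" "B x y = 1" and s: "s \<in> hperp x y" "s \<noteq> 0" "Q s = 0"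
  obtains t where "t \<in> hperp x y" "Q t = 0" "B s t = 1"
proof -
  obtain t0 where t0: "Q t0 = 0" "B s t0 = 1" using hyperbolic_partner[OF s(3,2)] by blast
  define t1 where "t1 = t0 - B y t0 *s x - B x t0 *s y"
  have t1: "t1 \<in> hperp x y" unfolding t1_def by (rule hyperbolic_decomp[OF xy])
  have st1: "B s t1 = 1" using s t0 by (simp add: t1_def B_lin hperp_def B_sym[of s])
  define t where "t = t1 - Q t1 *s s"
  have "t \<in> hperp x y" unfolding t_def using t1 s
    by (intro subspace_diff subspace_scale subspace_hperp)
  moreover have "Q t = 0" using st1 s by (simp add: t_def Q_diff Q_scale B_lin B_sym[of t1 s])
  moreover have "B s t = 1" using st1 s by (simp add: t_def B_lin B_self)
  ultimately show thesis using that by blast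
qed

text \<open>Complete \<open>s\<close> to a hyperbolic pair \<open>s\<close>, \<open>t\<close> inside
  the complement. If \<open>z\<close> is orthogonal to both, then \<open>t + z - Q z *s s\<close> is
  singular, so \<open>z\<close> is a combination of singular vectors.\<close>

lemma hperp_span_singular:
  assumes xy: "Q x = 0" "Q y = 0" "B x y = 1" and s: "s \<in> hperp x y" "s \<noteq> 0" "Q s = 0"
  shows "span {w \<in> hperp x y. Q w = 0} = hperp x y"
proof
  show "span {w \<in> hperp x y. Q w = 0} \<subseteq> hperp x y"
    by (rule span_minimal) (auto simp: subspace_hperp)
  obtain t where t: "t \<in> hperp x y" "Q t = 0" "B s t = 1" using hperp_partner[OF xy s] by blast
  show "hperp x y \<subseteq> span {w \<in> hperp x y. Q w = 0}"
  proof
    fix w assume w: "w \<in> hperp x y"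
    define z where "z = w - B t w *s s - B s w *s t"
    have z: "z \<in> hperp x y" unfolding z_def using w s t
      by (intro subspace_diff subspace_scale subspace_hperp)
    have zs: "B t z = 0" "B s z = 0" using s t by (auto simp: z_def B_lin B_self B_sym[of t s])
    let ?u = "t + z - Q z *s s"
    have "?u \<in> hperp x y" using z s t
      by (intro subspace_diff subspace_add subspace_scale subspace_hperp)
    moreover have "Q ?u = 0" using zs s t
      by (simp add: Q_diff Q_add Q_scale B_lin B_self B_sym[of t s] B_sym[of z s])
    ultimately have u: "?u \<in> span {w \<in> hperp x y. Q w = 0}" by (intro span_base) auto
    have "w = ?u - t + Q z *s s + B t w *s s + B s w *s t" by (simp add: z_def)
    also have "\<dots> \<in> span {w \<in> hperp x y. Q w = 0}"
      by (intro span_add span_diff span_scale u) (use s t in \<open>auto intro: span_base\<close>)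
    finally show "w \<in> span {w \<in> hperp x y. Q w = 0}" .
  qed
qed

text \<open>The summand is a polynomial in \<open>\<mu>\<close> of degree at most q-1 whose
  coefficient at the exponent q-1 is \<open>B x z ^ m\<close>; summing over the field extracts minus
  that coefficient.\<close>

lemma B_power_line:
  assumes "CARD('a) - 1 = m"
  shows "B x z ^ m = - (\<Sum>\<mu>\<in>UNIV. B (y + \<mu> *s x) z ^ m)"
proof -
  let ?P = "[:B y z, B x z:] ^ m"
  have d: "degree ?P \<le> CARD('a) - 1" using degree_power_le[of "[:B y z, B x z:]" m] assms
    by (simp split: if_splits)
  have m: "m > 0" using assms finite_field_card_pos[OF finF] by simp
  have "(\<Sum>\<mu>\<in>UNIV. B (y + \<mu> *s x) z ^ m) = (\<Sum>\<mu>\<in>UNIV. \<mu> ^ (CARD('a) - 1 - m) * poly ?P \<mu>)"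
    using assms by (intro sum.cong refl) (simp add: B_lin)
  also have "\<dots> = - coeff ?P m" by (rule sum_poly_coeff[OF finF d]) (use m assms in auto)
  also have "coeff ?P m = B x z ^ m" by (simp add: coeff_linear_poly_power)
  finally show ?thesis by simp
qed

end

section \<open>A chart of the quadric\<close>

text \<open>Exponents are bounded coordinate by coordinate in either argument, not by total degree:
  the bound p-1 is the condition under which base p digits do not carry.\<close>

definition kernel_span :: "'i set \<Rightarrow> nat \<Rightarrow> (('i \<Rightarrow> 'a::field) \<times> ('i \<Rightarrow> 'a) \<Rightarrow> 'a) set" where
  "kernel_span I b = fs.span ((\<lambda>(e, e') x. monomial_fun I e (fst x) * monomial_fun I e' (snd x)) `
     ((I \<rightarrow>\<^sub>E {..b}) \<times> (I \<rightarrow>\<^sub>E {..b})))"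

lemma kernel_span_mult:
  assumes "f \<in> kernel_span I b" "g \<in> kernel_span I b'"
  shows "(\<lambda>x. f x * g x) \<in> kernel_span I (b + b')"
  using assms unfolding kernel_span_def
proof (rule span_fun_mult)
  fix u v :: "('a \<Rightarrow> 'b) \<times> ('a \<Rightarrow> 'b) \<Rightarrow> 'b"
  assume "u \<in> (\<lambda>(e, e') x. monomial_fun I e (fst x) * monomial_fun I e' (snd x)) ` ((I \<rightarrow>\<^sub>E {..b}) \<times> (I \<rightarrow>\<^sub>E {..b}))"
    "v \<in> (\<lambda>(e, e') x. monomial_fun I e (fst x) * monomial_fun I e' (snd x)) ` ((I \<rightarrow>\<^sub>E {..b'}) \<times> (I \<rightarrow>\<^sub>E {..b'}))"
  then obtain e e' f f' where e: "e \<in> I \<rightarrow>\<^sub>E {..b}" "e' \<in> I \<rightarrow>\<^sub>E {..b}" "f \<in> I \<rightarrow>\<^sub>E {..b'}" "f' \<in> I \<rightarrow>\<^sub>E {..b'}"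
    and u: "u = (\<lambda>x. monomial_fun I e (fst x) * monomial_fun I e' (snd x))"
    and v: "v = (\<lambda>x. monomial_fun I f (fst x) * monomial_fun I f' (snd x))" by auto
  let ?g = "restrict (\<lambda>i. e i + f i) I" and ?g' = "restrict (\<lambda>i. e' i + f' i) I"
  have "(?g, ?g') \<in> (I \<rightarrow>\<^sub>E {..b + b'}) \<times> (I \<rightarrow>\<^sub>E {..b + b'})"
    using e by (auto simp: PiE_iff add_mono)
  moreover have "(\<lambda>x. u x * v x) = (\<lambda>(e, e') x. monomial_fun I e (fst x) * monomial_fun I e' (snd x)) (?g, ?g')"
    by (auto simp: u v monomial_fun_mult[symmetric] mult_ac)
  ultimately show "(\<lambda>x. u x * v x) \<in> fs.span ((\<lambda>(e, e') x. monomial_fun I e (fst x) * monomial_fun I e' (snd x)) `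
     ((I \<rightarrow>\<^sub>E {..b + b'}) \<times> (I \<rightarrow>\<^sub>E {..b + b'})))"
    by (intro fs.span_base) (rule image_eqI)
qed

lemma kernel_span_product:
  fixes f g :: "('i \<Rightarrow> 'a::field) \<Rightarrow> 'a"
  assumes "f \<in> fs.span (monomial_fun I ` (I \<rightarrow>\<^sub>E {..b}))" "g \<in> fs.span (monomial_fun I ` (I \<rightarrow>\<^sub>E {..b}))"
  shows "(\<lambda>x. f (fst x) * g (snd x)) \<in> kernel_span I b"
proof -
  let ?A = "(\<lambda>e (x :: ('i \<Rightarrow> 'a) \<times> ('i \<Rightarrow> 'a)). monomial_fun I e (fst x)) ` (I \<rightarrow>\<^sub>E {..b})"
  let ?B = "(\<lambda>e (x :: ('i \<Rightarrow> 'a) \<times> ('i \<Rightarrow> 'a)). monomial_fun I e (snd x)) ` (I \<rightarrow>\<^sub>E {..b})"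
  have "(\<lambda>x :: ('i \<Rightarrow> 'a) \<times> ('i \<Rightarrow> 'a). f (fst x)) \<in> fs.span ?A"
    by (rule span_fun_comp[OF assms(1)]) (auto intro!: fs.span_base)
  moreover have "(\<lambda>x :: ('i \<Rightarrow> 'a) \<times> ('i \<Rightarrow> 'a). g (snd x)) \<in> fs.span ?B"
    by (rule span_fun_comp[OF assms(2)]) (auto intro!: fs.span_base)
  ultimately show ?thesis
    unfolding kernel_span_def
  proof (rule span_fun_mult)
    fix u v assume "u \<in> ?A" "v \<in> ?B"
    then obtain e e' where "e \<in> I \<rightarrow>\<^sub>E {..b}" "e' \<in> I \<rightarrow>\<^sub>E {..b}"
      "u = (\<lambda>x. monomial_fun I e (fst x))" "v = (\<lambda>x. monomial_fun I e' (snd x))" by blast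
    then show "(\<lambda>x. u x * v x) \<in> fs.span ((\<lambda>(e, e') x. monomial_fun I e (fst x) * monomial_fun I e' (snd x)) `
       ((I \<rightarrow>\<^sub>E {..b}) \<times> (I \<rightarrow>\<^sub>E {..b})))"
      by (intro fs.span_base image_eqI[of _ _ "(e, e')"]) auto
  qed
qed

lemma homog_span_subset:
  "homog_span I b j \<subseteq> fs.span (monomial_fun I ` (I \<rightarrow>\<^sub>E {..b}))"
  by (intro fs.span_mono image_mono) (auto simp: homog_exps_def)

lemma kernel_span_power:
  assumes "f \<in> kernel_span I b"
  shows "(\<lambda>x. f x ^ k) \<in> kernel_span I (k * b)"
proof (induction k)
  case 0
  have "(\<lambda>x. (\<lambda>_. 1) (fst x) * (\<lambda>_. 1) (snd x)) \<in> kernel_span I 0"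
    by (rule kernel_span_product; rule subsetD[OF homog_span_subset homog_span_one])
  then show ?case by simp
next
  case (Suc k)
  then show ?case using kernel_span_mult[OF assms Suc] by simp
qed

lemma kernel_span_expansion:
  fixes k :: "('i \<Rightarrow> 'a::field) \<Rightarrow> ('i \<Rightarrow> 'a) \<Rightarrow> 'a"
  assumes I: "finite I" and k: "(\<lambda>x. k (fst x) (snd x)) \<in> kernel_span I b"
  shows "\<exists>a. \<forall>c d. k c d = (\<Sum>e\<in>I \<rightarrow>\<^sub>E {..b}. \<Sum>e'\<in>I \<rightarrow>\<^sub>E {..b}. a e e' * monomial_fun I e c * monomial_fun I e' d)"
proof -
  let ?E = "I \<rightarrow>\<^sub>E {..b}"
  have "finite (?E \<times> ?E)" using I by (intro finite_cartesian_product finite_PiE) auto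
  from fs.span_image_eq[OF this] k obtain a where
    a: "(\<lambda>x. k (fst x) (snd x)) = (\<Sum>z\<in>?E \<times> ?E. (\<lambda>x. a z * (case z of (e, e') \<Rightarrow>
        \<lambda>x. monomial_fun I e (fst x) * monomial_fun I e' (snd x)) x))"
    unfolding kernel_span_def by blast
  have "k c d = (\<Sum>e\<in>?E. \<Sum>e'\<in>?E. a (e, e') * monomial_fun I e c * monomial_fun I e' d)" for c d
  proof -
    have "k c d = (\<Sum>z\<in>?E \<times> ?E. a z * (monomial_fun I (fst z) c * monomial_fun I (snd z) d))"
      using fun_cong[OF a, of "(c, d)"] by (simp add: sum_fun_apply case_prod_beta)
    then show ?thesis by (simp add: sum.cartesian_product case_prod_beta mult.assoc)
  qed
  then show ?thesis by (intro exI[of _ "\<lambda>e e'. a (e, e')"]) blast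
qed

text \<open>By \<open>line\<close>, \<open>e1\<close> and some singular vector of its complement
  span a totally singular line. Its points serve to reach all of \<open>X\<close> from the chart and
  to separate the constant from the powers of \<open>B\<close>.\<close>

locale quadric_line = quadric scale Q
  for scale :: "'a::field \<Rightarrow> 'v::ab_group_add \<Rightarrow> 'v" (infixr "*s" 75) and Q :: "'v \<Rightarrow> 'a" +
  fixes e1 e2 :: 'v and S :: "'v set"
  assumes e12: "Q e1 = 0" "Q e2 = 0" "B e1 e2 = 1"
    and S_W: "S \<subseteq> hperp e1 e2" and S_sing: "s \<in> S \<Longrightarrow> Q s = 0"
    and S_ind: "independent S" and S_span: "span S = hperp e1 e2"
    and line: "\<exists>s\<in>hperp e1 e2. s \<noteq> 0 \<and> Q s = 0"
begin

abbreviation W where "W \<equiv> hperp e1 e2"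

definition vec_of :: "('v \<Rightarrow> 'a) \<Rightarrow> 'v" where "vec_of c = (\<Sum>s\<in>S. c s *s s)"

text \<open>The chart of points not orthogonal to \<open>e1\<close>: with coefficient 1 at
  \<open>e2\<close>, singularity forces the coefficient at \<open>e1\<close>, so the chart is
  parametrised by the whole space \<open>W\<close>.\<close>

definition pt :: "'v \<Rightarrow> 'v" where "pt w = e2 + w - Q w *s e1"

definition X0 where "X0 = pt ` W"

lemma e12': "B e2 e1 = 1" "B e1 e1 = 0" "B e2 e2 = 0"
  using e12 by (simp_all add: B_sym[of e2] B_self)

lemma W_perp: "w \<in> W \<Longrightarrow> B e1 w = 0" "w \<in> W \<Longrightarrow> B e2 w = 0"
   "w \<in> W \<Longrightarrow> B w e1 = 0" "w \<in> W \<Longrightarrow> B w e2 = 0"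
  by (auto simp: hperp_def B_sym[of w])

lemma B_pt: "w \<in> W \<Longrightarrow> w' \<in> W \<Longrightarrow> B (pt w) (pt w') = B w w' - Q w - Q w'"
  by (simp add: pt_def B_lin W_perp e12 e12')

lemma Q_pt: "w \<in> W \<Longrightarrow> Q (pt w) = 0"
  by (simp add: pt_def Q_diff Q_add Q_scale B_lin W_perp e12 e12')

lemma B_e1_pt: "w \<in> W \<Longrightarrow> B e1 (pt w) = 1"
  by (simp add: pt_def B_lin W_perp e12 e12')

lemma X0_X: "X0 \<subseteq> X"
proof -
  have "pt w \<noteq> 0" if "w \<in> W" for w using B_e1_pt[OF that] by auto
  then show ?thesis by (auto simp: X0_def X_def Q_pt)
qed

lemma vec_of_bij: "bij_betw vec_of (S \<rightarrow>\<^sub>E UNIV) W"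
proof -
  have "vec_of ` (S \<rightarrow>\<^sub>E UNIV) = range vec_of"
  proof -
    have "vec_of c \<in> vec_of ` (S \<rightarrow>\<^sub>E UNIV)" for c
      by (rule image_eqI[of _ _ "restrict c S"]) (auto simp: vec_of_def)
    then show ?thesis by blast
  qed
  also have "\<dots> = W"
    unfolding S_span[symmetric] using span_image_eq[of S "\<lambda>s. s"] by (simp add: vec_of_def[abs_def])
  finally have im: "vec_of ` (S \<rightarrow>\<^sub>E UNIV) = W" .
  have "card W = CARD('a) ^ card S"
    using card_span_independent[OF finF _ S_ind] S_span by simp
  then have "inj_on vec_of (S \<rightarrow>\<^sub>E UNIV)"
    by (intro eq_card_imp_inj_on) (auto simp: im card_funcsetE intro!: finite_PiE finF)
  then show ?thesis using im by (simp add: bij_betw_def)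
qed

lemma vec_of_W [simp]: "vec_of c \<in> W"
  unfolding vec_of_def by (intro subspace_sum subspace_hperp subspace_scale) (use S_W in auto)

lemma X0_eq: "X0 = (\<lambda>c. pt (vec_of c)) ` (S \<rightarrow>\<^sub>E UNIV)"
  unfolding X0_def bij_betw_imp_surj_on[OF vec_of_bij, symmetric] by (simp add: image_image)

text \<open>The terms \<open>(c s)^2 * Q s\<close> vanish, and for this the basis is taken singular.
  With squares present, the (p-1)-st power could have exponents up to 2(p-1), and base p digits
  would carry.\<close>

lemma Q_vec_of: "(\<lambda>c. Q (vec_of c)) \<in> homog_span S 1 2"
proof -
  have "(\<lambda>c. Q (\<Sum>s\<in>T. c s *s s)) \<in> homog_span S 1 2" if "T \<subseteq> S" for T
    using finite_V[of T] that
  proof (induction T rule: finite_induct)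
    case empty
    then show ?case using fs.span_zero by (simp add: zero_fun_def)
  next
    case (insert s T)
    have "(\<lambda>c. Q (\<Sum>t\<in>T. c t *s t)) + (\<Sum>t\<in>T. (\<lambda>c. B s t * (c s * c t))) \<in> homog_span S 1 2"
      using insert
      by (intro fs.span_add fs.span_sum fs.span_scale homog_span_coord2) auto
    also have "(\<lambda>c. Q (\<Sum>t\<in>T. c t *s t)) + (\<Sum>t\<in>T. (\<lambda>c. B s t * (c s * c t))) =
      (\<lambda>c. Q (\<Sum>t\<in>insert s T. c t *s t))"
      using insert S_sing[of s]
      by (intro ext) (simp add: sum_fun_apply Q_add Q_scale B_lin B_sum sum_distrib_left mult_ac)
    finally show ?case .
  qed
  then show ?thesis by (simp add: vec_of_def)
qed

lemma B_pt_kernel: "(\<lambda>x. B (pt (vec_of (fst x))) (pt (vec_of (snd x)))) \<in> kernel_span S 1"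
proof -
  note sub = subsetD[OF homog_span_subset]
  have one: "(\<lambda>_. 1) \<in> fs.span (monomial_fun S ` (S \<rightarrow>\<^sub>E {..1}))"
    by (rule sub[OF subsetD[OF homog_span_mono homog_span_one]]) simp
  have a: "(\<lambda>x. fst x s * snd x t :: 'a) \<in> kernel_span S 1" if "s \<in> S" "t \<in> S" for s t
    by (rule kernel_span_product[OF sub[OF homog_span_coord[OF finite_V that(1)]] sub[OF homog_span_coord[OF finite_V that(2)]]])
  have b: "(\<lambda>x. Q (vec_of (fst x)) * 1) \<in> kernel_span S 1" and c: "(\<lambda>x. 1 * Q (vec_of (snd x))) \<in> kernel_span S 1"
    by (rule kernel_span_product; rule sub[OF Q_vec_of] one)+
  have "(\<Sum>s\<in>S. \<Sum>t\<in>S. (\<lambda>x. B s t * (fst x s * snd x t)))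
     - (\<lambda>x. Q (vec_of (fst x)) * 1) - (\<lambda>x. 1 * Q (vec_of (snd x))) \<in> kernel_span S 1"
    unfolding kernel_span_def
    by (intro fs.span_diff fs.span_sum fs.span_scale a[unfolded kernel_span_def] b[unfolded kernel_span_def]
        c[unfolded kernel_span_def])
  also have "(\<Sum>s\<in>S. \<Sum>t\<in>S. (\<lambda>x. B s t * (fst x s * snd x t)))
     - (\<lambda>x. Q (vec_of (fst x)) * 1) - (\<lambda>x. 1 * Q (vec_of (snd x))) =
     (\<lambda>x. B (pt (vec_of (fst x))) (pt (vec_of (snd x))))"
  proof
    fix x
    have "B (vec_of (fst x)) (vec_of (snd x)) = (\<Sum>s\<in>S. \<Sum>t\<in>S. B s t * (fst x s * snd x t))"
      unfolding vec_of_def by (subst B_sum(2)) (simp add: B_sum(1) B_lin mult_ac)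
    then show "((\<Sum>s\<in>S. \<Sum>t\<in>S. (\<lambda>x. B s t * (fst x s * snd x t)))
     - (\<lambda>x. Q (vec_of (fst x)) * 1) - (\<lambda>x. 1 * Q (vec_of (snd x)))) x =
     B (pt (vec_of (fst x))) (pt (vec_of (snd x)))"
      by (simp add: B_pt sum_fun_apply)
  qed
  finally show ?thesis .
qed

lemma has_rank_X0_iff:
  fixes k :: "'v \<Rightarrow> 'v \<Rightarrow> 'a"
  shows "has_rank X0 X0 k r \<longleftrightarrow>
    has_rank (S \<rightarrow>\<^sub>E UNIV) (S \<rightarrow>\<^sub>E UNIV) (\<lambda>c d. k (pt (vec_of c)) (pt (vec_of d))) r"
proof -
  have fin: "finite (S \<rightarrow>\<^sub>E (UNIV :: 'a set))" by (intro finite_PiE finite_V finF)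
  have imp: "has_rank (S \<rightarrow>\<^sub>E UNIV) (S \<rightarrow>\<^sub>E UNIV) (\<lambda>c d. k (pt (vec_of c)) (pt (vec_of d))) r"
    if "has_rank X0 X0 k r" for r
    using that unfolding X0_eq by (rule has_rank_surj[OF _ fin fin])
  \<comment> \<open>The converse needs no inverse construction: some rank exists on
    \<open>X0\<close>, and ranks are unique.\<close>
  obtain r' where r': "has_rank X0 X0 k r'" using has_rank_exists[of X0 X0 k] by auto
  show ?thesis using imp r' has_rank_unique[OF finF fin fin imp[OF r']] by blast
qed

lemma has_rank_X0_power:
  assumes p: "prime p" and q: "CARD('a) = p ^ t" "t \<ge> 1"
    and rk: "has_rank X0 X0 (\<lambda>x y. B x y ^ (p - 1)) r"
  shows "has_rank X0 X0 (\<lambda>x y. B x y ^ (CARD('a) - 1)) (r ^ t)"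
proof -
  have p0: "p > 0" using p by (rule prime_gt_0_nat)
  have pp: "{..p - 1} = {..<p}" using p0 by auto
  let ?k = "\<lambda>c d. B (pt (vec_of c)) (pt (vec_of d))"
  have "(\<lambda>x. ?k (fst x) (snd x) ^ (p - 1)) \<in> kernel_span S ((p - 1) * 1)"
    by (rule kernel_span_power[OF B_pt_kernel])
  then have "\<exists>a. \<forall>c d. ?k c d ^ (p - 1) = (\<Sum>e\<in>S \<rightarrow>\<^sub>E {..<p}. \<Sum>e'\<in>S \<rightarrow>\<^sub>E {..<p}.
      a e e' * monomial_fun S e c * monomial_fun S e' d)"
    using kernel_span_expansion[OF finite_V, where k = "\<lambda>c d. ?k c d ^ (p - 1)" and b = "p - 1"]
    by (simp add: pp del: One_nat_def)
  then obtain a where a: "\<And>c d. ?k c d ^ (p - 1) = (\<Sum>e\<in>S \<rightarrow>\<^sub>E {..<p}. \<Sum>e'\<in>S \<rightarrow>\<^sub>E {..<p}.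
      a e e' * monomial_fun S e c * monomial_fun S e' d)" by blast
  have "has_rank (S \<rightarrow>\<^sub>E UNIV) (S \<rightarrow>\<^sub>E UNIV) (\<lambda>c d. \<Prod>i<t. (?k c d ^ (p - 1)) ^ (p ^ i)) (r ^ t)"
    by (rule has_rank_twist_product[OF finF finite_V p q _ a]) (rule rk[unfolded has_rank_X0_iff])
  then show ?thesis by (simp only: has_rank_X0_iff prod_power_twists[OF p0] q)
qed

text \<open>
  \<open>B x z ^ (q - 1)\<close> is minus the sum of \<open>B (y + \<mu> *s x) z ^ (q - 1)\<close> over \<open>\<mu>\<close>. If \<open>x\<close> is orthogonal but
  not proportional to \<open>e1\<close>, some \<open>y\<close> puts that whole affine line into the chart; \<open>e1\<close> itself is then
  reached through a second line.
\<close>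

lemma X_generated:
  assumes x: "x \<in> X" and m: "m = CARD('a) - 1"
  shows "\<exists>\<tau>. \<forall>y. B x y ^ m = (\<Sum>c\<in>X0. \<tau> c * B c y ^ m)"
proof -
  define gen where "gen x \<longleftrightarrow> (\<exists>\<tau>. \<forall>y. B x y ^ m = (\<Sum>c\<in>X0. \<tau> c * B c y ^ m))" for x
  have X0gen: "gen x" if "x \<in> X0" for x
  proof -
    have "(\<Sum>c\<in>X0. (if c = x then 1 else 0) * B c y ^ m) = (\<Sum>c\<in>X0. if c = x then B c y ^ m else 0)" for y
      by (intro sum.cong) auto
    then show ?thesis using that unfolding gen_def
      by (intro exI[of _ "\<lambda>c. if c = x then 1 else 0"]) simp
  qed
  have line_gen: "gen x" if "\<And>\<mu>. gen (y + \<mu> *s x)" for x y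
  proof -
    from that have "\<forall>\<mu>. \<exists>\<tau>. \<forall>z. B (y + \<mu> *s x) z ^ m = (\<Sum>c\<in>X0. \<tau> c * B c z ^ m)"
      unfolding gen_def by blast
    from choice[OF this] obtain T where
      T: "\<And>\<mu> z. B (y + \<mu> *s x) z ^ m = (\<Sum>c\<in>X0. T \<mu> c * B c z ^ m)" by blast
    have "B x z ^ m = (\<Sum>c\<in>X0. - (\<Sum>\<mu>\<in>UNIV. T \<mu> c) * B c z ^ m)" for z
      unfolding B_power_line[OF m[symmetric], of x z y] T
      by (subst sum.swap) (simp add: sum_negf sum_distrib_right)
    then show ?thesis unfolding gen_def by (intro exI[of _ "\<lambda>c. - (\<Sum>\<mu>\<in>UNIV. T \<mu> c)"]) blast
  qed
  have scale_gen: "gen (a *s x)" if "gen x" "a \<noteq> 0" for a x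
    using that finite_field_power_card_minus_1[OF finF that(2)]
    unfolding gen_def by (simp add: B_lin power_mult_distrib m)
  have tangent: "gen (a *s e1 + w)" if w: "w \<in> W" "w \<noteq> 0" "Q w = 0" for a w
  proof -
    obtain u where u: "u \<in> W" "Q u = 0" "B w u = 1" using hperp_partner[OF e12 w] by blast
    \<comment> \<open>The factor \<open>- a\<close> makes the base point orthogonal to
      \<open>a *s e1 + w\<close>. Since \<open>Q (- a *s u + \<mu> *s w) = - a * \<mu>\<close>, the
      chart point over that vector has precisely the required coefficient at
      \<open>e1\<close>.\<close>
    have "pt ((- a) *s u) + \<mu> *s (a *s e1 + w) \<in> X0" for \<mu>
    proof -
      have "pt ((- a) *s u) + \<mu> *s (a *s e1 + w) = pt ((- a) *s u + \<mu> *s w)"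
        using u w by (simp add: pt_def Q_add Q_diff Q_scale B_lin B_sym[of u w] algebra_simps)
      moreover have "(- a) *s u + \<mu> *s w \<in> W" using u w
        by (intro subspace_add subspace_scale subspace_hperp)
      ultimately show ?thesis by (simp add: X0_def)
    qed
    then show ?thesis by (rule line_gen[OF X0gen])
  qed
  define w where "w = x - B e2 x *s e1 - B e1 x *s e2"
  have w: "w \<in> W" unfolding w_def by (rule hyperbolic_decomp[OF e12])
  have xw: "x = B e2 x *s e1 + B e1 x *s e2 + w" by (simp add: w_def)
  have "Q x = B e2 x * B e1 x + Q w"
    using w by (subst xw) (simp add: Q_add Q_scale B_lin W_perp e12 e12' mult.commute)
  then have Qw: "Q w = - B e2 x * B e1 x" using x by (simp add: X_def add_eq_0_iff)
  have "gen x"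
  proof (cases "B e1 x = 0")
    case False
    have "Q ((1 / B e1 x) *s w) = - (B e2 x / B e1 x)"
      using False by (simp add: Q_scale Qw power2_eq_square)
    then have eq: "B e1 x *s pt ((1 / B e1 x) *s w) = B e2 x *s e1 + B e1 x *s e2 + w"
      using False by (simp add: pt_def scale_right_distrib scale_right_diff_distrib)
    have "x = B e1 x *s pt ((1 / B e1 x) *s w)" by (rule trans[OF xw eq[symmetric]])
    moreover have "pt ((1 / B e1 x) *s w) \<in> X0"
      unfolding X0_def by (intro imageI subspace_scale subspace_hperp w)
    then have "gen (B e1 x *s pt ((1 / B e1 x) *s w))"
      by (intro scale_gen False) (rule X0gen)
    ultimately show ?thesis by simp
  next
    case True
    show ?thesis
    proof (cases "w = 0")
      case False
      then show ?thesis using tangent[OF w False, of "B e2 x"] Qw True xw by simp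
    next
      case w0: True
      obtain s where s: "s \<in> W" "s \<noteq> 0" "Q s = 0" using line by blast
      \<comment> \<open>The line through \<open>s\<close> in the direction \<open>e1\<close>
        consists of the vectors \<open>\<mu> *s e1 + s\<close> treated above.\<close>
      have "gen e1" by (rule line_gen[of s]) (use tangent[OF s] in \<open>simp add: add.commute\<close>)
      have xe: "x = B e2 x *s e1" by (rule trans[OF xw]) (simp add: True w0)
      have "B e2 x \<noteq> 0"
      proof
        assume "B e2 x = 0"
        with xe have "x = 0 *s e1" by metis
        then show False using x by (simp add: X_def)
      qed
      then have "gen (B e2 x *s e1)" by (intro scale_gen \<open>gen e1\<close>)
      then show ?thesis by (rule subst[OF xe[symmetric]])
    qed
  qed
  then show ?thesis by (simp add: gen_def)
qed

lemma has_rank_incidence: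
  assumes p: "prime p" and q: "CARD('a) = p ^ t" "t \<ge> 1"
    and rk: "has_rank X0 X0 (\<lambda>x y. B x y ^ (p - 1)) r"
  shows "has_rank X X (\<lambda>x y. 1 - B x y ^ (CARD('a) - 1)) (Suc (r ^ t))"
proof -
  define m where "m = CARD('a) - 1"
  have X: "has_rank X X (\<lambda>x y. B x y ^ m) (r ^ t)"
    by (rule has_rank_extend[OF _ X0_X])
       (use has_rank_X0_power[OF assms] X_generated in \<open>auto simp: m_def B_sym\<close>)
  obtain s where s: "s \<in> W" "s \<noteq> 0" "Q s = 0" using line by blast
  \<comment> \<open>One representative for each point of a totally singular line: summing over \<open>L\<close> kills
    \<open>B ^ (q - 1)\<close> and maps the constant 1 to \<open>q + 1 = 1\<close>.\<close>
  define L where "L = insert s (range (\<lambda>\<mu>. e1 + \<mu> *s s))"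
  have e2L: "B (e1 + \<mu> *s s) e2 = 1" for \<mu> using s by (simp add: B_lin W_perp e12)
  have inj: "inj (\<lambda>\<mu>. e1 + \<mu> *s s)" using s by (auto simp: inj_def)
  have sL: "s \<notin> range (\<lambda>\<mu>. e1 + \<mu> *s s)"
  proof
    assume "s \<in> range (\<lambda>\<mu>. e1 + \<mu> *s s)"
    then obtain \<mu> where \<mu>: "s = e1 + \<mu> *s s" by blast
    have "B s e2 = B (e1 + \<mu> *s s) e2" by (rule arg_cong[OF \<mu>])
    then have "B s e2 = 1" by (rule trans[OF _ e2L])
    then show False using s by (simp add: W_perp)
  qed
  have LX: "L \<subseteq> X"
  proof -
    have "e1 + \<mu> *s s \<noteq> 0" for \<mu> using e2L[of \<mu>] by auto
    then show ?thesis using s by (auto simp: L_def X_def Q_add Q_scale B_lin W_perp e12)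
  qed
  have sumL: "(\<Sum>x\<in>X. (if x \<in> L then 1 else 0) * f x) = f s + (\<Sum>\<mu>\<in>UNIV. f (e1 + \<mu> *s s))" for f :: "'v \<Rightarrow> 'a"
  proof -
    have "(\<Sum>x\<in>X. (if x \<in> L then 1 else 0) * f x) = (\<Sum>x\<in>X. if x \<in> L then f x else 0)"
      by (intro sum.cong) auto
    also have "\<dots> = sum f L" using LX by (simp add: sum.inter_restrict[symmetric] Int_absorb1)
    also have "\<dots> = f s + sum f (range (\<lambda>\<mu>. e1 + \<mu> *s s))" using sL by (simp add: L_def)
    also have "sum f (range (\<lambda>\<mu>. e1 + \<mu> *s s)) = (\<Sum>\<mu>\<in>UNIV. f (e1 + \<mu> *s s))"
      by (simp add: sum.reindex[OF inj])
    finally show ?thesis .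
  qed
  have 1: "(\<Sum>x\<in>X. if x \<in> L then 1 else 0) = (1::'a)"
    using sumL[of "\<lambda>_. 1"] finite_field_of_nat_card[OF finF] by simp
  have 2: "(\<Sum>x\<in>X. (if x \<in> L then 1 else 0) * B x b ^ m) = 0" for b
    unfolding sumL using B_power_line[of m s b e1] by (simp add: m_def)
  have 3: "(\<Sum>x\<in>X. B b x ^ m * (if x \<in> L then 1 else 0)) = 0" for b
    using 2[of b] by (simp add: mult.commute B_sym[of b])
  show ?thesis unfolding m_def[symmetric]
    by (rule has_rank_one_minus[OF X _ _ 1 2 1 3]) auto
qed

end

section \<open>Characteristic two\<close>

context quadric
begin

text \<open>In characteristic 2 the form \<open>B\<close> is alternating. Splitting off the plane of
  two vectors with pairing 1 divides the cardinality by q^2 and leaves the radical unchanged, so the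
  exponent is even.\<close>

lemma alternating_card_even:
  assumes two: "(2::'a) = 0" and U: "subspace U"
  shows "\<exists>k. card U = CARD('a) ^ (2 * k) * card {v \<in> U. \<forall>u\<in>U. B u v = 0}"
  using U
proof (induction "card U" arbitrary: U rule: less_induct)
  case less
  show ?case
  proof (cases "\<forall>u\<in>U. \<forall>v\<in>U. B u v = 0")
    case True
    then have "{v \<in> U. \<forall>u\<in>U. B u v = 0} = U" by blast
    then show ?thesis by (intro exI[of _ 0]) simp
  next
    case False
    then obtain u v' where uv': "u \<in> U" "v' \<in> U" "B u v' \<noteq> 0" by blast
    define v where "v = (1 / B u v') *s v'"
    have v: "v \<in> U" "B u v = 1" "B v u = 1"
      using uv' less.prems by (auto simp: v_def subspace_scale B_lin B_sym[of v' u])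
    have self: "B w w = 0" for w by (simp add: B_self two)
    define U' where "U' = {w \<in> U. B u w = 0 \<and> B v w = 0}"
    have sU': "subspace U'" using less.prems unfolding U'_def subspace_def by (auto simp: B_lin)
    have proj: "x - B v x *s u - B u x *s v \<in> U'" if "x \<in> U" for x
      using that uv'(1) v less.prems by (simp add: U'_def B_lin self subspace_diff subspace_scale)
    have "bij_betw (\<lambda>(a, b, w). a *s u + b *s v + w) (UNIV \<times> UNIV \<times> U') U"
    proof (rule bij_betw_byWitness[where f' = "\<lambda>x. (B v x, B u x, x - B v x *s u - B u x *s v)"])
      show "\<forall>z\<in>UNIV \<times> UNIV \<times> U'. (\<lambda>x. (B v x, B u x, x - B v x *s u - B u x *s v))
          (case z of (a, b, w) \<Rightarrow> a *s u + b *s v + w) = z"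
        using v by (simp add: U'_def B_lin self)
      show "(\<lambda>(a, b, w). a *s u + b *s v + w) ` (UNIV \<times> UNIV \<times> U') \<subseteq> U"
        using uv'(1) v(1) less.prems by (auto simp: U'_def intro!: subspace_add subspace_scale)
      show "(\<lambda>x. (B v x, B u x, x - B v x *s u - B u x *s v)) ` U \<subseteq> UNIV \<times> UNIV \<times> U'"
        using proj by blast
    qed simp
    from bij_betw_same_card[OF this] have card: "card U = CARD('a) ^ 2 * card U'"
      by (simp add: card_cartesian_product power2_eq_square)
    have "u \<notin> U'" using v by (simp add: U'_def)
    then have "U' \<subset> U" using uv' by (auto simp: U'_def)
    then have "card U' < card U" by (intro psubset_card_mono) auto
    from less.hyps[OF this sU'] obtain k where
      k: "card U' = CARD('a) ^ (2 * k) * card {v \<in> U'. \<forall>u\<in>U'. B u v = 0}" by blast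
    have "{x \<in> U'. \<forall>y\<in>U'. B y x = 0} = {x \<in> U. \<forall>y\<in>U. B y x = 0}"
    proof (intro equalityI subsetI CollectI conjI)
      fix x assume x: "x \<in> {x \<in> U'. \<forall>y\<in>U'. B y x = 0}"
      then show "x \<in> U" by (simp add: U'_def)
      show "\<forall>y\<in>U. B y x = 0"
      proof
        fix y assume "y \<in> U"
        then have "B (y - B v y *s u - B u y *s v) x = 0" using x proj by blast
        then show "B y x = 0" using x by (simp add: B_lin U'_def)
      qed
    qed (use uv' v in \<open>auto simp: U'_def\<close>)
    then show ?thesis using card k by (intro exI[of _ "Suc k"]) (simp add: power_add power2_eq_square)
  qed
qed

end

context quadric_line
begin

lemma span_X0: "span X0 = UNIV"
proof -
  have "pt 0 \<in> span X0" by (intro span_base) (simp add: X0_def subspace_0 subspace_hperp)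
  then have e2: "e2 \<in> span X0" by (simp add: pt_def)
  have sing: "w \<in> span X0" if "w \<in> W" "Q w = 0" for w
  proof -
    have "pt w \<in> span X0" using that by (intro span_base) (simp add: X0_def)
    from span_diff[OF this e2] show ?thesis using that by (simp add: pt_def)
  qed
  obtain s where s: "s \<in> W" "s \<noteq> 0" "Q s = 0" using line by blast
  obtain t where t: "t \<in> W" "Q t = 0" "B s t = 1" using hperp_partner[OF e12 s] by blast
  \<comment> \<open>Chart points over singular vectors have no component along \<open>e1\<close>;
    here \<open>Q (s + t) = 1\<close> brings it in.\<close>
  have "pt (s + t) \<in> span X0"
    by (intro span_base) (auto simp: X0_def intro!: subspace_add subspace_hperp s t)
  moreover have "e1 = e2 + (s + t) - pt (s + t)" using s t by (simp add: pt_def Q_add)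
  ultimately have e1: "e1 \<in> span X0" using span_diff[OF span_add[OF e2 span_add[OF sing sing]]] s t
    by metis
  have "S \<subseteq> span X0" using sing S_W S_sing by auto
  then have W: "W \<subseteq> span X0" unfolding S_span[symmetric] by (rule span_minimal) simp
  have "v \<in> span X0" for v
  proof -
    have "v = B e2 v *s e1 + B e1 v *s e2 + (v - B e2 v *s e1 - B e1 v *s e2)" by simp
    also have "\<dots> \<in> span X0"
      using W hyperbolic_decomp[OF e12] by (intro span_add span_scale e1 e2) auto
    finally show ?thesis .
  qed
  then show ?thesis by auto
qed

lemma perp_X0: "(\<forall>b\<in>X0. B v b = 0) \<longleftrightarrow> (\<forall>b. B v b = 0)"
proof
  assume *: "\<forall>b\<in>X0. B v b = 0"
  have "subspace {b. B v b = 0}" unfolding subspace_def by (auto simp: B_lin)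
  then have "span X0 \<subseteq> {b. B v b = 0}" using * by (intro span_minimal) auto
  then show "\<forall>b. B v b = 0" by (auto simp: span_X0)
qed auto

text \<open>For p = 2 the exponent p-1 is 1, and as \<open>X0\<close> spans, the array has the rank
  of the bilinear form. That rank is even. By nondegeneracy \<open>Q\<close> is injective on the
  radical, which thus has at most q elements, so the rank is at least n-1; parity decides.\<close>

lemma has_rank_X0_char2:
  assumes two: "(2::'a) = 0" and n: "CARD('v) = CARD('a) ^ n"
    and rk: "has_rank X0 X0 B r"
  shows "r = (if even n then n else n - 1)"
proof -
  let ?q = "CARD('a)"
  have q1: "?q > 1" by (rule finite_field_card_pos[OF finF])
  define g where "g v b = (if b \<in> X0 then B v b else 0)" for v b
  define R where "R = {v. \<forall>b. B v b = 0}"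
  have "row_span X0 X0 B = range g"
  proof -
    have "row_span X0 X0 B = g ` range (\<lambda>c. \<Sum>a\<in>X0. c a *s a)"
      by (auto simp: row_span_def g_def fun_eq_iff B_sum B_lin image_iff)
    also have "range (\<lambda>c. \<Sum>a\<in>X0. c a *s a) = UNIV"
      using span_image_eq[of X0 "\<lambda>x. x"] span_X0 by simp
    finally show ?thesis .
  qed
  then have r: "card (range g) = ?q ^ r" using card_row_span[OF rk] by simp
  have "card (UNIV :: 'v set) = card (g ` UNIV) * card {v \<in> UNIV. g v = 0}"
    by (rule card_image_kernel) (auto simp: g_def fun_eq_iff B_lin)
  moreover have "{v \<in> UNIV. g v = 0} = R"
    unfolding R_def using perp_X0 by (auto simp: g_def fun_eq_iff)
  ultimately have 1: "?q ^ n = ?q ^ r * card R" using n r by simp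
  obtain k where k: "?q ^ n = ?q ^ (2 * k) * card R"
    using alternating_card_even[OF two subspace_UNIV] n
    by (auto simp: R_def B_sym)
  have "finite R" by simp
  then have Rpos: "card R > 0" by (subst card_gt_0_iff) (auto simp: R_def intro: exI[of _ 0])
  have "?q ^ r = ?q ^ (2 * k)" using trans[OF 1[symmetric] k] Rpos by auto
  then have rk2: "r = 2 * k" using q1 by (simp add: power_inject_exp)
  have "inj_on Q R"
  proof (rule inj_onI)
    fix x y assume xy: "x \<in> R" "y \<in> R" "Q x = Q y"
    have "Q (x - y) = 0" using xy two by (simp add: Q_diff R_def mult_2[symmetric])
    moreover have "\<forall>b. B (x - y) b = 0" using xy by (simp add: R_def B_lin)
    ultimately have "x - y = 0" using nonradical[of "x - y"] by auto
    then show "x = y" by simp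
  qed
  then have "card R \<le> ?q" using card_inj_on_le[of Q R UNIV] finF by simp
  then have "?q ^ n \<le> ?q ^ Suc r" unfolding 1 by simp
  then have "n \<le> Suc r" using q1 by (meson power_increasing_iff)
  moreover have "?q ^ r \<le> ?q ^ n" unfolding 1 using Rpos by simp
  then have "r \<le> n" using q1 by (meson power_increasing_iff)
  ultimately show ?thesis using rk2 by (auto elim!: evenE oddE)
qed

end

section \<open>Forms and directional derivatives\<close>

context quadric
begin

text \<open>A coordinate-free degree bound. Counting roots on lines and extracting linear
  coefficients require nothing more about a function.\<close>

definition line_poly :: "nat \<Rightarrow> ('v \<Rightarrow> 'a) \<Rightarrow> bool" where
  "line_poly d f \<longleftrightarrow> (\<forall>x v. \<exists>P. degree P \<le> d \<and> (\<forall>s. f (x + s *s v) = poly P s))"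

lemma line_poly_const: "line_poly d (\<lambda>_. c)"
  unfolding line_poly_def by (intro allI exI[of _ "[:c:]"]) simp

lemma line_poly_mono: "line_poly d f \<Longrightarrow> d \<le> d' \<Longrightarrow> line_poly d' f"
  unfolding line_poly_def by (meson order_trans)

lemma line_poly_mult:
  assumes "line_poly d f" "line_poly d' g" shows "line_poly (d + d') (\<lambda>x. f x * g x)"
  unfolding line_poly_def
proof (intro allI)
  fix x v
  obtain P P' where "degree P \<le> d" "\<And>s. f (x + s *s v) = poly P s"
    "degree P' \<le> d'" "\<And>s. g (x + s *s v) = poly P' s"
    using assms unfolding line_poly_def by meson
  then show "\<exists>P. degree P \<le> d + d' \<and> (\<forall>s. f (x + s *s v) * g (x + s *s v) = poly P s)"
    by (intro exI[of _ "P * P'"]) (auto intro: order_trans[OF degree_mult_le add_mono])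
qed

lemma line_poly_power:
  assumes "line_poly d f" shows "line_poly (k * d) (\<lambda>x. f x ^ k)"
  by (induction k) (use line_poly_mult[OF assms] in \<open>auto simp: line_poly_const\<close>)

lemma line_poly_B: "line_poly 1 (B v)"
  unfolding line_poly_def by (intro allI, rule_tac x = "[:B v x, B v va:]" in exI) (auto simp: B_lin)

lemma line_poly_Q: "line_poly 2 Q"
  unfolding line_poly_def
  by (intro allI, rule_tac x = "[:Q x, B x v, Q v:]" in exI)
     (auto simp: Q_add Q_scale B_lin power2_eq_square algebra_simps)

lemma line_poly_span:
  assumes "f \<in> fs.span A" "\<And>g. g \<in> A \<Longrightarrow> line_poly d g" shows "line_poly d f"
  using assms(1)
proof (induction rule: fs.span_induct_alt)
  case base
  then show ?case using line_poly_const[of d 0] by (simp add: zero_fun_def)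
next
  case (step c g h)
  show ?case unfolding line_poly_def
  proof (intro allI)
    fix x v
    obtain P P' where "degree P \<le> d" "\<And>s. g (x + s *s v) = poly P s"
      "degree P' \<le> d" "\<And>s. h (x + s *s v) = poly P' s"
      using step assms(2) unfolding line_poly_def by meson
    then show "\<exists>P. degree P \<le> d \<and> (\<forall>s. ((\<lambda>x. c * g x) + h) (x + s *s v) = poly P s)"
      by (intro exI[of _ "smult c P + P'"]) (auto intro: degree_add_le order_trans[OF degree_smult_le])
  qed
qed

text \<open>The q-1 nonzero parameters are more roots than a nonzero polynomial of degree
  \<open>d\<close> can have.\<close>

lemma line_poly_zero:
  assumes lp: "line_poly d f" and d: "d < CARD('a) - 1" and 0: "\<And>s. s \<noteq> 0 \<Longrightarrow> f (x + s *s v) = 0"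
  shows "f x = 0"
proof -
  obtain P where P: "degree P \<le> d" "\<And>s. f (x + s *s v) = poly P s"
    using lp unfolding line_poly_def by meson
  have "P = 0"
  proof (rule ccontr)
    assume "P \<noteq> 0"
    then have "card {s. poly P s = 0} \<le> d" using card_poly_roots_bound[of P] P(1) by simp
    moreover have "card (UNIV - {0::'a}) \<le> card {s. poly P s = 0}"
      by (intro card_mono finite_subset[OF _ finF]) (use 0 P(2) in auto)
    ultimately show False using d finF by (simp add: card_Diff_singleton)
  qed
  then show ?thesis using P(2)[of 0] by simp
qed

text \<open>
  Summation against \<open>s\<^sup>q\<^sup>-\<^sup>2\<close> extracts the coefficient of \<open>s\<close> from polynomials in \<open>s\<close> of degree below
  \<open>q\<close>; only for functions of such a degree along lines is this the directional derivative.
\<close>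

definition ddiff :: "'v \<Rightarrow> ('v \<Rightarrow> 'a) \<Rightarrow> 'v \<Rightarrow> 'a" where
  "ddiff v f x = - (\<Sum>s\<in>UNIV. s ^ (CARD('a) - 2) * f (x + s *s v))"

lemma ddiff_linear:
  "ddiff v (f + g) = ddiff v f + ddiff v g" "ddiff v (\<lambda>x. c * f x) = (\<lambda>x. c * ddiff v f x)" "ddiff v 0 = 0"
  by (auto simp: ddiff_def fun_eq_iff algebra_simps sum.distrib sum_distrib_left)

lemma ddiff_coeff:
  assumes P: "\<And>s. f (x + s *s v) = poly P s" "degree P \<le> CARD('a) - 1"
  shows "ddiff v f x = coeff P 1"
proof -
  have "(\<Sum>s\<in>UNIV. s ^ (CARD('a) - 1 - 1) * poly P s) = - coeff P 1"
    by (rule sum_poly_coeff[OF finF P(2)]) (use finite_field_card_pos[OF finF] in auto)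
  then show ?thesis by (simp add: ddiff_def P numeral_2_eq_2)
qed

text \<open>The bound on \<open>a + b\<close> keeps the product below degree q along lines, where
  the power sum still reads off its linear coefficient.\<close>

lemma ddiff_mult:
  assumes "line_poly a f" "line_poly b g" "a + b \<le> CARD('a) - 1"
  shows "ddiff v (\<lambda>x. f x * g x) = (\<lambda>x. f x * ddiff v g x + g x * ddiff v f x)"
proof
  fix x
  obtain P P' where P: "degree P \<le> a" "\<And>s. f (x + s *s v) = poly P s"
    "degree P' \<le> b" "\<And>s. g (x + s *s v) = poly P' s"
    using assms unfolding line_poly_def by meson
  have "ddiff v (\<lambda>x. f x * g x) x = coeff (P * P') 1"
    by (rule ddiff_coeff) (use P assms(3) in \<open>auto intro: order_trans[OF degree_mult_le]\<close>)
  also have "\<dots> = coeff P 0 * coeff P' 1 + coeff P 1 * coeff P' 0"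
    by (simp add: coeff_mult)
  also have "coeff P 0 = f x" using P(2)[of 0] by (simp add: poly_0_coeff_0)
  also have "coeff P' 0 = g x" using P(4)[of 0] by (simp add: poly_0_coeff_0)
  also have "coeff P 1 = ddiff v f x" by (rule ddiff_coeff[symmetric]) (use P assms(3) in auto)
  also have "coeff P' 1 = ddiff v g x" by (rule ddiff_coeff[symmetric]) (use P assms(3) in auto)
  finally show "ddiff v (\<lambda>x. f x * g x) x = f x * ddiff v g x + g x * ddiff v f x" by (simp add: mult.commute)
qed

lemma ddiff_B: "ddiff v (B w) = (\<lambda>_. B w v)"
proof
  fix x
  have "ddiff v (B w) x = coeff [:B w x, B w v:] 1"
    by (rule ddiff_coeff) (use finite_field_card_pos[OF finF] in \<open>auto simp: B_lin\<close>)
  then show "ddiff v (B w) x = B w v" by simp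
qed

lemma ddiff_Q:
  assumes "CARD('a) > 2"
  shows "ddiff v Q = B v"
proof
  fix x
  have "ddiff v Q x = coeff [:Q x, B x v, Q v:] 1"
    by (rule ddiff_coeff) (use assms in \<open>auto simp: Q_add Q_scale B_lin power2_eq_square algebra_simps\<close>)
  then show "ddiff v Q x = B v x" by (simp add: B_sym)
qed

lemma ddiff_B_power:
  assumes "k \<le> CARD('a) - 1"
  shows "ddiff v (\<lambda>x. B w x ^ k) = (\<lambda>x. of_nat k * B w v * B w x ^ (k - 1))"
  using assms
proof (induction k)
  case 0
  have "ddiff v (\<lambda>x. 1) x = coeff [:1:] 1" for x by (rule ddiff_coeff) auto
  then show ?case by auto
next
  case (Suc k)
  have "ddiff v (\<lambda>x. B w x * B w x ^ k) = (\<lambda>x. B w x * ddiff v (\<lambda>x. B w x ^ k) x + B w x ^ k * ddiff v (B w) x)"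
    by (rule ddiff_mult[OF line_poly_B line_poly_power[OF line_poly_B]]) (use Suc in simp)
  also have "\<dots> = (\<lambda>x. of_nat (Suc k) * B w v * B w x ^ (Suc k - 1))"
  proof
    fix x show "B w x * ddiff v (\<lambda>x. B w x ^ k) x + B w x ^ k * ddiff v (B w) x = of_nat (Suc k) * B w v * B w x ^ (Suc k - 1)"
      using Suc by (cases k) (auto simp: ddiff_B algebra_simps)
  qed
  finally show ?case by simp
qed

text \<open>Spanning by powers of linear forms reduces linear identities to a single power. In odd
  characteristic and for d < p these are all homogeneous polynomial functions of degree d, by
  \<open>forms_eq_span\<close>.\<close>

definition forms :: "nat \<Rightarrow> ('v \<Rightarrow> 'a) set" where
  "forms d = fs.span (range (\<lambda>v x. B v x ^ d))"

lemma line_poly_forms: "f \<in> forms d \<Longrightarrow> line_poly d f"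
  unfolding forms_def by (erule line_poly_span) (use line_poly_power[OF line_poly_B] in auto)

lemma forms_induct [consumes 1, case_names zero step]:
  assumes "f \<in> forms d" "R 0" "\<And>c v g. g \<in> forms d \<Longrightarrow> R g \<Longrightarrow> R ((\<lambda>x. c * B v x ^ d) + g)"
  shows "R f"
proof -
  have "f \<in> forms d \<and> R f"
    using assms(1) unfolding forms_def
  proof (induction rule: fs.span_induct_alt)
    case base
    then show ?case by (intro conjI fs.span_zero assms(2))
  next
    case (step c g h)
    then obtain v where v: "g = (\<lambda>x. B v x ^ d)" by blast
    have "(\<lambda>x. c * g x) + h \<in> fs.span (range (\<lambda>v x. B v x ^ d))"
      using step by (intro fs.span_add fs.span_scale) (auto intro: fs.span_base)
    moreover have "R ((\<lambda>x. c * B v x ^ d) + h)" by (rule assms(3)) (use step in \<open>auto simp: forms_def\<close>)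
    ultimately show ?case by (simp only: v simp_thms)
  qed
  then show ?thesis by blast
qed

lemma forms_power: "(\<lambda>x. B v x ^ d) \<in> forms d" unfolding forms_def by (intro fs.span_base) auto

lemma forms_closed:
  "0 \<in> forms d" "f \<in> forms d \<Longrightarrow> g \<in> forms d \<Longrightarrow> f + g \<in> forms d" "f \<in> forms d \<Longrightarrow> g \<in> forms d \<Longrightarrow> f - g \<in> forms d"
  "f \<in> forms d \<Longrightarrow> (\<lambda>x. c * f x) \<in> forms d"
  unfolding forms_def by (auto intro: fs.span_zero fs.span_add fs.span_diff fs.span_scale)

lemma forms_sum: "(\<And>i. i \<in> I \<Longrightarrow> f i \<in> forms d) \<Longrightarrow> (\<Sum>i\<in>I. f i) \<in> forms d"
  unfolding forms_def by (rule fs.span_sum)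

lemma ddiff_forms:
  assumes "f \<in> forms d" "d \<le> CARD('a) - 1"
  shows "ddiff v f \<in> forms (d - 1)"
  using assms(1)
proof (induction rule: forms_induct)
  case zero
  show ?case by (simp only: ddiff_linear(3) forms_closed(1))
next
  case (step c w g)
  have "ddiff v (\<lambda>x. c * B w x ^ d) = (\<lambda>x. c * of_nat d * B w v * B w x ^ (d - 1))"
    by (rule trans[OF ddiff_linear(2)]) (simp only: ddiff_B_power[OF assms(2)] mult.assoc)
  then have "ddiff v ((\<lambda>x. c * B w x ^ d) + g) = (\<lambda>x. c * of_nat d * B w v * B w x ^ (d - 1)) + ddiff v g"
    by (simp only: ddiff_linear(1))
  also have "\<dots> \<in> forms (d - 1)"
    by (rule forms_closed(2)[OF forms_closed(4)[OF forms_power] step(2)])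
  finally show ?case .
qed

end

section \<open>Odd characteristic: dual bases, polarization and multiplication by the quadratic
  form\<close>

locale quadric_odd = quadric_line scale Q e1 e2 S
  for scale :: "'a::field \<Rightarrow> 'v::ab_group_add \<Rightarrow> 'v" (infixr "*s" 75) and Q e1 e2 S +
  fixes p t n :: nat
  assumes p: "prime p" "p > 2" and q: "CARD('a) = p ^ t" "t \<ge> 1" and n: "CARD('v) = CARD('a) ^ n"
begin

lemma char: "CHAR('a) = p" by (rule finite_field_CHAR[OF finF q(1) p(1)])

lemma of_nat_nonzero: "0 < k \<Longrightarrow> k < p \<Longrightarrow> of_nat k \<noteq> (0::'a)"
  by (auto simp: of_nat_eq_0_iff_char_dvd char dest: dvd_imp_le)

lemma two_nonzero: "(2::'a) \<noteq> 0" using of_nat_nonzero[of 2] p by simp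

lemma p_le_q: "p \<le> CARD('a)"
  using power_increasing[of 1 t p] q p by simp

lemma radical_zero: "(\<And>b. B v b = 0) \<Longrightarrow> v = 0"
proof (rule ccontr)
  assume *: "\<And>b. B v b = 0" "v \<noteq> 0"
  have "2 * Q v = 0" using *(1)[of v] by (simp add: B_self)
  then have "Q v = 0" using two_nonzero by simp
  with nonradical *(2) *(1) show False by blast
qed

definition V_basis :: "'v set" where "V_basis = (SOME b. independent b \<and> span b = UNIV)"

lemma V_basis: "independent V_basis" "span V_basis = UNIV"
proof -
  obtain b where b: "independent b" "(UNIV :: 'v set) \<subseteq> span b"
    using maximal_independent_subset[of UNIV] by metis
  from b(2) have "span b = UNIV" by (rule top.extremum_uniqueI)
  with b(1) have "independent b \<and> span b = UNIV" by (rule conjI)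
  then have "independent V_basis \<and> span V_basis = UNIV" unfolding V_basis_def by (rule someI)
  then show "independent V_basis" "span V_basis = UNIV" by (rule conjunct1, rule conjunct2)
qed

lemma card_V_basis: "card V_basis = n"
proof -
  have "CARD('a) ^ n = CARD('a) ^ card V_basis"
    using card_span_independent[OF finF finite_V V_basis(1)] V_basis(2) n by simp
  then show ?thesis using finite_field_card_pos[OF finF] by (simp add: power_inject_exp)
qed

text \<open>Vectors map injectively to tuples of values because the radical is zero, and there are
  q^n of either.\<close>

lemma functional_on_V_basis: "\<exists>v. \<forall>b\<in>V_basis. B v b = h b"
proof -
  define \<Phi> where "\<Phi> v = restrict (\<lambda>b. B v b) V_basis" for v
  have "inj \<Phi>"
  proof (rule injI)
    fix v w assume vw: "\<Phi> v = \<Phi> w"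
    have "B (v - w) b = 0" if "b \<in> V_basis" for b
      using fun_cong[OF vw, of b] that by (simp add: \<Phi>_def B_lin)
    then have "V_basis \<subseteq> {b. B (v - w) b = 0}" by blast
    moreover have "subspace {b. B (v - w) b = 0}" unfolding subspace_def by (auto simp: B_lin)
    ultimately have "span V_basis \<subseteq> {b. B (v - w) b = 0}" by (rule span_minimal)
    then have "v - w = 0" by (intro radical_zero) (auto simp: V_basis)
    then show "v = w" by simp
  qed
  then have "card (range \<Phi>) = CARD('a) ^ card V_basis" using n by (simp add: card_image card_V_basis)
  moreover have "range \<Phi> \<subseteq> V_basis \<rightarrow>\<^sub>E UNIV" by (auto simp: \<Phi>_def)
  ultimately have "range \<Phi> = V_basis \<rightarrow>\<^sub>E UNIV"
    by (intro card_subset_eq) (auto simp: card_funcsetE intro!: finite_PiE finF)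
  moreover have "restrict h V_basis \<in> V_basis \<rightarrow>\<^sub>E UNIV" by simp
  ultimately obtain v where "\<Phi> v = restrict h V_basis" by (metis imageE)
  then have "B v b = h b" if "b \<in> V_basis" for b using that by (metis \<Phi>_def restrict_apply')
  then show ?thesis by blast
qed

definition dual_basis :: "'v \<Rightarrow> 'v" where "dual_basis = (SOME u. \<forall>b\<in>V_basis. \<forall>b'\<in>V_basis. B (u b) b' = (if b' = b then 1 else 0))"

lemma dual_basis: "b \<in> V_basis \<Longrightarrow> b' \<in> V_basis \<Longrightarrow> B (dual_basis b) b' = (if b' = b then 1 else 0)"
proof -
  have "\<forall>b. \<exists>v. \<forall>b'\<in>V_basis. B v b' = (if b' = b then 1 else 0)" by (intro allI functional_on_V_basis)
  then obtain u where "\<forall>b. \<forall>b'\<in>V_basis. B (u b) b' = (if b' = b then 1 else 0)" by metis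
  then have "\<forall>b\<in>V_basis. \<forall>b'\<in>V_basis. B (dual_basis b) b' = (if b' = b then 1 else 0)"
    unfolding dual_basis_def by (intro someI[of "\<lambda>u. \<forall>b\<in>V_basis. \<forall>b'\<in>V_basis. B (u b) b' = (if b' = b then 1 else 0)" u]) blast
  then show "b \<in> V_basis \<Longrightarrow> b' \<in> V_basis \<Longrightarrow> B (dual_basis b) b' = (if b' = b then 1 else 0)" by blast
qed

lemma coords: "(\<Sum>b\<in>V_basis. B (dual_basis b) x *s b) = x"
proof -
  obtain c where c: "x = (\<Sum>b\<in>V_basis. c b *s b)"
    using span_image_eq[of V_basis "\<lambda>b. b"] V_basis(2) by (auto simp: image_iff)
  have "B (dual_basis b) x = c b" if "b \<in> V_basis" for b
  proof -
    have "B (dual_basis b) x = (\<Sum>b'\<in>V_basis. if b' = b then c b' else 0)"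
      unfolding c B_sum by (intro sum.cong refl) (simp add: dual_basis[OF that] B_lin)
    then show ?thesis using that by simp
  qed
  then show ?thesis using c by simp
qed

lemma B_coords: "B x y = (\<Sum>b\<in>V_basis. B (dual_basis b) x * B b y)"
  by (subst coords[of x, symmetric]) (simp add: B_sum B_lin)

text \<open>Polarization: the factors of \<open>vs\<close> are split off from a power one at a time, as linear coefficients.\<close>

lemma products_in_forms:
  assumes "length vs \<le> d" "d < p"
  shows "(\<lambda>x. prod_list (map (\<lambda>v. B v x) vs) * B u x ^ (d - length vs)) \<in> forms d"
  using assms(1)
proof (induction vs arbitrary: u)
  case Nil
  then show ?case by (simp add: forms_power)
next
  case (Cons w vs)
  define m where "m = d - length vs"
  have m: "0 < m" "m < p" "d - length (w # vs) = m - 1" using Cons.prems assms(2) by (auto simp: m_def)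
  define F where "F x = prod_list (map (\<lambda>v. B v x) vs)" for x
  have IH: "(\<lambda>x. F x * B u x ^ m) \<in> forms d" for u using Cons by (simp add: F_def m_def)
  have "(\<Sum>s\<in>UNIV. (\<lambda>x. (- (s ^ (CARD('a) - 2))) * (F x * B (u + s *s w) x ^ m))) \<in> forms d"
    by (intro forms_sum forms_closed(4) IH)
  also have "(\<Sum>s\<in>UNIV. (\<lambda>x. (- (s ^ (CARD('a) - 2))) * (F x * B (u + s *s w) x ^ m))) =
     (\<lambda>x. F x * (of_nat m * B w x * B u x ^ (m - 1)))"
  proof
    fix x
    have "degree ([:B u x, B w x:] ^ m) \<le> CARD('a) - 1"
      using degree_power_le[of "[:B u x, B w x:]" m] m p_le_q by (auto split: if_splits)
    then have "(\<Sum>s\<in>UNIV. s ^ (CARD('a) - 1 - 1) * poly ([:B u x, B w x:] ^ m) s) = - coeff ([:B u x, B w x:] ^ m) 1"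
      by (rule sum_poly_coeff[OF finF]) (use finite_field_card_pos[OF finF] in auto)
    also have "coeff ([:B u x, B w x:] ^ m) 1 = of_nat m * B w x * B u x ^ (m - 1)"
      using m by (subst coeff_linear_poly_power) auto
    finally show "(\<Sum>s\<in>UNIV. (\<lambda>x. (- (s ^ (CARD('a) - 2))) * (F x * B (u + s *s w) x ^ m))) x =
       F x * (of_nat m * B w x * B u x ^ (m - 1))"
      by (simp add: sum_fun_apply B_lin numeral_2_eq_2 sum_negf sum_distrib_left[symmetric] mult.left_commute[of _ "F x"])
  qed
  \<comment> \<open>Division by \<open>m\<close> is possible because 0 < m < p; powers of linear
    forms suffice only in degrees below the characteristic.\<close>
  finally have "(\<lambda>x. (1 / of_nat m) * (F x * (of_nat m * B w x * B u x ^ (m - 1)))) \<in> forms d"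
    by (rule forms_closed(4))
  also have "(\<lambda>x. (1 / of_nat m) * (F x * (of_nat m * B w x * B u x ^ (m - 1)))) =
    (\<lambda>x. prod_list (map (\<lambda>v. B v x) (w # vs)) * B u x ^ (d - length (w # vs)))"
    using of_nat_nonzero[OF m(1,2)] unfolding m(3) by (simp add: F_def mult_ac)
  finally show ?case .
qed

text \<open>Expanding \<open>B x x = 2 * Q x\<close> in dual bases writes \<open>Q\<close> as half a
  sum of products of two linear forms; polarization handles the resulting products of
  \<open>d + 2\<close> factors.\<close>

lemma Q_mult_forms:
  assumes f: "f \<in> forms d" and d: "d + 2 < p"
  shows "(\<lambda>x. Q x * f x) \<in> forms (d + 2)"
  using f
proof (induction rule: forms_induct)
  case zero
  then show ?case using forms_closed(1) by (simp add: zero_fun_def)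
next
  case (step c v g)
  have "(\<Sum>b\<in>V_basis. (\<lambda>x. c / 2 * (B (dual_basis b) x * B b x * B v x ^ d))) + (\<lambda>x. Q x * g x) \<in> forms (d + 2)"
    using products_in_forms[of "[dual_basis _, _]" "d + 2" v] d
    by (intro forms_closed(2) forms_sum forms_closed(4) step) (simp add: mult.assoc)
  also have "(\<Sum>b\<in>V_basis. (\<lambda>x. c / 2 * (B (dual_basis b) x * B b x * B v x ^ d))) + (\<lambda>x. Q x * g x) =
     (\<lambda>x. Q x * ((\<lambda>x. c * B v x ^ d) + g) x)"
  proof
    fix x
    have "(\<Sum>b\<in>V_basis. B (dual_basis b) x * B b x) = 2 * Q x" using B_coords[of x x] by (simp add: B_self)
    then have "(\<Sum>b\<in>V_basis. c / 2 * (B (dual_basis b) x * B b x * B v x ^ d)) = c / 2 * (2 * Q x * B v x ^ d)"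
      by (simp only: sum_distrib_left[symmetric] sum_distrib_right[symmetric])
    then show "((\<Sum>b\<in>V_basis. (\<lambda>x. c / 2 * (B (dual_basis b) x * B b x * B v x ^ d))) + (\<lambda>x. Q x * g x)) x =
       Q x * ((\<lambda>x. c * B v x ^ d) + g) x"
      using two_nonzero by (simp add: sum_fun_apply distrib_left)
  qed
  finally show ?case .
qed

text \<open>Only singular points are in doubt. Through each of them runs a line on which
  \<open>Q\<close> vanishes nowhere else: towards a hyperbolic partner \<open>Q\<close> equals
  \<open>s\<close>, and at the origin in direction \<open>e1 + e2\<close> it equals
  \<open>s^2\<close>. The degree bound then carries the zero over.\<close>

lemma Q_mult_inj:
  assumes f: "line_poly d f" and d: "d < CARD('a) - 1" and Qf: "\<And>x. Q x * f x = 0"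
  shows "f x = 0"
proof (cases "Q x = 0")
  case False
  then show ?thesis using Qf[of x] by simp
next
  case True
  show ?thesis
  proof (cases "x = 0")
    case True
    have "f (x + s *s (e1 + e2)) = 0" if "s \<noteq> 0" for s
      using Qf[of "x + s *s (e1 + e2)"] that True by (simp add: Q_scale Q_add e12)
    then show ?thesis by (rule line_poly_zero[OF f d])
  next
    case False
    obtain y where y: "Q y = 0" "B x y = 1" using hyperbolic_partner[OF True False] by blast
    have "f (x + s *s y) = 0" if "s \<noteq> 0" for s
      using Qf[of "x + s *s y"] that True y by (simp add: Q_scale Q_add B_lin)
    then show ?thesis by (rule line_poly_zero[OF f d])
  qed
qed

end

section \<open>Forms vanishing on the quadric\<close>

text \<open>Stars and bars: with total degree \<open>d\<close> the bound \<open>d\<close> on single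
  exponents holds automatically.\<close>

lemma card_homog_exps:
  assumes I: "finite I"
  shows "card (homog_exps I d d) = (card I + d - 1) choose d"
proof -
  obtain xs where xs: "set xs = I" "distinct xs" using finite_distinct_list[OF I] by blast
  have len: "length xs = card I" using xs distinct_card by fastforce
  have suml: "sum_list (map e xs) = sum e I" for e :: "'a \<Rightarrow> nat"
    using sum_list_distinct_conv_sum_set[OF xs(2), of e] xs(1) by simp
  have "bij_betw (\<lambda>e. map e xs) (homog_exps I d d) {l. length l = card I \<and> sum_list l = d}"
    unfolding bij_betw_def
  proof
    show "inj_on (\<lambda>e. map e xs) (homog_exps I d d)"
    proof (rule inj_onI)
      fix e f assume ef: "e \<in> homog_exps I d d" "f \<in> homog_exps I d d" "map e xs = map f xs"
      have "e i = f i" if "i \<in> I" for i using ef(3) that xs(1) by simp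
      then show "e = f" using ef by (intro PiE_ext[of e I "\<lambda>_. {..d}" f]) (auto simp: homog_exps_def)
    qed
    show "(\<lambda>e. map e xs) ` homog_exps I d d = {l. length l = card I \<and> sum_list l = d}"
    proof (intro equalityI subsetI)
      fix l assume "l \<in> (\<lambda>e. map e xs) ` homog_exps I d d"
      then show "l \<in> {l. length l = card I \<and> sum_list l = d}"
        by (auto simp: homog_exps_def suml len)
    next
      fix l assume l: "l \<in> {l. length l = card I \<and> sum_list l = d}"
      define e where "e = restrict (\<lambda>i. the (map_of (zip xs l) i)) I"
      have el: "map e xs = l"
      proof (rule nth_equalityI)
        fix i assume "i < length (map e xs)"
        then have i: "i < length xs" "i < length l" "xs ! i \<in> I" using l len xs(1) by auto
        have "map_of (zip xs l) (xs ! i) = Some (l ! i)"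
          using i l len xs(2) by (intro map_of_zip_nth) auto
        then show "map e xs ! i = l ! i" using i by (simp add: e_def)
      qed (use l len in simp)
      then have s: "sum e I = d" using l suml[of e] by simp
      have "e i \<le> d" if "i \<in> I" for i using member_le_sum[OF that, of e] I s by simp
      then have "e \<in> homog_exps I d d" using s by (auto simp: homog_exps_def e_def)
      then show "l \<in> (\<lambda>e. map e xs) ` homog_exps I d d" using el by (intro image_eqI[of _ _ e]) auto
    qed
  qed
  from bij_betw_same_card[OF this] show ?thesis
    by (simp add: card_length_sum_list add.commute)
qed

text \<open>With single exponents below q, coefficients are determined by the function. Each
  monomial has one total degree, so components of distinct degrees cannot cancel.\<close>

lemma homog_independent:
  fixes f :: "'z \<Rightarrow> ('i \<Rightarrow> 'a::field) \<Rightarrow> 'a"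
  assumes fin: "finite (UNIV :: 'a set)" and I: "finite I" and b: "b < CARD('a)"
    and J: "finite J" "inj_on deg J"
    and f: "\<And>z. z \<in> J \<Longrightarrow> f z \<in> homog_span I b (deg z)"
    and 0: "\<And>c. (\<Sum>z\<in>J. f z c) = 0" and z: "z \<in> J"
  shows "f z c = 0"
proof -
  have "\<forall>z\<in>J. \<exists>A. \<forall>c. f z c = (\<Sum>e\<in>homog_exps I b (deg z). A e * monomial_fun I e c)"
  proof
    fix z assume "z \<in> J"
    then have "f z \<in> range (\<lambda>a. \<Sum>e\<in>homog_exps I b (deg z). (\<lambda>x. a e * monomial_fun I e x))"
      using f fs.span_image_eq[OF finite_homog_exps[OF I]] by blast
    then obtain A where "f z = (\<Sum>e\<in>homog_exps I b (deg z). (\<lambda>x. A e * monomial_fun I e x))" by blast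
    then show "\<exists>A. \<forall>c. f z c = (\<Sum>e\<in>homog_exps I b (deg z). A e * monomial_fun I e c)"
      by (intro exI[of _ A]) (simp add: sum_fun_apply)
  qed
  from bchoice[OF this] obtain A where A: "\<And>z c. z \<in> J \<Longrightarrow>
      f z c = (\<Sum>e\<in>homog_exps I b (deg z). A z e * monomial_fun I e c)" by blast
  define E where "E = I \<rightarrow>\<^sub>E {..b}"
  have fE: "finite E" unfolding E_def using I by (intro finite_PiE) auto
  define A' where "A' e = (\<Sum>z\<in>J. if sum e I = deg z then A z e else 0)" for e
  have "(\<Sum>e\<in>E. A' e * monomial_fun I e c) = 0" for c
  proof -
    have "(\<Sum>e\<in>E. A' e * monomial_fun I e c) =
        (\<Sum>z\<in>J. \<Sum>e\<in>E. if sum e I = deg z then A z e * monomial_fun I e c else 0)"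
      unfolding A'_def sum_distrib_right by (subst sum.swap) (intro sum.cong refl, simp)
    also have "\<dots> = (\<Sum>z\<in>J. f z c)"
    proof (intro sum.cong refl)
      fix z assume "z \<in> J"
      have "homog_exps I b (deg z) = {e \<in> E. sum e I = deg z}" by (auto simp: homog_exps_def E_def)
      then show "(\<Sum>e\<in>E. if sum e I = deg z then A z e * monomial_fun I e c else 0) = f z c"
        using A[OF \<open>z \<in> J\<close>] fE by (simp add: sum.inter_filter)
    qed
    finally show ?thesis using 0 by simp
  qed
  moreover have "E \<subseteq> I \<rightarrow>\<^sub>E {..<CARD('a)}" unfolding E_def by (rule PiE_mono) (use b in auto)
  ultimately have A'0: "A' e = 0" if "e \<in> E" for e
    using monomials_independent[OF fin I _ _ that] by blast
  have "A z e = 0" if e: "e \<in> homog_exps I b (deg z)" for e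
  proof -
    have se: "sum e I = deg z" and eE: "e \<in> E" using e by (auto simp: homog_exps_def E_def)
    have "A' e = (\<Sum>z'\<in>J. if z' = z then A z' e else 0)"
      unfolding A'_def se using J(2) z by (intro sum.cong refl) (auto dest: inj_onD)
    then show ?thesis using A'0[OF eE] z J(1) by simp
  qed
  then show ?thesis using A[OF z] by simp
qed

text \<open>Pascal's rule twice. For m = \<open>card S\<close> and n = m+2 the terms count the
  monomials of degree at most d and of degree at most d-1 in m variables, the forms of degree d-2 in
  n variables, and the forms of degree d in n variables.\<close>

lemma choose_degree_split:
  "(m + d choose d) + (m + d - 1 choose (d - 1)) + (m + d - 1 choose (d - 2)) = (m + 1 + d choose d)"
  if "d \<ge> 2"
proof -
  have k: "d = Suc (Suc (d - 2))" using that by simp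
  show ?thesis by (subst (1 2 3 4 5 6 7 8) k) simp
qed

lemma homog_exps_subset: "b < N \<Longrightarrow> homog_exps I b j \<subseteq> I \<rightarrow>\<^sub>E {..<N}"
proof -
  assume "b < N"
  then have "I \<rightarrow>\<^sub>E {..b} \<subseteq> I \<rightarrow>\<^sub>E {..<N}" by (intro PiE_mono) auto
  then show ?thesis by (auto simp: homog_exps_def)
qed

context quadric_odd
begin

lemma products_exist:
  assumes "finite I"
  shows "\<exists>vs. length vs = sum e I \<and> (\<forall>x. prod_list (map (\<lambda>v. B v x) vs) = (\<Prod>i\<in>I. B (u i) x ^ e i))"
  using assms
proof (induction I rule: finite_induct)
  case empty
  then show ?case by (intro exI[of _ "[]"]) simp
next
  case (insert i I)
  then obtain vs where "length vs = sum e I" "\<forall>x. prod_list (map (\<lambda>v. B v x) vs) = (\<Prod>i\<in>I. B (u i) x ^ e i)" by blast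
  then show ?case using insert
    by (intro exI[of _ "replicate (e i) (u i) @ vs"]) (simp add: prod_list_replicate)
qed

lemma monomial_in_forms:
  assumes "finite I" "sum e I \<le> d" "d < p"
  shows "(\<lambda>x. (\<Prod>i\<in>I. B (u i) x ^ e i) * B w x ^ (d - sum e I)) \<in> forms d"
proof -
  obtain vs where vs: "length vs = sum e I" "\<And>x. prod_list (map (\<lambda>v. B v x) vs) = (\<Prod>i\<in>I. B (u i) x ^ e i)"
    using products_exist[OF assms(1), of e u] by blast
  show ?thesis using products_in_forms[of vs d w] assms(2,3) by (simp add: vs)
qed

definition \<kappa> :: "'v \<Rightarrow> 'v \<Rightarrow> 'a" where "\<kappa> x b = B (dual_basis b) x"

text \<open>A power of a linear form expands in the coordinates \<open>\<kappa>\<close>; conversely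
  polarization turns each monomial of degree d < p into a combination of powers.\<close>

lemma forms_eq_span:
  assumes d: "d < p"
  shows "forms d = fs.span ((\<lambda>e x. monomial_fun V_basis e (\<kappa> x)) ` homog_exps V_basis d d)"
proof
  show "fs.span ((\<lambda>e x. monomial_fun V_basis e (\<kappa> x)) ` homog_exps V_basis d d) \<subseteq> forms d"
  proof (rule fs.span_minimal)
    show "(\<lambda>e x. monomial_fun V_basis e (\<kappa> x)) ` homog_exps V_basis d d \<subseteq> forms d"
    proof (rule image_subsetI)
      fix e assume "e \<in> homog_exps V_basis d d"
      then show "(\<lambda>x. monomial_fun V_basis e (\<kappa> x)) \<in> forms d"
        using monomial_in_forms[of V_basis e d dual_basis 0] d by (auto simp: homog_exps_def monomial_fun_def \<kappa>_def)
    qed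
    show "fs.subspace (forms d)" unfolding forms_def by (rule fs.subspace_span)
  qed
  have "range (\<lambda>v x. B v x ^ d) \<subseteq> fs.span ((\<lambda>e x. monomial_fun V_basis e (\<kappa> x)) ` homog_exps V_basis d d)"
  proof (rule image_subsetI)
    fix v
    have "(\<Sum>b\<in>V_basis. (\<lambda>c. B b v * c b)) \<in> homog_span V_basis 1 1"
      by (intro fs.span_sum fs.span_scale homog_span_coord finite_V)
    then have "(\<lambda>c. (\<Sum>b\<in>V_basis. (\<lambda>c. B b v * c b)) c ^ d) \<in> homog_span V_basis (d * 1) (d * 1)"
      by (rule homog_span_power)
    then have "(\<lambda>x. (\<Sum>b\<in>V_basis. (\<lambda>c. B b v * c b)) (\<kappa> x) ^ d) \<in>
      fs.span ((\<lambda>e x. monomial_fun V_basis e (\<kappa> x)) ` homog_exps V_basis d d)"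
      by (rule span_fun_comp) (auto intro: fs.span_base)
    moreover have "(\<Sum>b\<in>V_basis. (\<lambda>c. B b v * c b)) (\<kappa> x) = B v x" for x
      using B_coords[of x v] by (simp add: sum_fun_apply \<kappa>_def mult.commute B_sym[of x])
    ultimately show "(\<lambda>x. B v x ^ d) \<in> fs.span ((\<lambda>e x. monomial_fun V_basis e (\<kappa> x)) ` homog_exps V_basis d d)"
      by simp
  qed
  then show "forms d \<subseteq> fs.span ((\<lambda>e x. monomial_fun V_basis e (\<kappa> x)) ` homog_exps V_basis d d)"
    unfolding forms_def by (rule fs.span_minimal) (rule fs.subspace_span)
qed

lemma card_forms:
  assumes d: "d < p"
  shows "card (forms d) = CARD('a) ^ (n + d - 1 choose d)"
proof -
  have "card (fs.span ((\<lambda>e x. monomial_fun V_basis e (\<kappa> x)) ` homog_exps V_basis d d)) = CARD('a) ^ card (homog_exps V_basis d d)"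
  proof (rule fs.card_span_family[OF finF finite_homog_exps[OF finite_V]])
    fix a :: "('v \<Rightarrow> nat) \<Rightarrow> 'a" and e
    assume *: "(\<Sum>e\<in>homog_exps V_basis d d. (\<lambda>x. a e * monomial_fun V_basis e (\<kappa> x))) = 0" "e \<in> homog_exps V_basis d d"
    have "(\<Sum>e\<in>homog_exps V_basis d d. a e * monomial_fun V_basis e c) = 0" for c
    proof -
      have k: "\<kappa> (\<Sum>b\<in>V_basis. c b *s b) b = c b" if "b \<in> V_basis" for b
      proof -
        have "\<kappa> (\<Sum>b\<in>V_basis. c b *s b) b = (\<Sum>b'\<in>V_basis. if b' = b then c b' else 0)"
          unfolding \<kappa>_def B_sum by (intro sum.cong refl) (simp add: dual_basis[OF that] B_lin)
        then show ?thesis using that by simp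
      qed
      have "monomial_fun V_basis e (\<kappa> (\<Sum>b\<in>V_basis. c b *s b)) = monomial_fun V_basis e c" for e
        unfolding monomial_fun_def by (intro prod.cong refl) (simp add: k)
      then show ?thesis using fun_cong[OF *(1), of "\<Sum>b\<in>V_basis. c b *s b"] by (simp add: sum_fun_apply)
    qed
    then show "a e = 0"
      using monomials_independent[OF finF finite_V homog_exps_subset _ *(2)] d p_le_q by simp
  qed
  then show ?thesis by (simp add: forms_eq_span[OF d] card_homog_exps card_V_basis)
qed

lemma finite_funs: "finite (A :: ('v \<Rightarrow> 'a) set)"
proof -
  have "finite (UNIV :: ('v \<Rightarrow> 'a) set)"
    using finite_PiE[of "UNIV :: 'v set" "\<lambda>_. UNIV :: 'a set"] finF by (simp add: PiE_UNIV_domain)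
  then show ?thesis by (rule rev_finite_subset) simp
qed

lemma card_S: "n = card S + 2"
proof -
  have "CARD('a) ^ n = CARD('a) ^ (card S + 2)"
    using card_hperp[OF e12] n card_span_independent[OF finF finite_V S_ind] S_span
    by (simp add: power_add mult.commute power2_eq_square)
  then show ?thesis unfolding power_inject_exp[OF finite_field_card_pos[OF finF]] .
qed

lemma card_S_pos: "card S > 0"
proof (rule ccontr)
  assume "\<not> card S > 0"
  then have "S = {}" by simp
  then have "W = {0}" using S_span by simp
  then show False using line by auto
qed

text \<open>The coordinates with respect to \<open>S\<close> are pairings with vectors of
  \<open>W\<close>. This rests on \<open>W\<close> having zero radical, as a vector of
  \<open>W\<close> orthogonal to \<open>W\<close> is also orthogonal to \<open>e1\<close> and
  \<open>e2\<close>.\<close>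

lemma dual_S: "\<exists>u. \<forall>s\<in>S. \<forall>s'\<in>S. u s \<in> W \<and> B (u s) s' = (if s' = s then 1 else 0)"
proof -
  define \<Phi> where "\<Phi> v = restrict (\<lambda>b. B v b) S" for v
  have "inj_on \<Phi> W"
  proof (rule inj_onI)
    fix v w assume vw: "v \<in> W" "w \<in> W" "\<Phi> v = \<Phi> w"
    have "B (v - w) b = 0" if "b \<in> S" for b
      using fun_cong[OF vw(3), of b] that by (simp add: \<Phi>_def B_lin)
    then have "S \<subseteq> {b. B (v - w) b = 0}" by blast
    moreover have "subspace {b. B (v - w) b = 0}" unfolding subspace_def by (auto simp: B_lin)
    ultimately have W0: "W \<subseteq> {b. B (v - w) b = 0}" unfolding S_span[symmetric] by (rule span_minimal)
    have vwW: "v - w \<in> W" using vw by (intro subspace_diff subspace_hperp)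
    have "B (v - w) b = 0" for b
    proof -
      have "b - B e2 b *s e1 - B e1 b *s e2 \<in> W" by (rule hyperbolic_decomp[OF e12])
      then have "B (v - w) (b - B e2 b *s e1 - B e1 b *s e2) = 0" using W0 by blast
      moreover have "B (v - w) e1 = 0" "B (v - w) e2 = 0" using vwW by (auto simp: W_perp)
      ultimately show ?thesis by (simp add: B_add_right B_scale_right B_diff(1))
    qed
    then have "v - w = 0" by (rule radical_zero)
    then show "v = w" by simp
  qed
  moreover have "card W = CARD('a) ^ card S"
    using card_span_independent[OF finF finite_V S_ind] S_span by simp
  ultimately have "card (\<Phi> ` W) = CARD('a) ^ card S" by (simp add: card_image)
  moreover have "\<Phi> ` W \<subseteq> S \<rightarrow>\<^sub>E UNIV" by (auto simp: \<Phi>_def)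
  ultimately have im: "\<Phi> ` W = S \<rightarrow>\<^sub>E UNIV"
    by (intro card_subset_eq) (auto simp: card_funcsetE intro!: finite_PiE finF)
  have "\<forall>s. \<exists>v. v \<in> W \<and> (\<forall>s'\<in>S. B v s' = (if s' = s then 1 else 0))"
  proof
    fix s
    have "restrict (\<lambda>s'. if s' = s then 1 else 0) S \<in> \<Phi> ` W" unfolding im by simp
    then obtain v where v: "v \<in> W" "\<Phi> v = restrict (\<lambda>s'. if s' = s then 1 else 0) S" by (metis imageE)
    have "B v s' = (if s' = s then 1 else 0)" if "s' \<in> S" for s'
      using fun_cong[OF v(2), of s'] that by (simp add: \<Phi>_def)
    then show "\<exists>v. v \<in> W \<and> (\<forall>s'\<in>S. B v s' = (if s' = s then 1 else 0))" using v by blast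
  qed
  then obtain u where "\<forall>s. u s \<in> W \<and> (\<forall>s'\<in>S. B (u s) s' = (if s' = s then 1 else 0))" by metis
  then show ?thesis by blast
qed

text \<open>The argument of \<open>Q_mult_inj\<close> inside \<open>W\<close>, where
  \<open>hperp_partner\<close> keeps the auxiliary lines in the subspace.\<close>

lemma zero_on_W:
  assumes f: "line_poly j f" "j < CARD('a) - 1" and 0: "\<And>w. w \<in> W \<Longrightarrow> Q w \<noteq> 0 \<Longrightarrow> f w = 0" and w: "w \<in> W"
  shows "f w = 0"
proof (cases "Q w = 0")
  case True
  show ?thesis
  proof (cases "w = 0")
    case False
    obtain y where y: "y \<in> W" "Q y = 0" "B w y = 1" using hperp_partner[OF e12 w False True] by blast
    have "f (w + s *s y) = 0" if "s \<noteq> 0" for s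
      by (rule 0) (use w y that True in \<open>auto simp: Q_add Q_scale B_lin intro!: subspace_add subspace_scale subspace_hperp\<close>)
    then show ?thesis by (rule line_poly_zero[OF f])
  next
    case w0: True
    obtain s where s: "s \<in> W" "s \<noteq> 0" "Q s = 0" using line by blast
    obtain y where y: "y \<in> W" "Q y = 0" "B s y = 1" using hperp_partner[OF e12 s] by blast
    have "f (w + a *s (s + y)) = 0" if "a \<noteq> 0" for a
      by (rule 0) (use w w0 s y that in \<open>auto simp: Q_add Q_scale B_lin intro!: subspace_add subspace_scale subspace_hperp\<close>)
    then show ?thesis by (rule line_poly_zero[OF f])
  qed
qed (use 0 w in blast)

lemma X0_zero_iff: "(\<forall>x\<in>X0. f x = 0) \<longleftrightarrow> (\<forall>c. f (pt (vec_of c)) = 0)"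
proof
  assume "\<forall>x\<in>X0. f x = 0"
  then show "\<forall>c. f (pt (vec_of c)) = 0" by (auto simp: X0_def)
qed (auto simp: X0_eq)

text \<open>Multiples of \<open>Q\<close> bound the space of restrictions from above by dimension
  \<nu>; here \<nu> independent restrictions are exhibited, so that no further forms can vanish on
  the chart.\<close>

lemma card_restriction_ge:
  assumes d: "2 \<le> d" "d < p" and \<nu>: "\<nu> + (n + (d - 2) - 1 choose (d - 2)) = (n + d - 1 choose d)"
  shows "card ((\<lambda>f c. f (pt (vec_of c))) ` forms d) \<ge> CARD('a) ^ \<nu>"
proof -
  have dq: "d < CARD('a)" using d p_le_q by simp
  obtain u where u: "\<And>s s'. s \<in> S \<Longrightarrow> s' \<in> S \<Longrightarrow> B (u s) s' = (if s' = s then 1 else 0)"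
      "\<And>s. s \<in> S \<Longrightarrow> u s \<in> W" using dual_S by metis
  have uvec: "B (u s) (vec_of c) = c s" if "s \<in> S" for s c
  proof -
    have "B (u s) (vec_of c) = (\<Sum>s'\<in>S. if s' = s then c s' else 0)"
      unfolding vec_of_def B_sum by (intro sum.cong refl) (simp add: u(1)[OF that] B_lin)
    then show ?thesis using that by simp
  qed
  have upt: "B (u s) (pt (vec_of c)) = c s" if "s \<in> S" for s c
    using uvec[OF that] u(2)[OF that] by (simp add: pt_def B_lin W_perp)
  \<comment> \<open>On the chart \<open>B e1\<close> is 1 and \<open>B e2\<close> is \<open>-Q\<close>, so a monomial in the \<open>S\<close>-coordinates times a power of
    one of them restricts to \<open>G\<close>, and the degrees of these restrictions separate the two families.\<close>
  define H where "H j = homog_exps S j j" for j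
  define G where "G z c = (case z of (e, b) \<Rightarrow> if b then monomial_fun S e c
      else (- Q (vec_of c)) ^ (d - sum e S) * monomial_fun S e c)" for z :: "('v \<Rightarrow> nat) \<times> bool" and c
  \<comment> \<open>Degree \<open>d\<close> occurs in one family only: for \<open>j = d\<close> the
    extra power is trivial and both families restrict to the same monomials.\<close>
  define J where "J = ({..<d} \<times> {True}) \<union> ({..d} \<times> {False})"
  define E where "E = (SIGMA z:J. H (fst z))"
  define E' where "E' = (\<lambda>(z, e). (e, snd z)) ` E"
  have fH: "finite (H j)" for j unfolding H_def by (intro finite_homog_exps finite_V)
  have fJ: "finite J" by (auto simp: J_def)
  have fE: "finite E" unfolding E_def using fJ fH by auto
  have sH: "sum e S = j" if "e \<in> H j" for e j using that by (auto simp: H_def homog_exps_def)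
  have injE: "inj_on (\<lambda>(z, e). (e, snd z)) E"
    by (auto simp: inj_on_def E_def prod_eq_iff dest!: sH)
  have cardE: "card E' = \<nu>"
  proof -
    have "card S + j - 1 = card S - 1 + j" for j using card_S_pos by simp
    then have cH: "card (H j) = (card S - 1 + j choose j)" for j by (simp add: H_def card_homog_exps)
    have "card E' = card E" unfolding E'_def by (rule card_image[OF injE])
    also have "\<dots> = (\<Sum>z\<in>J. card (H (fst z)))" unfolding E_def using fH fJ by (intro card_SigmaI) auto
    also have "\<dots> = (\<Sum>j<d. card (H j)) + (\<Sum>j\<le>d. card (H j))"
      unfolding J_def by (subst sum.union_disjoint) (auto simp: sum.cartesian_product' simp flip: sum.cartesian_product)
    also have "(\<Sum>j\<le>d. card (H j)) = (card S + d choose d)"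
      unfolding cH sum_choose_lower using card_S_pos by simp
    also have "{..<d} = {..d - 1}" using d by auto
    also have "(\<Sum>j\<le>d - 1. card (H j)) = (card S + d - 1 choose (d - 1))"
    proof -
      have "Suc (card S - 1 + (d - 1)) = card S + d - 1" using card_S_pos d by simp
      then show ?thesis unfolding cH sum_choose_lower by (simp only:)
    qed
    finally have "card E' + (card S + d - 1 choose (d - 2)) = (card S + 1 + d choose d)"
      using choose_degree_split[OF d(1), of "card S"] by linarith
    moreover have "n + (d - 2) - 1 = card S + d - 1" using card_S d by simp
    moreover have "n + d - 1 = card S + 1 + d" using card_S by simp
    ultimately show ?thesis using \<nu> by (simp only:)
  qed
  have GT: "G (e, True) = monomial_fun S e" for e by (auto simp: G_def)
  have GF: "G (e, False) = (\<lambda>c. (- Q (vec_of c)) ^ (d - sum e S) * monomial_fun S e c)" for e by (auto simp: G_def)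
  have "fs.span (G ` E') \<subseteq> (\<lambda>f c. f (pt (vec_of c))) ` forms d"
  proof (rule fs.span_minimal)
    show "G ` E' \<subseteq> (\<lambda>f c. f (pt (vec_of c))) ` forms d"
    proof
      fix g assume "g \<in> G ` E'"
      then obtain j b e where jb: "(j, b) \<in> J" "e \<in> H j" "g = G (e, b)" by (auto simp: E'_def E_def)
      have j: "j \<le> d" "sum e S = j" using jb sH by (auto simp: J_def)
      define w where "w = (if b then e1 else e2)"
      define F where "F x = (\<Prod>i\<in>S. B (u i) x ^ e i) * B w x ^ (d - sum e S)" for x
      have FP: "F \<in> forms d"
        unfolding F_def[abs_def] by (rule monomial_in_forms) (use j d in auto)
      have "g = (\<lambda>c. F (pt (vec_of c)))"
      proof
        fix c
        have "(\<Prod>i\<in>S. B (u i) (pt (vec_of c)) ^ e i) = monomial_fun S e c"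
          unfolding monomial_fun_def by (intro prod.cong refl) (simp add: upt)
        moreover have "B w (pt (vec_of c)) = (if b then 1 else - Q (vec_of c))"
          by (simp add: w_def pt_def B_lin W_perp e12 e12')
        ultimately show "g c = F (pt (vec_of c))"
          by (simp add: jb(3) G_def F_def mult.commute)
      qed
      then show "g \<in> (\<lambda>f c. f (pt (vec_of c))) ` forms d"
        using imageI[OF FP, of "\<lambda>f c. f (pt (vec_of c))"] by simp
    qed
    show "fs.subspace ((\<lambda>f c. f (pt (vec_of c))) ` forms d)"
    proof (rule fs.subspaceI)
      show "0 \<in> (\<lambda>f c. f (pt (vec_of c))) ` forms d"
        by (rule image_eqI[of _ _ 0]) (auto simp: forms_closed)
    next
      fix f g assume "f \<in> (\<lambda>f c. f (pt (vec_of c))) ` forms d" "g \<in> (\<lambda>f c. f (pt (vec_of c))) ` forms d"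
      then obtain f' g' where "f' \<in> forms d" "g' \<in> forms d" "f = (\<lambda>c. f' (pt (vec_of c)))" "g = (\<lambda>c. g' (pt (vec_of c)))" by blast
      then show "f + g \<in> (\<lambda>f c. f (pt (vec_of c))) ` forms d"
        by (intro image_eqI[of _ _ "f' + g'"] forms_closed) auto
    next
      fix k f assume "f \<in> (\<lambda>f c. f (pt (vec_of c))) ` forms d"
      then obtain f' where "f' \<in> forms d" "f = (\<lambda>c. f' (pt (vec_of c)))" by blast
      then show "(\<lambda>x. k * f x) \<in> (\<lambda>f c. f (pt (vec_of c))) ` forms d"
        by (intro image_eqI[of _ _ "\<lambda>x. k * f' x"] forms_closed) auto
    qed
  qed
  moreover have "card (fs.span (G ` E')) = CARD('a) ^ card E'"
  proof (rule fs.card_span_family[OF finF])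
    show "finite E'" unfolding E'_def using fE by simp
  next
    fix a :: "('v \<Rightarrow> nat) \<times> bool \<Rightarrow> 'a" and y
    assume *: "(\<Sum>z\<in>E'. (\<lambda>x. a z * G z x)) = 0" "y \<in> E'"
    define f where "f z c = (\<Sum>e\<in>H (fst z). a (e, snd z) * G (e, snd z) c)" for z :: "nat \<times> bool" and c
    \<comment> \<open>Total degrees on the chart: \<open>j\<close> runs through 0..d-1 in the first
      family and \<open>2 * d - j\<close> through d..2d in the second. They are distinct, so a
      relation splits into its homogeneous parts.\<close>
    define deg where "deg z = (if snd z then fst z else 2 * d - fst z)" for z :: "nat \<times> bool"
    have sum0: "(\<Sum>z\<in>J. f z c) = 0" for c
    proof -
      have "(\<Sum>z\<in>J. f z c) = (\<Sum>(z, e)\<in>E. a (e, snd z) * G (e, snd z) c)"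
        unfolding f_def E_def using fJ fH by (subst sum.Sigma) auto
      also have "\<dots> = (\<Sum>z\<in>E'. a z * G z c)"
        unfolding E'_def by (subst sum.reindex[OF injE]) (simp add: case_prod_beta)
      also have "\<dots> = 0" using fun_cong[OF *(1), of c] by (simp add: sum_fun_apply)
      finally show ?thesis .
    qed
    have injdeg: "inj_on deg J" by (auto simp: inj_on_def J_def deg_def)
    have hom: "f z \<in> homog_span S d (deg z)" if "z \<in> J" for z
    proof -
      obtain j b where z: "z = (j, b)" by (cases z)
      have j: "j \<le> d" using that by (auto simp: z J_def)
      have "(\<lambda>c. (- 1) * Q (vec_of c)) \<in> homog_span S 1 2" by (intro fs.span_scale Q_vec_of)
      then have "(\<lambda>c. - Q (vec_of c)) \<in> homog_span S 1 2" by simp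
      from homog_span_power[OF this, of "d - j"]
      have Qp: "(\<lambda>c. (- Q (vec_of c)) ^ (d - j)) \<in> homog_span S (d - j) ((d - j) * 2)" by simp
      have m: "monomial_fun S e \<in> homog_span S j j" if "e \<in> H j" for e
        using that by (intro fs.span_base) (auto simp: H_def)
      have "G (e, b) \<in> homog_span S d (deg z)" if e: "e \<in> H j" for e
      proof (cases b)
        case True
        then show ?thesis using subsetD[OF homog_span_mono[OF j] m[OF e]] by (simp add: GT z deg_def)
      next
        case False
        have "(\<lambda>c. (- Q (vec_of c)) ^ (d - j) * monomial_fun S e c) \<in> homog_span S ((d - j) + j) ((d - j) * 2 + j)"
          by (rule homog_span_mult[OF Qp m[OF e]])
        moreover have "(d - j) + j = d" "(d - j) * 2 + j = 2 * d - j" using j by auto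
        ultimately show ?thesis using False sH[OF e] by (simp add: GF z deg_def)
      qed
      then have "(\<Sum>e\<in>H j. (\<lambda>c. a (e, b) * G (e, b) c)) \<in> homog_span S d (deg z)"
        by (intro fs.span_sum fs.span_scale) auto
      also have "(\<Sum>e\<in>H j. (\<lambda>c. a (e, b) * G (e, b) c)) = f z"
        by (auto simp: f_def z sum_fun_apply)
      finally show ?thesis .
    qed
    have f0: "f z c = 0" if "z \<in> J" for z c
      by (rule homog_independent[OF finF finite_V dq fJ injdeg hom sum0 that])
    obtain j b e where jb: "(j, b) \<in> J" "e \<in> H j" "y = (e, b)" using *(2) by (auto simp: E'_def E_def)
    have j: "j \<le> d" using jb by (auto simp: J_def)
    have Hq: "H j \<subseteq> S \<rightarrow>\<^sub>E {..<CARD('a)}" unfolding H_def by (rule homog_exps_subset) (use j dq in simp)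
    define g where "g c = (\<Sum>e\<in>H j. a (e, b) * monomial_fun S e c)" for c
    have "g c = 0" for c
    proof (cases "b \<or> j = d")
      case True
      have "f (j, b) c = g c" unfolding f_def g_def
        by (simp, intro sum.cong refl) (use True sH in \<open>auto simp: G_def\<close>)
      then show ?thesis using f0[OF jb(1)] by simp
    next
      case False
      have fg: "f (j, b) c = (- Q (vec_of c)) ^ (d - j) * g c" for c
        unfolding f_def g_def sum_distrib_left
        by (simp, intro sum.cong refl) (use False sH in \<open>auto simp: G_def\<close>)
      \<comment> \<open>\<open>h\<close> is \<open>g\<close> as a form on the whole space. Where
        \<open>Q\<close> is nonzero the factor \<open>(- Q)^(d - j)\<close> cancels, and
        \<open>zero_on_W\<close> extends the vanishing to all of \<open>W\<close>.\<close>
      define h where "h x = (\<Sum>e\<in>H j. a (e, b) * (\<Prod>s\<in>S. B (u s) x ^ e s))" for x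
      have "(\<Sum>e\<in>H j. (\<lambda>x. a (e, b) * (\<Prod>s\<in>S. B (u s) x ^ e s))) \<in> forms j"
      proof (intro forms_sum forms_closed(4))
        fix e assume "e \<in> H j"
        then show "(\<lambda>x. \<Prod>s\<in>S. B (u s) x ^ e s) \<in> forms j"
          using monomial_in_forms[of S e j u 0] sH j d by simp
      qed
      also have "(\<Sum>e\<in>H j. (\<lambda>x. a (e, b) * (\<Prod>s\<in>S. B (u s) x ^ e s))) = h"
        by (auto simp: h_def sum_fun_apply)
      finally have hP: "line_poly j h" by (rule line_poly_forms)
      have hg: "h (vec_of c) = g c" for c
        unfolding h_def g_def monomial_fun_def
        by (intro sum.cong refl arg_cong2[where f = "(*)"] prod.cong) (simp add: uvec)
      have "h w = 0" if w: "w \<in> W" "Q w \<noteq> 0" for w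
      proof -
        obtain c where "w = vec_of c" using w(1) bij_betw_imp_surj_on[OF vec_of_bij] by blast
        then show ?thesis using fg[of c] f0[OF jb(1), of c] w(2) hg[of c] by simp
      qed
      moreover have "j < CARD('a) - 1" using False j dq by auto
      ultimately have "h (vec_of c) = 0" using zero_on_W[OF hP] by simp
      then show ?thesis using hg by simp
    qed
    then have "a (e, b) = 0"
      by (intro monomials_independent[OF finF finite_V Hq _ jb(2), of "\<lambda>e. a (e, b)"]) (simp add: g_def)
    then show "a y = 0" by (simp add: jb)
  qed
  moreover have "finite ((\<lambda>f c. f (pt (vec_of c))) ` forms d)" by (intro finite_imageI finite_funs)
  ultimately show ?thesis using card_mono[of "(\<lambda>f c. f (pt (vec_of c))) ` forms d" "fs.span (G ` E')"] cardE
    by simp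
qed

end

section \<open>Harmonic forms\<close>

context quadric_odd
begin

text \<open>The second-order operator attached to \<open>B\<close>: second derivatives are paired
  along a basis and its dual basis, which is what turns the sum over the basis into
  \<open>2 * Q w\<close> on powers of \<open>B w\<close>.\<close>

definition laplacian :: "('v \<Rightarrow> 'a) \<Rightarrow> 'v \<Rightarrow> 'a" where
  "laplacian f = (\<Sum>b\<in>V_basis. ddiff b (ddiff (dual_basis b) f))"

lemma laplacian_add: "laplacian (f + g) = laplacian f + laplacian g"
  by (simp only: laplacian_def ddiff_linear(1) sum.distrib)

lemma laplacian_scale: "laplacian (\<lambda>x. c * f x) = (\<lambda>x. c * laplacian f x)"
proof -
  have "ddiff b (ddiff (dual_basis b) (\<lambda>x. c * f x)) = (\<lambda>x. c * ddiff b (ddiff (dual_basis b) f) x)" for b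
    by (subst ddiff_linear(2), subst ddiff_linear(2), rule refl)
  then show ?thesis unfolding laplacian_def by (simp add: fun_eq_iff sum_fun_apply sum_distrib_left)
qed

lemma laplacian_zero: "laplacian 0 = 0"
  by (simp only: laplacian_def ddiff_linear(3) sum.neutral_const)

text \<open>The factor \<open>Q w\<close> makes the powers of \<open>B w\<close> with
  \<open>w\<close> singular harmonic; this links harmonic forms to the rows of the incidence
  kernel.\<close>

lemma laplacian_power:
  assumes d: "d \<le> CARD('a) - 1"
  shows "laplacian (\<lambda>x. B w x ^ d) = (\<lambda>x. of_nat d * of_nat (d - 1) * (2 * Q w) * B w x ^ (d - 2))"
proof
  fix x
  have "ddiff b (ddiff (dual_basis b) (\<lambda>x. B w x ^ d)) x =
      of_nat d * of_nat (d - 1) * B w x ^ (d - 2) * (B (dual_basis b) w * B b w)" for b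
  proof -
    have "ddiff b (ddiff (dual_basis b) (\<lambda>x. B w x ^ d)) = ddiff b (\<lambda>x. (of_nat d * B w (dual_basis b)) * B w x ^ (d - 1))"
      by (simp only: ddiff_B_power[OF d])
    also have "\<dots> = (\<lambda>x. (of_nat d * B w (dual_basis b)) * ddiff b (\<lambda>x. B w x ^ (d - 1)) x)"
      by (rule ddiff_linear(2))
    also have "ddiff b (\<lambda>x. B w x ^ (d - 1)) = (\<lambda>x. of_nat (d - 1) * B w b * B w x ^ (d - 1 - 1))"
      by (rule ddiff_B_power) (use d in simp)
    also have "d - 1 - 1 = d - 2" by simp
    finally show ?thesis by (simp only: B_sym[of w "dual_basis b"] B_sym[of w b] mult_ac)
  qed
  then have "laplacian (\<lambda>x. B w x ^ d) x = of_nat d * of_nat (d - 1) * B w x ^ (d - 2) * (\<Sum>b\<in>V_basis. B (dual_basis b) w * B b w)"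
    by (simp add: laplacian_def sum_fun_apply sum_distrib_left)
  also have "(\<Sum>b\<in>V_basis. B (dual_basis b) w * B b w) = 2 * Q w" using B_coords[of w w] by (simp add: B_self)
  finally show "laplacian (\<lambda>x. B w x ^ d) x = of_nat d * of_nat (d - 1) * (2 * Q w) * B w x ^ (d - 2)"
    by (simp add: mult_ac)
qed

lemma laplacian_forms:
  assumes "f \<in> forms d" "d \<le> CARD('a) - 1" shows "laplacian f \<in> forms (d - 2)"
proof -
  have "ddiff b (ddiff (dual_basis b) f) \<in> forms (d - 1 - 1)" for b
    by (intro ddiff_forms assms) (use assms in simp)
  then show ?thesis unfolding laplacian_def by (intro forms_sum) (simp add: numeral_2_eq_2)
qed

lemma laplacian_small:
  assumes "f \<in> forms d" "d < 2" shows "laplacian f = 0"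
  using assms(1)
proof (induction rule: forms_induct)
  case zero
  then show ?case by (rule laplacian_zero)
next
  case (step c v g)
  have "d \<le> CARD('a) - 1" using assms(2) finite_field_card_pos[OF finF] by simp
  from laplacian_power[OF this, of v] have "laplacian (\<lambda>x. B v x ^ d) = 0"
    using assms(2) by (auto simp: less_2_cases_iff fun_eq_iff)
  then have "laplacian (\<lambda>x. c * B v x ^ d) = 0" unfolding laplacian_scale by (simp add: fun_eq_iff)
  then show ?case using step(2) by (simp only: laplacian_add add_0)
qed

text \<open>The two sums are the cross terms that the product rule produces in
  \<open>laplacian_Q\<close>.\<close>

lemma euler:
  assumes f: "f \<in> forms d" and d: "d \<le> CARD('a) - 1"
  shows "(\<Sum>b\<in>V_basis. B b x * ddiff (dual_basis b) f x) = of_nat d * f x"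
    and "(\<Sum>b\<in>V_basis. B (dual_basis b) x * ddiff b f x) = of_nat d * f x"
proof -
  have "(\<Sum>b\<in>V_basis. B b x * ddiff (dual_basis b) f x) = of_nat d * f x \<and>
     (\<Sum>b\<in>V_basis. B (dual_basis b) x * ddiff b f x) = of_nat d * f x"
    using f
  proof (induction rule: forms_induct)
    case zero
    show ?case by (simp add: ddiff_def)
  next
    case (step c w g)
    have D: "ddiff u ((\<lambda>x. c * B w x ^ d) + g) x = c * (of_nat d * B w u * B w x ^ (d - 1)) + ddiff u g x" for u
      unfolding ddiff_linear(1) plus_fun_apply by (subst ddiff_linear(2)) (simp only: ddiff_B_power[OF d])
    have pw: "of_nat d * B w x ^ (d - 1) * B w x = of_nat d * B w x ^ d" by (cases d) auto
    have 1: "(\<Sum>b\<in>V_basis. B b x * B w (dual_basis b)) = B w x" using B_coords[of w x] by (simp add: B_sym[of w] mult.commute)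
    have 2: "(\<Sum>b\<in>V_basis. B (dual_basis b) x * B w b) = B w x" using B_coords[of x w] by (simp add: B_sym[of w])
    have "(\<Sum>b\<in>V_basis. B b x * ddiff (dual_basis b) ((\<lambda>x. c * B w x ^ d) + g) x) =
        c * (of_nat d * B w x ^ (d - 1)) * (\<Sum>b\<in>V_basis. B b x * B w (dual_basis b)) + (\<Sum>b\<in>V_basis. B b x * ddiff (dual_basis b) g x)"
      unfolding D by (simp add: distrib_left sum.distrib sum_distrib_left mult_ac)
    also have "\<dots> = of_nat d * ((\<lambda>x. c * B w x ^ d) + g) x"
      unfolding 1 using step pw by (simp add: distrib_left mult_ac)
    finally have A: "(\<Sum>b\<in>V_basis. B b x * ddiff (dual_basis b) ((\<lambda>x. c * B w x ^ d) + g) x) = of_nat d * ((\<lambda>x. c * B w x ^ d) + g) x" .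
    have "(\<Sum>b\<in>V_basis. B (dual_basis b) x * ddiff b ((\<lambda>x. c * B w x ^ d) + g) x) =
        c * (of_nat d * B w x ^ (d - 1)) * (\<Sum>b\<in>V_basis. B (dual_basis b) x * B w b) + (\<Sum>b\<in>V_basis. B (dual_basis b) x * ddiff b g x)"
      unfolding D by (simp add: distrib_left sum.distrib sum_distrib_left mult_ac)
    also have "\<dots> = of_nat d * ((\<lambda>x. c * B w x ^ d) + g) x"
      unfolding 2 using step pw by (simp add: distrib_left mult_ac)
    finally show ?case using A by blast
  qed
  then show "(\<Sum>b\<in>V_basis. B b x * ddiff (dual_basis b) f x) = of_nat d * f x"
    and "(\<Sum>b\<in>V_basis. B (dual_basis b) x * ddiff b f x) = of_nat d * f x" by blast+
qed

text \<open>Applied to \<open>Q f\<close>, the two cross terms each give d by Euler's identity, and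
  the second derivatives of \<open>Q\<close> give the trace n of a dual pair of bases.\<close>

lemma laplacian_Q:
  assumes f: "f \<in> forms d" and d: "d + 2 < p"
  shows "laplacian (\<lambda>x. Q x * f x) = (\<lambda>x. Q x * laplacian f x + (of_nat n + 2 * of_nat d) * f x)"
proof
  fix x
  have q3: "CARD('a) > 2" using p p_le_q by simp
  have dq: "d \<le> CARD('a) - 1" "2 + d \<le> CARD('a) - 1" "2 + (d - 1) \<le> CARD('a) - 1" "d + 1 \<le> CARD('a) - 1"
    using d p_le_q by auto
  have one: "ddiff b (ddiff u (\<lambda>x. Q x * f x)) x =
     Q x * ddiff b (ddiff u f) x + B b x * ddiff u f x + (f x * B u b + B u x * ddiff b f x)" for b u
  proof -
    have "ddiff u (\<lambda>x. Q x * f x) = (\<lambda>x. Q x * ddiff u f x + f x * ddiff u Q x)"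
      by (rule ddiff_mult[OF line_poly_Q line_poly_forms[OF f] dq(2)])
    also have "\<dots> = (\<lambda>x. Q x * ddiff u f x) + (\<lambda>x. f x * B u x)"
      by (auto simp: ddiff_Q[OF q3])
    finally have "ddiff b (ddiff u (\<lambda>x. Q x * f x)) x =
       ddiff b (\<lambda>x. Q x * ddiff u f x) x + ddiff b (\<lambda>x. f x * B u x) x" by (simp only: ddiff_linear(1) plus_fun_apply)
    also have "ddiff b (\<lambda>x. Q x * ddiff u f x) = (\<lambda>x. Q x * ddiff b (ddiff u f) x + ddiff u f x * ddiff b Q x)"
      by (rule ddiff_mult[OF line_poly_Q line_poly_forms[OF ddiff_forms[OF f dq(1)]] dq(3)])
    also have "ddiff b (\<lambda>x. f x * B u x) = (\<lambda>x. f x * ddiff b (B u) x + B u x * ddiff b f x)"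
      by (rule ddiff_mult[OF line_poly_forms[OF f] line_poly_B dq(4)])
    finally show ?thesis by (simp add: ddiff_Q[OF q3] ddiff_B mult.commute)
  qed
  have "laplacian (\<lambda>x. Q x * f x) x = (\<Sum>b\<in>V_basis. Q x * ddiff b (ddiff (dual_basis b) f) x) + (\<Sum>b\<in>V_basis. B b x * ddiff (dual_basis b) f x)
     + ((\<Sum>b\<in>V_basis. f x * B (dual_basis b) b) + (\<Sum>b\<in>V_basis. B (dual_basis b) x * ddiff b f x))"
    unfolding laplacian_def sum_fun_apply one sum.distrib ..
  also have "(\<Sum>b\<in>V_basis. f x * B (dual_basis b) b) = of_nat n * f x" by (simp add: dual_basis card_V_basis)
  also have "(\<Sum>b\<in>V_basis. Q x * ddiff b (ddiff (dual_basis b) f) x) = Q x * laplacian f x"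
    by (simp add: laplacian_def sum_fun_apply sum_distrib_left)
  finally show "laplacian (\<lambda>x. Q x * f x) x = Q x * laplacian f x + (of_nat n + 2 * of_nat d) * f x"
    unfolding euler[OF f dq(1)] by (simp add: algebra_simps)
qed

lemma Qpow_forms:
  assumes "f \<in> forms \<mu>" "\<mu> + 2 * j < p" shows "(\<lambda>x. Q x ^ j * f x) \<in> forms (\<mu> + 2 * j)"
  using assms(2)
proof (induction j)
  case 0
  then show ?case using assms(1) by simp
next
  case (Suc j)
  have "(\<lambda>x. Q x * (Q x ^ j * f x)) \<in> forms (\<mu> + 2 * j + 2)" by (rule Q_mult_forms) (use Suc in auto)
  then show ?case by (simp add: mult.assoc add.assoc)
qed

text \<open>Iterating \<open>laplacian_Q\<close> adds n + 2(\<mu> + 2i) for i < j, with sum j(n +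
  2\<mu> + 2j - 2).\<close>

lemma laplacian_Qpow:
  assumes f: "f \<in> forms \<mu>" and "\<mu> + 2 * j < p"
  shows "laplacian (\<lambda>x. Q x ^ j * f x) =
    (\<lambda>x. Q x ^ j * laplacian f x + of_nat j * (of_nat n + 2 * of_nat \<mu> + 2 * of_nat j - 2) * (Q x ^ (j - 1) * f x))"
  using assms(2)
proof (induction j)
  case 0
  then show ?case by simp
next
  case (Suc j)
  have "laplacian (\<lambda>x. Q x ^ Suc j * f x) = laplacian (\<lambda>x. Q x * (Q x ^ j * f x))" by (simp add: mult.assoc)
  also have "\<dots> = (\<lambda>x. Q x * laplacian (\<lambda>x. Q x ^ j * f x) x + (of_nat n + 2 * of_nat (\<mu> + 2 * j)) * (Q x ^ j * f x))"
    by (rule laplacian_Q) (use Suc Qpow_forms[OF f] in auto)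
  also have "laplacian (\<lambda>x. Q x ^ j * f x) = (\<lambda>x. Q x ^ j * laplacian f x + of_nat j * (of_nat n + 2 * of_nat \<mu> + 2 * of_nat j - 2) * (Q x ^ (j - 1) * f x))"
    by (rule Suc.IH) (use Suc.prems in simp)
  finally show ?case
    by (cases j) (auto simp: fun_eq_iff algebra_simps)
qed

text \<open>For nonsingular \<open>v\<close> the power of \<open>B v\<close> is reached directly, as
  its scalar is invertible. For singular \<open>v\<close>, a polynomial of degree below q-1 sums to
  0 over the field, so the power at \<open>v\<close> is minus the sum of the powers at
  \<open>v + s *s y\<close> with s nonzero, all of which are nonsingular.\<close>

lemma laplacian_surj:
  assumes d: "2 \<le> d" "d < p"
  shows "laplacian ` forms d = forms (d - 2)"
proof
  have dq: "d \<le> CARD('a) - 1" using d p_le_q by simp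
  then show "laplacian ` forms d \<subseteq> forms (d - 2)" using laplacian_forms by blast
  have sub: "fs.subspace (laplacian ` forms d)"
  proof (rule fs.subspaceI)
    show "0 \<in> laplacian ` forms d" by (rule image_eqI[of _ _ 0]) (simp_all only: laplacian_zero forms_closed)
  next
    fix f g assume "f \<in> laplacian ` forms d" "g \<in> laplacian ` forms d"
    then obtain f' g' where "f' \<in> forms d" "g' \<in> forms d" "f = laplacian f'" "g = laplacian g'" by blast
    then show "f + g \<in> laplacian ` forms d"
      by (intro image_eqI[of _ _ "f' + g'"] forms_closed) (simp_all only: laplacian_add)
  next
    fix k f assume "f \<in> laplacian ` forms d"
    then obtain f' where "f' \<in> forms d" "f = laplacian f'" by blast
    then show "(\<lambda>x. k * f x) \<in> laplacian ` forms d"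
      by (intro image_eqI[of _ _ "\<lambda>x. k * f' x"] forms_closed) (simp_all only: laplacian_scale)
  qed
  have ns: "(\<lambda>x. B v x ^ (d - 2)) \<in> laplacian ` forms d" if v: "Q v \<noteq> 0" for v
  proof -
    define c where "c = of_nat d * of_nat (d - 1) * (2 * Q v)"
    have "c \<noteq> 0" unfolding c_def using of_nat_nonzero[of d] of_nat_nonzero[of "d - 1"] two_nonzero v d
      by auto
    then have "(\<lambda>x. (1 / c) * (c * B v x ^ (d - 2))) = (\<lambda>x. B v x ^ (d - 2))" by simp
    moreover have "laplacian (\<lambda>x. (1 / c) * B v x ^ d) = (\<lambda>x. (1 / c) * (c * B v x ^ (d - 2)))"
      unfolding laplacian_scale by (simp only: laplacian_power[OF dq] c_def)
    ultimately show ?thesis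
      by (intro image_eqI[of _ _ "\<lambda>x. (1 / c) * B v x ^ d"] forms_closed(4) forms_power) simp
  qed
  have sing: "(\<lambda>x. B v x ^ (d - 2)) \<in> laplacian ` forms d" if y: "Q v = 0" "B v y \<noteq> 0" "Q y = 0" for v y
  proof -
    have "(\<Sum>s\<in>UNIV - {0}. (\<lambda>x. (- 1) * B (v + s *s y) x ^ (d - 2))) \<in> laplacian ` forms d"
      by (intro fs.subspace_sum[OF sub] fs.subspace_scale[OF sub] ns) (use y in \<open>auto simp: Q_add Q_scale B_lin\<close>)
    also have "(\<Sum>s\<in>UNIV - {0}. (\<lambda>x. (- 1) * B (v + s *s y) x ^ (d - 2))) = (\<lambda>x. B v x ^ (d - 2))"
    proof
      fix x
      let ?P = "[:B v x, B y x:] ^ (d - 2)"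
      have deg: "degree ?P < CARD('a) - 1"
        using degree_power_le[of "[:B v x, B y x:]" "d - 2"] d p_le_q by (auto split: if_splits)
      have "(\<Sum>s\<in>UNIV. s ^ (CARD('a) - 1 - (CARD('a) - 1)) * poly ?P s) = - coeff ?P (CARD('a) - 1)"
        by (rule sum_poly_coeff[OF finF]) (use deg finite_field_card_pos[OF finF] in auto)
      then have "(\<Sum>s\<in>UNIV. B (v + s *s y) x ^ (d - 2)) = 0"
        using coeff_eq_0[OF deg] by (simp add: B_lin)
      then have "B v x ^ (d - 2) + (\<Sum>s\<in>UNIV - {0}. B (v + s *s y) x ^ (d - 2)) = 0"
        using sum.remove[OF finF, of 0 "\<lambda>s. B (v + s *s y) x ^ (d - 2)"] by simp
      then show "(\<Sum>s\<in>UNIV - {0}. (\<lambda>x. (- 1) * B (v + s *s y) x ^ (d - 2))) x = B v x ^ (d - 2)"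
        by (simp add: sum_fun_apply sum_negf add_eq_0_iff2)
    qed
    finally show ?thesis .
  qed
  have "(\<lambda>x. B v x ^ (d - 2)) \<in> laplacian ` forms d" for v
  proof (cases "Q v = 0")
    case True
    show ?thesis
    proof (cases "v = 0")
      case False
      then show ?thesis using hyperbolic_partner[OF True False] sing[OF True] by (metis zero_neq_one)
    next
      case v0: True
      show ?thesis
      proof (cases "d = 2")
        case True
        \<comment> \<open>For d = 2 the target is the constant 1 even at \<open>v = 0\<close>, and
          any nonsingular vector reaches it.\<close>
        have "Q (e1 + e2) \<noteq> 0" by (simp add: Q_add e12)
        from ns[OF this] show ?thesis using True by simp
      next
        case False
        then have "(\<lambda>x. B v x ^ (d - 2)) = 0" using v0 d by (auto simp: fun_eq_iff)
        then show ?thesis using fs.subspace_0[OF sub] by simp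
      qed
    qed
  qed (use ns in blast)
  then have "range (\<lambda>v x. B v x ^ (d - 2)) \<subseteq> laplacian ` forms d" by blast
  then show "forms (d - 2) \<subseteq> laplacian ` forms d" unfolding forms_def[of "d - 2"] by (rule fs.span_minimal[OF _ sub])
qed

definition harmonic :: "nat \<Rightarrow> ('v \<Rightarrow> 'a) set" where "harmonic d = {f \<in> forms d. laplacian f = 0}"

lemma card_harmonic:
  assumes d: "d < p"
  shows "card (harmonic d) * CARD('a) ^ (if d < 2 then 0 else n + (d - 2) - 1 choose (d - 2)) = CARD('a) ^ (n + d - 1 choose d)"
proof (cases "d < 2")
  case True
  then have "harmonic d = forms d" using laplacian_small by (auto simp: harmonic_def)
  then show ?thesis using True card_forms[OF d] by simp
next
  case False
  have Ldiff: "laplacian (f - g) = laplacian f - laplacian g" for f g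
  proof -
    have "laplacian f = laplacian (f - g) + laplacian g" by (simp only: laplacian_add[symmetric] diff_add_cancel)
    then show ?thesis by (simp only: eq_diff_eq)
  qed
  have "card (forms d) = card (laplacian ` forms d) * card {f \<in> forms d. laplacian f = 0}"
    by (rule card_image_kernel[OF finite_funs]) (use forms_closed(1,3) Ldiff in blast)+
  then show ?thesis using laplacian_surj[of d] False d card_forms[of "d - 2"] card_forms[OF d]
    by (simp add: harmonic_def mult.commute)
qed

end

section \<open>The rank in odd characteristic\<close>

context quadric_odd
begin

definition D where "D = p - 1"

definition forms_dim where "forms_dim d = (n + d - 1 choose d)"

lemma card_P_forms_dim: "d < p \<Longrightarrow> card (forms d) = CARD('a) ^ forms_dim d"
  by (simp add: card_forms forms_dim_def)

lemma card_H_forms_dim: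
  assumes "d < p"
  shows "card (harmonic d) * CARD('a) ^ (if d < 2 then 0 else forms_dim (d - 2)) = CARD('a) ^ forms_dim d"
  using card_harmonic[OF assms] by (simp only: forms_dim_def)

definition vanishing_forms :: "('v \<Rightarrow> 'a) set" where "vanishing_forms = {f \<in> forms D. \<forall>x\<in>X0. f x = 0}"

definition restr :: "('v \<Rightarrow> 'a) \<Rightarrow> 'v \<Rightarrow> 'a" where "restr f = (\<lambda>b. if b \<in> X0 then f b else 0)"

lemma D_bounds: "2 \<le> D" "D < p" "D \<le> CARD('a) - 1"
  using p p_le_q by (auto simp: D_def)

lemma card_H_D: "card (harmonic D) * CARD('a) ^ forms_dim (D - 2) = CARD('a) ^ forms_dim D"
  using card_H_forms_dim[OF D_bounds(2)] D_bounds(1) by (simp only: not_less[symmetric] if_False)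

lemma laplacian_diff: "laplacian (f - g) = laplacian f - laplacian g"
proof -
  have "laplacian f = laplacian (f - g) + laplacian g" by (simp only: laplacian_add[symmetric] diff_add_cancel)
  then show ?thesis by (simp only: eq_diff_eq)
qed

lemma QP_subset_vanishing_forms: "(\<lambda>g x. Q x * g x) ` forms (D - 2) \<subseteq> vanishing_forms"
proof (rule image_subsetI)
  fix g assume "g \<in> forms (D - 2)"
  then have "(\<lambda>x. Q x * g x) \<in> forms (D - 2 + 2)" by (rule Q_mult_forms) (use D_bounds in simp)
  moreover have "D - 2 + 2 = D" using D_bounds by simp
  ultimately show "(\<lambda>x. Q x * g x) \<in> vanishing_forms" using X0_X by (auto simp: vanishing_forms_def X_def)
qed

lemma card_QP: "card ((\<lambda>g x. Q x * g x) ` forms (D - 2)) = CARD('a) ^ forms_dim (D - 2)"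
proof -
  have "inj_on (\<lambda>g x. Q x * g x) (forms (D - 2))"
  proof (rule inj_onI)
    fix f g assume fg: "f \<in> forms (D - 2)" "g \<in> forms (D - 2)" "(\<lambda>x. Q x * f x) = (\<lambda>x. Q x * g x)"
    have "(f - g) x = 0" for x
    proof (rule Q_mult_inj)
      show "line_poly (D - 2) (f - g)" by (intro line_poly_forms forms_closed fg)
      show "D - 2 < CARD('a) - 1" using D_bounds by simp
      show "Q x * (f - g) x = 0" for x using fun_cong[OF fg(3), of x] by (simp add: algebra_simps)
    qed
    then show "f = g" by (auto simp: fun_eq_iff)
  qed
  then show ?thesis using card_P_forms_dim[of "D - 2"] D_bounds by (simp add: card_image)
qed

lemma choose_mono_D: "forms_dim (D - 2) \<le> forms_dim D"
proof -
  have "vanishing_forms \<subseteq> forms D" by (auto simp: vanishing_forms_def)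
  then have "card ((\<lambda>g x. Q x * g x) ` forms (D - 2)) \<le> card (forms D)"
    using QP_subset_vanishing_forms by (intro card_mono finite_funs) auto
  then show ?thesis using card_QP card_P_forms_dim[OF D_bounds(2)] finite_field_card_pos[OF finF]
    by (metis power_increasing_iff)
qed

definition \<nu> where "\<nu> = forms_dim D - forms_dim (D - 2)"

lemma \<nu>: "\<nu> + forms_dim (D - 2) = forms_dim D"
  using choose_mono_D by (simp add: \<nu>_def)

lemma card_P_vanishing_forms: "card (forms D) = card (restr ` forms D) * card vanishing_forms"
proof -
  have "card (forms D) = card (restr ` forms D) * card {f \<in> forms D. restr f = 0}"
  proof (rule card_image_kernel[OF finite_funs])
    show "forms D \<noteq> {}" using forms_closed(1) by blast
  qed (auto simp: restr_def fun_eq_iff intro!: forms_closed(3))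
  moreover have "{f \<in> forms D. restr f = 0} = vanishing_forms" by (auto simp: vanishing_forms_def restr_def fun_eq_iff)
  ultimately show ?thesis by simp
qed

text \<open>A squeeze: restrictions number at least q^\<nu>, vanishing forms at least as many as the
  multiples of \<open>Q\<close>, and the product of the two counts is the number of forms. Both
  bounds are therefore sharp.\<close>

lemma card_restr: "card (restr ` forms D) = CARD('a) ^ \<nu>" and vanishing_forms_eq: "vanishing_forms = (\<lambda>g x. Q x * g x) ` forms (D - 2)"
proof -
  let ?q = "CARD('a)" and ?N = "forms_dim (D - 2)"
  have q0: "?q > 0" using finite_field_card_pos[OF finF] by simp
  have fin2: "finite ((\<lambda>f c. f (pt (vec_of c))) ` forms D)" by (intro finite_imageI finite_funs)
  have "card (forms D) = card ((\<lambda>f c. f (pt (vec_of c))) ` forms D) * card {f \<in> forms D. (\<lambda>c. f (pt (vec_of c))) = 0}"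
  proof (rule card_image_kernel[OF finite_funs])
    show "forms D \<noteq> {}" using forms_closed(1) by blast
  qed (auto simp: fun_eq_iff intro!: forms_closed(3))
  moreover have "{f \<in> forms D. (\<lambda>c. f (pt (vec_of c))) = 0} = vanishing_forms"
    using X0_zero_iff by (auto simp: vanishing_forms_def fun_eq_iff)
  ultimately have 1: "?q ^ (\<nu> + ?N) = card ((\<lambda>f c. f (pt (vec_of c))) ` forms D) * card vanishing_forms"
    using card_P_forms_dim[OF D_bounds(2)] \<nu> by simp
  have ge: "?q ^ \<nu> \<le> card ((\<lambda>f c. f (pt (vec_of c))) ` forms D)"
    by (rule card_restriction_ge[OF D_bounds(1,2) \<nu>[unfolded forms_dim_def]])
  have Kge: "?q ^ ?N \<le> card vanishing_forms"
    unfolding card_QP[symmetric] by (rule card_mono[OF finite_funs QP_subset_vanishing_forms])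
  have "?q ^ \<nu> * card vanishing_forms \<le> ?q ^ \<nu> * ?q ^ ?N"
    using mult_le_mono1[OF ge, of "card vanishing_forms"] 1 by (simp add: power_add)
  then have "card vanishing_forms \<le> ?q ^ ?N" using q0 by simp
  with Kge have cK: "card vanishing_forms = ?q ^ ?N" by simp
  show "card (restr ` forms D) = ?q ^ \<nu>"
  proof -
    have "card (restr ` forms D) * ?q ^ ?N = ?q ^ \<nu> * ?q ^ ?N"
      using card_P_vanishing_forms cK card_P_forms_dim[OF D_bounds(2)] \<nu> by (metis power_add)
    then show ?thesis using q0 by simp
  qed
  show "vanishing_forms = (\<lambda>g x. Q x * g x) ` forms (D - 2)"
    by (rule card_subset_eq[symmetric, OF finite_funs QP_subset_vanishing_forms]) (simp add: card_QP cK)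
qed

lemma row_span_restr:
  "row_span A X0 (\<lambda>x y. B x y ^ D) = restr ` fs.span ((\<lambda>x y. B x y ^ D) ` A)"
proof -
  have "fs.span ((\<lambda>x y. B x y ^ D) ` A) = range (\<lambda>c. \<Sum>a\<in>A. (\<lambda>y. c a * B a y ^ D))"
    by (rule fs.span_image_eq) simp
  then show ?thesis
    by (auto simp: row_span_def restr_def fun_eq_iff sum_fun_apply image_iff)
qed

text \<open>Row rank equals column rank for the array on \<open>X0\<close> times the whole space.
  Its column side consists of the restrictions of all forms to \<open>X0\<close>, of dimension
  \<nu>, and the harmonic forms have that dimension too; one inclusion then suffices.\<close>

lemma span_X0_eq_harmonic: "fs.span ((\<lambda>x y. B x y ^ D) ` X0) = harmonic D"
proof -
  let ?q = "CARD('a)"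
  define DD where "DD = fs.span ((\<lambda>x y. B x y ^ D) ` X0)"
  obtain r where r: "has_rank X0 (UNIV :: 'v set) (\<lambda>x y. B x y ^ D) r"
    using has_rank_exists[of X0 UNIV "\<lambda>x y. B x y ^ D"] by auto
  have "row_span X0 UNIV (\<lambda>x y. B x y ^ D) = DD"
  proof -
    have "DD = range (\<lambda>c. \<Sum>a\<in>X0. (\<lambda>y. c a * B a y ^ D))"
      unfolding DD_def by (rule fs.span_image_eq) simp
    then show ?thesis by (auto simp: row_span_def fun_eq_iff sum_fun_apply image_iff)
  qed
  then have DDr: "card DD = ?q ^ r" using card_row_span[OF r] by simp
  have "has_rank (UNIV :: 'v set) X0 (\<lambda>y x. B x y ^ D) r" by (rule has_rank_transpose[OF r])
  then have "has_rank (UNIV :: 'v set) X0 (\<lambda>x y. B x y ^ D) r"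
    by (rule has_rank_cong_imp) (simp add: B_sym)
  from card_row_span[OF this] have "card (restr ` forms D) = ?q ^ r"
    by (simp add: row_span_restr forms_def)
  then have cDD: "card DD = ?q ^ \<nu>" using DDr card_restr by simp
  have "card (harmonic D) * ?q ^ forms_dim (D - 2) = ?q ^ \<nu> * ?q ^ forms_dim (D - 2)"
    using card_H_D \<nu> by (simp flip: power_add)
  then have cH: "card (harmonic D) = ?q ^ \<nu>" using finite_field_card_pos[OF finF] by simp
  have "fs.subspace (harmonic D)"
  proof (rule fs.subspaceI)
    show "0 \<in> harmonic D" unfolding harmonic_def using forms_closed(1) laplacian_zero by blast
  next
    fix f g assume "f \<in> harmonic D" "g \<in> harmonic D"
    then show "f + g \<in> harmonic D"
      unfolding harmonic_def by (simp only: mem_Collect_eq laplacian_add forms_closed(2) add_0 simp_thms)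
  next
    fix c f assume "f \<in> harmonic D"
    then have "f \<in> forms D" "laplacian f = 0" by (simp_all add: harmonic_def)
    then show "(\<lambda>x. c * f x) \<in> harmonic D"
      unfolding harmonic_def using forms_closed(4) laplacian_scale[of c f] by (auto simp: fun_eq_iff)
  qed
  moreover have "(\<lambda>x y. B x y ^ D) ` X0 \<subseteq> harmonic D"
  proof (rule image_subsetI)
    fix x assume "x \<in> X0"
    then have "Q x = 0" using X0_X by (auto simp: X_def)
    then show "(\<lambda>y. B x y ^ D) \<in> harmonic D"
      unfolding harmonic_def using laplacian_power[OF D_bounds(3), of x] forms_power[of x D] by (simp add: fun_eq_iff)
  qed
  ultimately have "DD \<subseteq> harmonic D" unfolding DD_def by (intro fs.span_minimal)
  then have "DD = harmonic D" by (intro card_subset_eq finite_funs) (simp_all add: cDD cH)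
  then show ?thesis by (simp add: DD_def)
qed

text \<open>By \<open>vanishing_forms_eq\<close> this is the kernel of restriction to the chart on
  harmonic forms; its size separates the two cases of the rank formula.\<close>

definition harmonic_multiples where "harmonic_multiples = harmonic D \<inter> (\<lambda>g x. Q x * g x) ` forms (D - 2)"

lemma rank_harmonic_multiples:
  assumes rk: "has_rank X0 X0 (\<lambda>x y. B x y ^ D) r"
  shows "CARD('a) ^ r * card harmonic_multiples * CARD('a) ^ forms_dim (D - 2) = CARD('a) ^ forms_dim D"
proof -
  have "card (restr ` harmonic D) = CARD('a) ^ r"
    using card_row_span[OF rk] row_span_restr[of X0] span_X0_eq_harmonic by simp
  moreover have "card (harmonic D) = card (restr ` harmonic D) * card {f \<in> harmonic D. restr f = 0}"
  proof (rule card_image_kernel[OF finite_funs])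
    show "harmonic D \<noteq> {}" using forms_closed(1)[of D] laplacian_zero unfolding harmonic_def by blast
    show "x - y \<in> harmonic D" if "x \<in> harmonic D" "y \<in> harmonic D" for x y
      using that forms_closed(3)[of x D y] laplacian_diff[of x y] unfolding harmonic_def by (simp only: mem_Collect_eq) simp
  qed (auto simp: restr_def fun_eq_iff)
  moreover have "{f \<in> harmonic D. restr f = 0} = harmonic D \<inter> vanishing_forms"
    by (auto simp: vanishing_forms_def harmonic_def restr_def fun_eq_iff)
  ultimately have "card (harmonic D) = CARD('a) ^ r * card harmonic_multiples" by (simp add: harmonic_multiples_def vanishing_forms_eq)
  then show ?thesis using card_H_D by simp
qed

lemma harmonic_multiples_structure:
  assumes f: "f \<in> harmonic_multiples" "f \<noteq> (\<lambda>x. 0)"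
  shows "\<exists>j g. 1 \<le> j \<and> 2 * j \<le> D \<and> p dvd (n + 2 * (D - 2 * j) + 2 * j - 2) \<and>
    g \<in> harmonic (D - 2 * j) \<and> f = (\<lambda>x. Q x ^ j * g x)"
proof -
  \<comment> \<open>For the largest power \<open>j\<close> of \<open>Q\<close> dividing \<open>f\<close>, the commutation relation forces its scalar to vanish.\<close>
  define T where "T = {j. 2 * j \<le> D \<and> (\<exists>g\<in>forms (D - 2 * j). f = (\<lambda>x. Q x ^ j * g x))}"
  have T1: "1 \<in> T"
  proof -
    obtain g where "g \<in> forms (D - 2)" "f = (\<lambda>x. Q x * g x)" using f(1) unfolding harmonic_multiples_def by blast
    then show ?thesis using D_bounds(1) unfolding T_def by (intro CollectI conjI bexI[of _ g]) auto
  qed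
  have finT: "finite T" by (rule finite_subset[of _ "{..D}"]) (auto simp: T_def)
  define j where "j = Max T"
  have jT: "j \<in> T" unfolding j_def by (rule Max_in) (use finT T1 in auto)
  have j1: "1 \<le> j" unfolding j_def by (rule Max_ge[OF finT T1])
  have jmax: "i \<le> j" if "i \<in> T" for i unfolding j_def by (rule Max_ge[OF finT that])
  define \<mu> where "\<mu> = D - 2 * j"
  obtain g where g: "g \<in> forms \<mu>" "f = (\<lambda>x. Q x ^ j * g x)" and j2: "2 * j \<le> D"
    using jT by (auto simp: T_def \<mu>_def)
  have \<mu>: "\<mu> + 2 * j = D" "\<mu> \<le> CARD('a) - 1" "\<mu> < CARD('a) - 1" "\<mu> + 2 * j < p"
    using j1 j2 D_bounds by (auto simp: \<mu>_def)
  define c where "c = (of_nat j * (of_nat n + 2 * of_nat \<mu> + 2 * of_nat j - 2) :: 'a)"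
  have "laplacian f = (\<lambda>x. Q x ^ j * laplacian g x + c * (Q x ^ (j - 1) * g x))"
    unfolding g(2) c_def by (rule laplacian_Qpow[OF g(1) \<mu>(4)])
  moreover have "laplacian f = (\<lambda>x. 0)" using f(1) by (auto simp: harmonic_multiples_def harmonic_def)
  ultimately have eq: "Q x ^ j * laplacian g x + c * (Q x ^ (j - 1) * g x) = 0" for x by (metis (no_types))
  \<comment> \<open>\<open>h\<close> is what remains of the commutation relation after division by
    \<open>Q^(j-1)\<close>. It is again a form of degree \<open>\<mu>\<close>, so vanishing off the
    quadric makes it vanish everywhere.\<close>
  define h where "h x = Q x * laplacian g x + c * g x" for x
  have hP: "h \<in> forms \<mu>"
  proof (cases "\<mu> < 2")
    case True
    then have "h = (\<lambda>x. c * g x)" using laplacian_small[OF g(1)] by (auto simp: h_def)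
    then show ?thesis using forms_closed(4)[OF g(1)] by simp
  next
    case False
    have "(\<lambda>x. Q x * laplacian g x) \<in> forms (\<mu> - 2 + 2)"
      by (rule Q_mult_forms[OF laplacian_forms[OF g(1) \<mu>(2)]]) (use False \<mu> D_bounds in auto)
    also have "\<mu> - 2 + 2 = \<mu>" using False by simp
    finally have "(\<lambda>x. Q x * laplacian g x) + (\<lambda>x. c * g x) \<in> forms \<mu>"
      by (intro forms_closed(2) forms_closed(4)[OF g(1)])
    also have "(\<lambda>x. Q x * laplacian g x) + (\<lambda>x. c * g x) = h" by (auto simp: h_def)
    finally show ?thesis .
  qed
  have Qh: "Q x * h x = 0" for x
  proof -
    have "Q x ^ j = Q x * Q x ^ (j - 1)" using j1 by (cases j) auto
    then have "Q x ^ (j - 1) * h x = 0" using eq[of x] by (simp add: h_def algebra_simps)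
    then show ?thesis by auto
  qed
  have h0: "h x = 0" for x by (rule Q_mult_inj[OF line_poly_forms[OF hP] \<mu>(3) Qh])
  have c0: "c = 0"
  proof (rule ccontr)
    assume c: "c \<noteq> 0"
    \<comment> \<open>A nonzero scalar would make \<open>g\<close> itself a multiple of
      \<open>Q\<close>, against the maximality of \<open>j\<close>.\<close>
    have gx: "g x = Q x * ((- 1 / c) * laplacian g x)" for x
    proof -
      have "c * g x = - (Q x * laplacian g x)" using h0[of x] by (simp add: h_def add_eq_0_iff add.commute)
      then have "g x = - (Q x * laplacian g x) / c" using c by (metis nonzero_mult_div_cancel_left)
      then show ?thesis by simp
    qed
    show False
    proof (cases "\<mu> < 2")
      case True
      then have "g x = 0" for x using gx[of x] laplacian_small[OF g(1)] by simp
      then show False using f(2) g(2) by simp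
    next
      case False
      have "(\<lambda>x. (- 1 / c) * laplacian g x) \<in> forms (\<mu> - 2)" by (rule forms_closed(4)[OF laplacian_forms[OF g(1) \<mu>(2)]])
      moreover have "\<mu> - 2 = D - 2 * Suc j" by (simp add: \<mu>_def)
      moreover have "f = (\<lambda>x. Q x ^ Suc j * ((- 1 / c) * laplacian g x))"
        unfolding g(2) by (intro ext, subst gx) (simp add: mult_ac)
      ultimately have "Suc j \<in> T" using False \<mu>(1) unfolding T_def
        by (intro CollectI conjI bexI[of _ "\<lambda>x. (- 1 / c) * laplacian g x"]) simp_all
      then show False using jmax[of "Suc j"] by simp
    qed
  qed
  \<comment> \<open>With the scalar gone, \<open>Q\<close> cancels and \<open>g\<close> is
    harmonic.\<close>
  have "Q x * laplacian g x = 0" for x using h0[of x] c0 by (simp add: h_def)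
  moreover have "line_poly \<mu> (laplacian g)" by (rule line_poly_mono[OF line_poly_forms[OF laplacian_forms[OF g(1) \<mu>(2)]] diff_le_self])
  ultimately have "laplacian g x = 0" for x using Q_mult_inj[OF _ \<mu>(3)] by blast
  then have "g \<in> harmonic \<mu>" using g(1) by (auto simp: harmonic_def fun_eq_iff)
  moreover have "p dvd (n + 2 * \<mu> + 2 * j - 2)"
  proof -
    have "of_nat (j * (n + 2 * \<mu> + 2 * j - 2)) = c"
      using j1 by (simp add: c_def of_nat_diff)
    then have "of_nat (j * (n + 2 * \<mu> + 2 * j - 2)) = (0::'a)" using c0 by simp
    then have "p dvd j * (n + 2 * \<mu> + 2 * j - 2)" by (simp only: of_nat_eq_0_iff_char_dvd char)
    moreover have "\<not> p dvd j" using j1 j2 D_bounds p by (auto dest!: dvd_imp_le)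
    ultimately show ?thesis using p(1) by (simp add: prime_dvd_mult_iff)
  qed
  ultimately show ?thesis using j1 j2 g(2) unfolding \<mu>_def by blast
qed

text \<open>When p divides the scalar, the Laplacian commutes with multiplication by
  \<open>Q^j\<close> on forms of this degree, so harmonicity of \<open>g\<close> is
  inherited.\<close>

lemma harmonic_multiples_member:
  assumes j: "1 \<le> j" "2 * j \<le> D" "p dvd (n + 2 * (D - 2 * j) + 2 * j - 2)" and g: "g \<in> harmonic (D - 2 * j)"
  shows "(\<lambda>x. Q x ^ j * g x) \<in> harmonic_multiples"
proof -
  define \<mu> where "\<mu> = D - 2 * j"
  have \<mu>: "\<mu> + 2 * j = D" "\<mu> + 2 * j < p" using j D_bounds by (auto simp: \<mu>_def)
  have gP: "g \<in> forms \<mu>" and Lg: "laplacian g = 0" using g by (auto simp: harmonic_def \<mu>_def)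
  have 1: "(\<lambda>x. Q x ^ j * g x) \<in> forms D" using Qpow_forms[OF gP \<mu>(2)] \<mu> by simp
  have c: "(of_nat n + 2 * of_nat \<mu> + 2 * of_nat j - 2 :: 'a) = 0"
  proof -
    have "of_nat (n + 2 * \<mu> + 2 * j - 2) = (0::'a)"
      using j(3) by (simp only: of_nat_eq_0_iff_char_dvd char \<mu>_def)
    then show ?thesis using j(1) by (simp add: of_nat_diff)
  qed
  have "laplacian (\<lambda>x. Q x ^ j * g x) = (\<lambda>x. 0)" unfolding laplacian_Qpow[OF gP \<mu>(2)] c Lg by simp
  then have harmonic: "(\<lambda>x. Q x ^ j * g x) \<in> harmonic D" using 1 by (auto simp: harmonic_def fun_eq_iff)
  have "(\<lambda>x. Q x ^ (j - 1) * g x) \<in> forms (\<mu> + 2 * (j - 1))" by (rule Qpow_forms[OF gP]) (use \<mu> j in auto)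
  moreover have "\<mu> + 2 * (j - 1) = D - 2" using \<mu> j by auto
  moreover have "(\<lambda>x. Q x ^ j * g x) = (\<lambda>x. Q x * (Q x ^ (j - 1) * g x))"
    using j(1) by (cases j) (auto simp: mult.assoc)
  ultimately show ?thesis using harmonic unfolding harmonic_multiples_def by auto
qed

text \<open>The scalars of two exponents differ by 2(i - j), which is smaller than p in absolute
  value because 2i and 2j lie between 2 and p-1.\<close>

lemma j_unique:
  assumes "2 * j \<le> D" "p dvd (n + 2 * (D - 2 * j) + 2 * j - 2)" "1 \<le> j"
    and "2 * i \<le> D" "p dvd (n + 2 * (D - 2 * i) + 2 * i - 2)" "1 \<le> i"
  shows "i = j"
proof -
  have "int (n + 2 * (D - 2 * j) + 2 * j - 2) - int (n + 2 * (D - 2 * i) + 2 * i - 2) = 2 * (int i - int j)"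
    using assms by simp
  moreover have "int p dvd int (n + 2 * (D - 2 * j) + 2 * j - 2) - int (n + 2 * (D - 2 * i) + 2 * i - 2)"
    using assms(2,5) by (intro dvd_diff) (simp_all only: int_dvd_int_iff)
  ultimately have "int p dvd 2 * (int i - int j)" by simp
  moreover have "\<bar>2 * (int i - int j)\<bar> < int p" using assms D_bounds by auto
  ultimately show ?thesis using zdvd_not_zless[of "\<bar>2 * (int i - int j)\<bar>" "int p"] by force
qed

lemma card_HQ_trivial:
  assumes "\<And>j. 1 \<le> j \<Longrightarrow> 2 * j \<le> D \<Longrightarrow> \<not> p dvd (n + 2 * (D - 2 * j) + 2 * j - 2)"
  shows "card harmonic_multiples = 1"
proof -
  have "0 \<in> harmonic D" "0 \<in> forms (D - 2)" using forms_closed(1) laplacian_zero unfolding harmonic_def by blast+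
  then have "0 \<in> harmonic_multiples" unfolding harmonic_multiples_def by (auto intro!: image_eqI[of _ _ 0])
  moreover have "f = 0" if "f \<in> harmonic_multiples" for f
  proof (rule ccontr)
    assume "f \<noteq> 0"
    then have "f \<noteq> (\<lambda>x. 0)" by (auto simp: fun_eq_iff)
    from harmonic_multiples_structure[OF that this] assms show False by blast
  qed
  ultimately have "harmonic_multiples = {0}" by blast
  then show ?thesis by simp
qed

lemma card_harmonic_multiples:
  assumes j: "1 \<le> j" "2 * j \<le> D" "p dvd (n + 2 * (D - 2 * j) + 2 * j - 2)"
  shows "card harmonic_multiples = card (harmonic (D - 2 * j))"
proof -
  have "harmonic_multiples = (\<lambda>g x. Q x ^ j * g x) ` harmonic (D - 2 * j)"
  proof (intro equalityI subsetI)
    fix f assume f: "f \<in> harmonic_multiples"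
    show "f \<in> (\<lambda>g x. Q x ^ j * g x) ` harmonic (D - 2 * j)"
    proof (cases "f = (\<lambda>x. 0)")
      case True
      have "0 \<in> harmonic (D - 2 * j)" using forms_closed(1) laplacian_zero unfolding harmonic_def by blast
      then show ?thesis using True by (intro image_eqI[of _ _ 0]) auto
    next
      case False
      from harmonic_multiples_structure[OF f this] obtain i g where i: "1 \<le> i" "2 * i \<le> D"
        "p dvd (n + 2 * (D - 2 * i) + 2 * i - 2)" "g \<in> harmonic (D - 2 * i)" "f = (\<lambda>x. Q x ^ i * g x)" by blast
      have "i = j" by (rule j_unique[OF j(2,3,1) i(2,3,1)])
      then show ?thesis using i by blast
    qed
  qed (use harmonic_multiples_member[OF j] in blast)
  moreover have "inj_on (\<lambda>g x. Q x ^ j * g x) (harmonic (D - 2 * j))"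
  proof (rule inj_onI)
    fix f g assume fg: "f \<in> harmonic (D - 2 * j)" "g \<in> harmonic (D - 2 * j)" "(\<lambda>x. Q x ^ j * f x) = (\<lambda>x. Q x ^ j * g x)"
    have "(f - g) x = 0" for x
    proof (rule Q_mult_inj)
      show "line_poly (D - 2 * j) (f - g)" using fg by (intro line_poly_forms forms_closed) (auto simp: harmonic_def)
      show "D - 2 * j < CARD('a) - 1" using D_bounds j by simp
      show "Q x * (f - g) x = 0" for x
      proof -
        have "Q x ^ j * (f - g) x = 0" using fun_cong[OF fg(3), of x] by (simp add: algebra_simps)
        then show ?thesis by auto
      qed
    qed
    then show "f = g" by (auto simp: fun_eq_iff)
  qed
  ultimately show ?thesis by (simp add: card_image)
qed

lemma choose_flip: "a + b = m \<Longrightarrow> m choose a = m choose b"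
  using binomial_symmetric[of a m] by (metis add_diff_cancel_left' le_add1)

lemma rank_odd:
  assumes rk: "has_rank X0 X0 (\<lambda>x y. B x y ^ (p - 1)) r" and n4: "n \<ge> 4"
  shows "\<And>u. u > 0 \<Longrightarrow> [u = n + 1] (mod 2) \<Longrightarrow> n - 3 \<le> u * p \<Longrightarrow> u * p \<le> p + n - 5 \<Longrightarrow>
      int r = int ((n + p - 2) choose (n - 1)) - int ((n + p - 4) choose (n - 1))
               - int ((u * p + 2) choose (n - 1)) + int ((u * p) choose (n - 1))"
    and "(\<nexists>u::nat. u > 0 \<and> [u = n + 1] (mod 2) \<and> n - 3 \<le> u * p \<and> u * p \<le> p + n - 5) \<Longrightarrow>
      int r = int ((n + p - 2) choose (n - 1)) - int ((n + p - 4) choose (n - 1))"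
proof -
  let ?q = "CARD('a)"
  have q1: "?q > 1" by (rule finite_field_card_pos[OF finF])
  have oddp: "odd p" using p prime_odd_nat by auto
  have "n + D - 1 = n + p - 2" "D + (n - 1) = n + p - 2" using p n4 by (auto simp: D_def)
  then have N1: "forms_dim D = (n + p - 2) choose (n - 1)" unfolding forms_dim_def by (metis choose_flip)
  have "n + (D - 2) - 1 = n + p - 4" "D - 2 + (n - 1) = n + p - 4" using p n4 by (auto simp: D_def)
  then have N2: "forms_dim (D - 2) = (n + p - 4) choose (n - 1)" unfolding forms_dim_def by (metis choose_flip)
  {
    fix u :: nat
    assume u: "u > 0" "[u = n + 1] (mod 2)" "n - 3 \<le> u * p" "u * p \<le> p + n - 5"
    \<comment> \<open>The exponent of \<open>Q\<close> belonging to \<open>u\<close> satisfies \<open>2j = n + p - 4 - up\<close>.\<close>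
    define m where "m = n + p - 4 - u * p"
    have m: "m + u * p + 4 = n + p" using u n4 p by (simp add: m_def)
    have "even m"
    proof -
      have "u mod 2 = (n + 1) mod 2" using u(2) by (simp add: cong_def)
      moreover have "even (u * p) = even u" using oddp by simp
      ultimately show ?thesis using m oddp by presburger
    qed
    define j where "j = m div 2"
    have 2: "2 * j = m" unfolding j_def using \<open>even m\<close> by simp
    \<comment> \<open>\<open>n - 3 \<le> u * p\<close> says that 2j is at most p-1.
      \<open>u * p \<le> p + n - 5\<close> gives only m at least 1, which parity raises to
      2.\<close>
    have j: "1 \<le> j" "2 * j \<le> D" using 2 m u n4 p by (auto simp: D_def)
    have eq: "n + 2 * (D - 2 * j) + 2 * j - 2 = p + u * p" using 2 m j u n4 p by (simp add: D_def)
    have dvd: "p dvd (n + 2 * (D - 2 * j) + 2 * j - 2)" unfolding eq by simp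
    define \<mu> where "\<mu> = D - 2 * j"
    have \<mu>: "n + \<mu> - 1 = u * p + 2" "\<mu> < p" "\<mu> + (n - 1) = u * p + 2"
      using 2 m j u n4 p by (auto simp: \<mu>_def D_def)
    have M1: "forms_dim \<mu> = (u * p + 2) choose (n - 1)"
      unfolding forms_dim_def \<mu>(1) by (rule choose_flip[OF \<mu>(3)])
    \<comment> \<open>In degrees below 2 all forms are harmonic; there u p = n + \<mu> - 3 is below
      n-1, so the binomial is 0 as well.\<close>
    have M2: "?q ^ (if \<mu> < 2 then 0 else forms_dim (\<mu> - 2)) = ?q ^ ((u * p) choose (n - 1))"
    proof (cases "\<mu> < 2")
      case True
      then have "u * p < n - 1" using \<mu> n4 by simp
      then show ?thesis using True by (simp add: binomial_eq_0)
    next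
      case False
      then have "n + (\<mu> - 2) - 1 = u * p" "\<mu> - 2 + (n - 1) = u * p" using \<mu> n4 by auto
      then have "forms_dim (\<mu> - 2) = (u * p) choose (n - 1)" unfolding forms_dim_def by (metis choose_flip)
      then show ?thesis using False by simp
    qed
    have A: "card (harmonic \<mu>) * ?q ^ ((u * p) choose (n - 1)) = ?q ^ ((u * p + 2) choose (n - 1))"
      using card_H_forms_dim[OF \<mu>(2)] unfolding M1 M2 .
    have B: "?q ^ r * card (harmonic \<mu>) * ?q ^ ((n + p - 4) choose (n - 1)) = ?q ^ ((n + p - 2) choose (n - 1))"
      using rank_harmonic_multiples[OF rk[folded D_def]] card_harmonic_multiples[OF j dvd] unfolding N1 N2 \<mu>_def by simp
    have "?q ^ (r + ((u * p + 2) choose (n - 1)) + ((n + p - 4) choose (n - 1))) =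
       (?q ^ r * card (harmonic \<mu>) * ?q ^ ((n + p - 4) choose (n - 1))) * ?q ^ ((u * p) choose (n - 1))"
      unfolding power_add A[symmetric] by (simp only: mult_ac)
    then have "?q ^ (r + ((u * p + 2) choose (n - 1)) + ((n + p - 4) choose (n - 1))) =
       ?q ^ (((n + p - 2) choose (n - 1)) + ((u * p) choose (n - 1)))"
      unfolding B power_add .
    then have "r + ((u * p + 2) choose (n - 1)) + ((n + p - 4) choose (n - 1)) =
       ((n + p - 2) choose (n - 1)) + ((u * p) choose (n - 1))"
      unfolding power_inject_exp[OF q1] .
    then show "int r = int ((n + p - 2) choose (n - 1)) - int ((n + p - 4) choose (n - 1))
               - int ((u * p + 2) choose (n - 1)) + int ((u * p) choose (n - 1))" by linarith
  }
  {
    assume no: "\<nexists>u::nat. u > 0 \<and> [u = n + 1] (mod 2) \<and> n - 3 \<le> u * p \<and> u * p \<le> p + n - 5"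
    have "card harmonic_multiples = 1"
    proof (rule card_HQ_trivial, rule notI)
      fix j assume j: "1 \<le> j" "2 * j \<le> D" "p dvd (n + 2 * (D - 2 * j) + 2 * j - 2)"
      then obtain w where w: "n + 2 * (D - 2 * j) + 2 * j - 2 = p * w" by blast
      have eq: "p * w + 2 * j + 4 = n + 2 * p" using w j p n4 by (simp add: D_def)
      \<comment> \<open>The quotient \<open>w\<close> is u+1. As 2j is at most p-1, p w is at least
        n + p - 3, which exceeds p and makes u positive.\<close>
      have "w \<ge> 2"
      proof (rule ccontr)
        assume "\<not> w \<ge> 2"
        then have "p * w \<le> p" using mult_le_mono2[of w 1 p] by simp
        moreover have "2 * j + 1 \<le> p" using j(2) p by (simp add: D_def)
        ultimately show False using eq n4 by linarith
      qed
      then obtain u where u: "w = u + 1" "u > 0" using that[of "w - 1"] by auto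
      have eq': "u * p + 2 * j + 4 = n + p" using eq u by (simp add: algebra_simps)
      moreover have "even (u * p) = even u" using oddp by simp
      ultimately have "u mod 2 = (n + 1) mod 2" using oddp by presburger
      then have "[u = n + 1] (mod 2)" by (simp add: cong_def)
      moreover have "n - 3 \<le> u * p" using eq' j(2) p by (simp add: D_def)
      moreover have "u * p \<le> p + n - 5" using eq' j(1) by simp
      ultimately show False using no u by blast
    qed
    then have "?q ^ (r + ((n + p - 4) choose (n - 1))) = ?q ^ ((n + p - 2) choose (n - 1))"
      using rank_harmonic_multiples[OF rk[folded D_def]] N1 N2 by (simp add: power_add)
    then have "r + ((n + p - 4) choose (n - 1)) = (n + p - 2) choose (n - 1)"
      unfolding power_inject_exp[OF q1] .
    then show "int r = int ((n + p - 2) choose (n - 1)) - int ((n + p - 4) choose (n - 1))" by linarith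
  }
qed

end

section \<open>The incidence matrix\<close>

text \<open>Every element of the field with p elements is some \<open>of_nat i\<close>, and
  \<open>of_nat\<close> identifies the same numbers in both fields, as they have the same
  characteristic.\<close>

lemma prime_field_embedding:
  assumes k: "CARD('k::field) = p" and a: "CARD('a::field) = p ^ t" "finite (UNIV :: 'a::field set)" and p: "prime p"
  obtains h :: "'k::field \<Rightarrow> 'a::field" where "\<And>x y. h (x + y) = h x + h y" "\<And>x y. h (x * y) = h x * h y" "h 1 = 1" "h 0 = 0"
proof -
  have fk: "finite (UNIV :: 'k set)" using k p prime_gt_0_nat by (metis card_ge_0_finite)
  have ck: "CHAR('k) = p" using finite_field_CHAR[OF fk, of p 1] k p by simp
  have ca: "CHAR('a) = p" by (rule finite_field_CHAR[OF a(2,1) p])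
  have eq: "of_nat i = (of_nat j :: 'k) \<longleftrightarrow> of_nat i = (of_nat j :: 'a)" for i j
    by (simp add: of_nat_eq_iff_cong_CHAR ck ca)
  have "inj_on (of_nat :: nat \<Rightarrow> 'k) {..<p}"
    by (rule inj_onI) (auto simp: of_nat_eq_iff_cong_CHAR ck cong_def)
  then have "card (of_nat ` {..<p} :: 'k set) = CARD('k)" using k by (simp add: card_image)
  then have "of_nat ` {..<p} = (UNIV :: 'k set)" by (intro card_subset_eq fk) auto
  then have surj: "\<exists>i. x = (of_nat i :: 'k)" for x by (metis UNIV_I imageE)
  define g where "g x = (SOME i. of_nat i = (x :: 'k))" for x
  have g: "of_nat (g x) = x" for x unfolding g_def using surj[of x] by (metis (mono_tags) someI)
  define h where "h x = (of_nat (g x) :: 'a)" for x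
  have h: "h (of_nat i) = of_nat i" for i unfolding h_def using eq g by blast
  show thesis
  proof (rule that[of h])
    show "h (x + y) = h x + h y" for x y using h[of "g x + g y"] by (simp add: g h_def)
    show "h (x * y) = h x * h y" for x y using h[of "g x * g y"] by (simp add: g h_def)
    show "h 1 = 1" "h 0 = 0" using h[of 1] h[of 0] by simp_all
  qed
qed

lemma has_rank_identity:
  assumes "finite R"
  shows "has_rank R R (\<lambda>x y. if x = y then 1 else (0::'f::field)) (card R)"
proof (rule has_rankI[OF assms refl, where u = "\<lambda>a i. if a = i then 1 else 0" and v = "\<lambda>i a. if a = i then 1 else 0"
      and l = "\<lambda>i a. if a = i then 1 else 0" and m = "\<lambda>a i. if a = i then 1 else 0"])
  have sum1: "(\<Sum>i\<in>R. (if a = i then 1 else 0) * (if b = i then 1 else (0::'f))) = (if a = b then 1 else 0)" if "a \<in> R" for a b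
  proof -
    have "(\<Sum>i\<in>R. (if a = i then 1 else 0) * (if b = i then 1 else (0::'f))) = (\<Sum>i\<in>R. if a = i then (if b = i then 1 else 0) else 0)"
      by (intro sum.cong) auto
    then show ?thesis using that assms by auto
  qed
  have sum2: "(\<Sum>i\<in>R. (if i = a then 1 else 0) * (if i = b then 1 else (0::'f))) = (if a = b then 1 else 0)" if "a \<in> R" for a b
  proof -
    have "(\<Sum>i\<in>R. (if i = a then 1 else 0) * (if i = b then 1 else (0::'f))) = (\<Sum>i\<in>R. if i = a then (if i = b then 1 else 0) else 0)"
      by (intro sum.cong) auto
    then show ?thesis using that assms by auto
  qed
  fix a b assume ab: "a \<in> R" "b \<in> R"
  show "(if a = b then 1 else (0::'f)) = (\<Sum>i\<in>R. (if a = i then 1 else 0) * (if b = i then 1 else 0))"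
    by (rule sum1[OF ab(1), symmetric])
  show "(\<Sum>i\<in>R. (if i = a then 1 else 0) * (if i = b then 1 else (0::'f))) = (if a = b then 1 else 0)"
    by (rule sum2[OF ab(1)])
  then show "(\<Sum>i\<in>R. (if i = a then 1 else 0) * (if i = b then 1 else (0::'f))) = (if a = b then 1 else 0)" .
qed

text \<open>For n = 4 the general bracket is p^2, which reconciles it with the q^2+1 points of a
  quadric without lines.\<close>

lemma choose_3_diff: "int (p + 2 choose 3) - int (p choose 3) = int p ^ 2"
proof -
  have "p + 2 choose 3 = (p choose 1) + 2 * (p choose 2) + (p choose 3)"
    by (simp add: numeral_eq_Suc)
  moreover have "2 * (p choose 2) + p = p * p" by (cases p) (auto simp: choose_two algebra_simps)
  ultimately have "p + 2 choose 3 = p * p + (p choose 3)" by simp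
  then show ?thesis by (simp add: power2_eq_square)
qed

section \<open>From points and hyperplanes to the kernel on singular vectors\<close>

context quadric
begin

lemma singular_points_eq: "singular_points scale Q = (\<lambda>x. span {x}) ` X"
proof (intro equalityI subsetI)
  fix L assume "L \<in> singular_points scale Q"
  then have L: "subspace L" "dim L = 1" "\<And>v. v \<in> L \<Longrightarrow> Q v = 0" by (auto simp: singular_points_def)
  obtain b where b: "b \<subseteq> L" "independent b" "L \<subseteq> span b" "card b = dim L" using basis_exists by blast
  then obtain x where x: "b = {x}" using L(2) by (metis card_1_singletonE)
  have "x \<noteq> 0" using b(2) x dependent_zero[of b] by auto
  moreover have "L = span {x}" using b L(1) x span_minimal[of b L] by auto
  ultimately show "L \<in> (\<lambda>x. span {x}) ` X" using L(3) b(1) x by (auto simp: X_def)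
next
  fix L assume "L \<in> (\<lambda>x. span {x}) ` X"
  then obtain x where x: "x \<noteq> 0" "Q x = 0" "L = span {x}" by (auto simp: X_def)
  have "dim (span {x}) = 1" using x(1) dim_eq_card_independent[of "{x}"] by simp
  moreover have "Q v = 0" if "v \<in> span {x}" for v
    using that x(2) by (auto simp: span_singleton Q_scale)
  ultimately show "L \<in> singular_points scale Q" using x by (simp add: singular_points_def subspace_span)
qed

lemma span_perp_iff: "span {x} \<subseteq> perp Q (span {y}) \<longleftrightarrow> B x y = 0"
proof
  assume "span {x} \<subseteq> perp Q (span {y})"
  moreover have "x \<in> span {x}" "y \<in> span {y}" by (auto intro: span_base)
  ultimately have "B y x = 0" by (auto simp: perp_def)
  then show "B x y = 0" by (simp only: B_sym[of y x])
next
  assume "B x y = 0"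
  then have "B (d *s y) (c *s x) = 0" for c d by (simp add: B_scale_left B_scale_right B_sym[of y x])
  then show "span {x} \<subseteq> perp Q (span {y})" by (auto simp: perp_def span_singleton)
qed

text \<open>The index maps from singular vectors to list positions are surjective, so the array on
  \<open>X\<close> repeats rows and columns of the matrix. Since nonzero elements have (q-1)-st
  power 1, the 0-1 entry is \<open>1 - B x y ^ (q - 1)\<close>.\<close>

lemma has_rank_points:
  fixes k :: "nat \<Rightarrow> nat \<Rightarrow> 'a"
  assumes Ps: "set Ps = singular_points scale Q" and Hs: "set Hs = polar_hyperplanes scale Q"
    and d: "distinct Ps" "distinct Hs"
    and k: "\<And>i j. i < length Ps \<Longrightarrow> j < length Hs \<Longrightarrow> k i j = (if Ps ! i \<subseteq> Hs ! j then 1 else 0)"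
    and rk: "has_rank {..<length Ps} {..<length Hs} k r"
  shows "has_rank X X (\<lambda>x y. 1 - B x y ^ (CARD('a) - 1)) r"
proof -
  have "\<forall>x\<in>X. \<exists>i<length Ps. Ps ! i = span {x}"
    using Ps singular_points_eq by (metis imageI in_set_conv_nth)
  then obtain f where f: "\<And>x. x \<in> X \<Longrightarrow> f x < length Ps" "\<And>x. x \<in> X \<Longrightarrow> Ps ! (f x) = span {x}" by metis
  have "\<forall>y\<in>X. \<exists>i<length Hs. Hs ! i = perp Q (span {y})"
    using Hs singular_points_eq unfolding polar_hyperplanes_def by (metis imageI in_set_conv_nth)
  then obtain g where g: "\<And>x. x \<in> X \<Longrightarrow> g x < length Hs" "\<And>x. x \<in> X \<Longrightarrow> Hs ! (g x) = perp Q (span {x})" by metis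
  have fX: "f ` X = {..<length Ps}"
  proof (intro equalityI subsetI)
    fix i assume i: "i \<in> {..<length Ps}"
    then have "Ps ! i \<in> (\<lambda>x. span {x}) ` X" using Ps singular_points_eq by (metis lessThan_iff nth_mem)
    then obtain x where x: "x \<in> X" "Ps ! i = span {x}" by blast
    then have "i = f x" using f[OF x(1)] d(1) i by (metis lessThan_iff nth_eq_iff_index_eq)
    then show "i \<in> f ` X" using x(1) by blast
  qed (use f in auto)
  have gX: "g ` X = {..<length Hs}"
  proof (intro equalityI subsetI)
    fix i assume i: "i \<in> {..<length Hs}"
    then have "Hs ! i \<in> perp Q ` (\<lambda>x. span {x}) ` X"
      using Hs singular_points_eq unfolding polar_hyperplanes_def by (metis lessThan_iff nth_mem)
    then obtain x where x: "x \<in> X" "Hs ! i = perp Q (span {x})" by blast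
    then have "i = g x" using g[OF x(1)] d(2) i by (metis lessThan_iff nth_eq_iff_index_eq)
    then show "i \<in> g ` X" using x(1) by blast
  qed (use g in auto)
  have "has_rank X X (\<lambda>x y. k (f x) (g y)) r"
    using rk unfolding fX[symmetric] gX[symmetric] by (rule has_rank_surj) auto
  then show ?thesis
  proof (rule has_rank_cong_imp)
    fix x y assume xy: "x \<in> X" "y \<in> X"
    have "CARD('a) - 1 > 0" using finite_field_card_pos[OF finF] by simp
    then show "1 - B x y ^ (CARD('a) - 1) = k (f x) (g y)"
      using finite_field_power_card_minus_1[OF finF, of "B x y"]
      unfolding k[OF f(1)[OF xy(1)] g(1)[OF xy(2)]] f(2)[OF xy(1)] g(2)[OF xy(2)] span_perp_iff
      by (cases "B x y = 0") (simp_all add: power_0_left)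
  qed
qed

text \<open>Without totally singular lines, orthogonal singular vectors are proportional, so on
  representatives of the points incidence is equality. There are q^2 points on the chart, and
  \<open>e1\<close> is the only other one.\<close>

lemma has_rank_ovoid:
  assumes n: "CARD('v) = CARD('a) ^ 4" and e: "Q e1 = 0" "Q e2 = 0" "B e1 e2 = 1"
    and no: "\<And>x y s. Q x = 0 \<Longrightarrow> Q y = 0 \<Longrightarrow> B x y = 1 \<Longrightarrow> s \<in> hperp x y \<Longrightarrow> Q s = 0 \<Longrightarrow> s = 0"
  shows "has_rank X X (\<lambda>x y. 1 - B x y ^ (CARD('a) - 1)) (Suc (CARD('a)\<^sup>2))"
proof -
  let ?q = "CARD('a)"
  have q1: "?q - 1 > 0" using finite_field_card_pos[OF finF] by simp
  have col: "\<exists>c. y = c *s x" if x: "x \<in> X" and y: "Q y = 0" and xy: "B x y = 0" for x y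
  proof -
    obtain z where z: "Q z = 0" "B x z = 1" using hyperbolic_partner[of x] x by (auto simp: X_def)
    have xQ: "Q x = 0" using x by (simp add: X_def)
    have "y - B z y *s x - B x y *s z \<in> hperp x z" by (rule hyperbolic_decomp[OF xQ z])
    then have "y - B z y *s x \<in> hperp x z" using xy by simp
    moreover have "Q (y - B z y *s x) = 0" using xQ y xy by (simp add: Q_diff Q_scale B_lin B_sym[of y x])
    ultimately have "y - B z y *s x = 0" by (rule no[OF xQ z])
    then show ?thesis by auto
  qed
  define A where "A = {x \<in> X. B e1 x = 1}"
  define R where "R = insert e1 A"
  \<comment> \<open>Representatives are scaled to pair to 1 with \<open>e1\<close>; the only point
    orthogonal to \<open>e1\<close> is represented by \<open>e1\<close> itself.\<close>
  define \<rho> where "\<rho> x = (if B e1 x = 0 then e1 else (1 / B e1 x) *s x)" for x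
  have e1X: "e1 \<in> X" using e by (auto simp: X_def)
  have e1A: "e1 \<notin> A" using e by (auto simp: A_def B_self)
  have "bij_betw (\<lambda>w. e2 + w - Q w *s e1) (hperp e1 e2) A"
  proof (rule bij_betw_byWitness[where f' = "\<lambda>x. x - B e2 x *s e1 - B e1 x *s e2"])
    have s: "B e2 e1 = 1" "B e1 e1 = 0" "B e2 e2 = 0" using e by (simp_all add: B_sym[of e2] B_self)
    show "\<forall>w\<in>hperp e1 e2. e2 + w - Q w *s e1 - B e2 (e2 + w - Q w *s e1) *s e1 - B e1 (e2 + w - Q w *s e1) *s e2 = w"
      using e s by (simp add: hperp_def B_lin)
    show "\<forall>x\<in>A. e2 + (x - B e2 x *s e1 - B e1 x *s e2) - Q (x - B e2 x *s e1 - B e1 x *s e2) *s e1 = x"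
    proof
      fix x assume "x \<in> A"
      then have x: "Q x = 0" "B e1 x = 1" "B x e1 = 1" "B x e2 = B e2 x"
        by (simp_all add: A_def X_def B_sym[of x e1] B_sym[of x e2])
      have "Q (x - B e2 x *s e1 - B e1 x *s e2) = - B e2 x"
        using e by (simp add: Q_diff Q_scale B_scale_right B_scale_left B_diff x)
      then show "e2 + (x - B e2 x *s e1 - B e1 x *s e2) - Q (x - B e2 x *s e1 - B e1 x *s e2) *s e1 = x"
        by (simp add: x(2))
    qed
    show "(\<lambda>w. e2 + w - Q w *s e1) ` hperp e1 e2 \<subseteq> A"
    proof (rule image_subsetI)
      fix w assume w: "w \<in> hperp e1 e2"
      have "B e1 (e2 + w - Q w *s e1) = 1" using w e s by (simp add: hperp_def B_lin)
      moreover have "Q (e2 + w - Q w *s e1) = 0"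
        using w e s by (simp add: hperp_def Q_diff Q_add Q_scale B_lin B_sym[of w])
      ultimately show "e2 + w - Q w *s e1 \<in> A" by (auto simp: A_def X_def)
    qed
    show "(\<lambda>x. x - B e2 x *s e1 - B e1 x *s e2) ` A \<subseteq> hperp e1 e2"
      using hyperbolic_decomp[OF e] by blast
  qed
  then have "card A = card (hperp e1 e2)" by (rule bij_betw_same_card[symmetric])
  moreover have "card (hperp e1 e2) = ?q\<^sup>2"
  proof -
    have "?q\<^sup>2 * card (hperp e1 e2) = ?q\<^sup>2 * ?q\<^sup>2"
      using card_hperp[OF e] n by (simp flip: power_add)
    then show ?thesis using finite_field_card_pos[OF finF] by (simp only: mult_cancel1) simp
  qed
  ultimately have cR: "card R = Suc (?q\<^sup>2)" using e1A finite_field_card_pos[OF finF] by (simp add: R_def)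
  have \<rho>A: "\<rho> x \<in> A" if "x \<in> X" "B e1 x \<noteq> 0" for x
    using that by (auto simp: \<rho>_def A_def X_def Q_scale B_lin)
  have \<rho>X: "\<rho> ` X = R"
  proof (intro equalityI subsetI)
    fix z assume "z \<in> \<rho> ` X"
    then show "z \<in> R" using \<rho>A by (auto simp: R_def \<rho>_def)
  next
    fix z assume "z \<in> R"
    then have "z \<in> X" "\<rho> z = z" using e1X e by (auto simp: R_def A_def \<rho>_def B_self)
    then show "z \<in> \<rho> ` X" by (metis imageI)
  qed
  have \<rho>c: "\<exists>c. c \<noteq> 0 \<and> x = c *s \<rho> x" if x: "x \<in> X" for x
  proof (cases "B e1 x = 0")
    case True
    obtain c where c: "x = c *s e1" using col[OF e1X _ True] x by (auto simp: X_def)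
    then have "c \<noteq> 0" using x by (auto simp: X_def)
    then show ?thesis using c True by (auto simp: \<rho>_def)
  next
    case False
    then show ?thesis by (intro exI[of _ "B e1 x"]) (simp add: \<rho>_def)
  qed
  have iff: "B x y = 0 \<longleftrightarrow> \<rho> x = \<rho> y" if x: "x \<in> X" and y: "y \<in> X" for x y
  proof
    assume "\<rho> x = \<rho> y"
    obtain c d where "x = c *s \<rho> x" "y = d *s \<rho> y" using \<rho>c x y by blast
    then have "B x y = c * d * B (\<rho> x) (\<rho> x)" using \<open>\<rho> x = \<rho> y\<close> by (metis B_scale_left B_scale_right mult.assoc)
    moreover have "Q (\<rho> x) = 0" using \<rho>X x e by (auto simp: R_def A_def X_def)
    ultimately show "B x y = 0" by (simp add: B_self)
  next
    assume "B x y = 0"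
    then obtain c where c: "y = c *s x" using col[OF x] y by (auto simp: X_def)
    then have "c \<noteq> 0" using y by (auto simp: X_def)
    then show "\<rho> x = \<rho> y" using c by (simp add: \<rho>_def B_lin)
  qed
  have "has_rank R R (\<lambda>x y. if x = y then 1 else (0::'a)) (Suc (?q\<^sup>2))"
    using has_rank_identity[of R] cR by simp
  then have "has_rank X X (\<lambda>x y. if \<rho> x = \<rho> y then 1 else (0::'a)) (Suc (?q\<^sup>2))"
    unfolding \<rho>X[symmetric] by (rule has_rank_surj) auto
  then show ?thesis
  proof (rule has_rank_cong_imp)
    fix x y assume "x \<in> X" "y \<in> X"
    then show "1 - B x y ^ (?q - 1) = (if \<rho> x = \<rho> y then 1 else 0)"
      using iff finite_field_power_card_minus_1[OF finF, of "B x y"] q1 by (auto simp: power_0_left)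
  qed
qed

lemma quadric_line_exists:
  assumes "Q e1 = 0" "Q e2 = 0" "B e1 e2 = 1" "s \<in> hperp e1 e2" "s \<noteq> 0" "Q s = 0"
  shows "\<exists>S. quadric_line scale Q e1 e2 S"
proof -
  obtain S where S: "S \<subseteq> {w \<in> hperp e1 e2. Q w = 0}" "independent S" "{w \<in> hperp e1 e2. Q w = 0} \<subseteq> span S"
    using maximal_independent_subset by blast
  have "span S \<subseteq> span {w \<in> hperp e1 e2. Q w = 0}" by (rule span_mono[OF S(1)])
  moreover have "span {w \<in> hperp e1 e2. Q w = 0} \<subseteq> span S" by (rule span_minimal[OF S(3)]) (rule subspace_span)
  ultimately have "span S = hperp e1 e2" using hperp_span_singular[OF assms] by simp
  then have "quadric_line scale Q e1 e2 S"
    using assms S(1,2) by unfold_locales auto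
  then show ?thesis by blast
qed

end

text \<open>The formulas concern the base \<open>r\<close> of the t-th power because they describe
  the kernel with exponent p-1, before the passage to q-1.\<close>

lemma incidence_rank:
  fixes p t n :: nat
    and scale :: "'a::field \<Rightarrow> 'v::ab_group_add \<Rightarrow> 'v"
    and Q :: "'v \<Rightarrow> 'a"
    and Ps Hs :: "'v set list"
  assumes p: "prime p" and t: "t \<ge> 1" and q: "CARD('a) = p ^ t"
    and vs: "vector_space scale" and dim: "vector_space.dim scale UNIV = n" and n4: "n \<ge> 4"
    and qf: "quadratic_form scale Q" and nd: "nondegenerate Q"
    and Ps: "distinct Ps" "set Ps = singular_points scale Q"
    and Hs: "distinct Hs" "set Hs = polar_hyperplanes scale Q"
    and k: "CARD('k::field) = p"
  shows "\<exists>r. mat_rank (incidence_mat Ps Hs :: 'k mat) = 1 + r ^ t \<and>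
    (p = 2 \<longrightarrow> r = (if even n then n else n - 1)) \<and>
    (p > 2 \<longrightarrow>
      (\<forall>u::nat. u > 0 \<and> [u = n + 1] (mod 2) \<and> n - 3 \<le> u * p \<and> u * p \<le> p + n - 5 \<longrightarrow>
        int r = int ((n + p - 2) choose (n - 1)) - int ((n + p - 4) choose (n - 1))
               - int ((u * p + 2) choose (n - 1)) + int ((u * p) choose (n - 1))) \<and>
      ((\<nexists>u::nat. u > 0 \<and> [u = n + 1] (mod 2) \<and> n - 3 \<le> u * p \<and> u * p \<le> p + n - 5) \<longrightarrow>
        int r = int ((n + p - 2) choose (n - 1)) - int ((n + p - 4) choose (n - 1))))"
proof -
  interpret vector_space scale by (rule vs)
  have p0: "p > 0" using p by (rule prime_gt_0_nat)
  have finF: "finite (UNIV :: 'a set)" using q p0 by (intro card_ge_0_finite) simp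
  obtain b where b: "independent b" "span b = UNIV" "card b = n"
  proof -
    obtain b where "independent b" "UNIV \<subseteq> span b" "card b = dim UNIV" using basis_exists[of UNIV] by metis
    then show thesis using that[of b] dim by (simp add: top.extremum_unique)
  qed
  have "finite b" using b(3) n4 by (intro card_ge_0_finite) simp
  then have cV: "CARD('v) = CARD('a) ^ n" using card_span_independent[OF finF _ b(1)] b by simp
  then have finV: "finite (UNIV :: 'v set)" using q p0 by (intro card_ge_0_finite) simp
  interpret quadric scale Q by unfold_locales (use qf nd finF finV in auto)
  define k0 where "k0 i j = (if Ps ! i \<subseteq> Hs ! j then 1 else (0::'k))" for i j
  obtain R where R: "has_rank {..<length Ps} {..<length Hs} k0 R"
    using has_rank_exists[of "{..<length Ps}" "{..<length Hs}" k0] by blast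
  have "incidence_mat Ps Hs = mat (length Ps) (length Hs) (\<lambda>(i, j). k0 i j)"
    by (simp add: incidence_mat_def k0_def)
  then have mr: "mat_rank (incidence_mat Ps Hs :: 'k mat) = R" using mat_rank_eqI[OF R] by simp
  obtain h :: "'k \<Rightarrow> 'a" where h: "\<And>x y. h (x + y) = h x + h y" "\<And>x y. h (x * y) = h x * h y" "h 1 = 1" "h 0 = 0"
    using prime_field_embedding[OF k q finF p] by blast
  have "has_rank {..<length Ps} {..<length Hs} (\<lambda>i j. h (k0 i j)) R"
    by (rule has_rank_hom[OF h(1-3) R])
  then have RX: "has_rank X X (\<lambda>x y. 1 - B x y ^ (CARD('a) - 1)) R"
    by (rule has_rank_points[OF Ps(2) Hs(2) Ps(1) Hs(1), rotated]) (simp add: k0_def h)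
  \<comment> \<open>The rank over the prime field is now a rank of the kernel over GF(q), so any
    rank computed for that kernel equals \<open>R\<close>.\<close>
  note unique = has_rank_unique[OF finF finite_V finite_V RX]
  have two: "p = 2 \<Longrightarrow> (2::'a) = 0"
    using finite_field_CHAR[OF finF q p] of_nat_CHAR[where ?'a = 'a] by simp
  have "CARD('a) ^ 3 \<le> CARD('a) ^ n"
    using finite_field_card_pos[OF finF] n4 by (intro power_increasing) auto
  then obtain x where x: "x \<noteq> 0" "Q x = 0" using exists_singular[OF subspace_UNIV] cV by auto
  obtain y where y: "Q y = 0" "B x y = 1" using hyperbolic_partner[OF x(2,1)] by blast
  show ?thesis
  proof (cases "\<exists>x y s. Q x = 0 \<and> Q y = 0 \<and> B x y = 1 \<and> s \<in> hperp x y \<and> s \<noteq> 0 \<and> Q s = 0")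
    case True
    then obtain e1 e2 S where ql: "quadric_line scale Q e1 e2 S" using quadric_line_exists by blast
    interpret l: quadric_line scale Q e1 e2 S by (rule ql)
    obtain r where r: "has_rank l.X0 l.X0 (\<lambda>x y. B x y ^ (p - 1)) r"
      using has_rank_exists[of l.X0 l.X0 "\<lambda>x y. B x y ^ (p - 1)"] by auto
    have "R = Suc (r ^ t)" by (rule unique[OF l.has_rank_incidence[OF p q t r]])
    moreover have "r = (if even n then n else n - 1)" if "p = 2"
      using l.has_rank_X0_char2[OF two[OF that] cV, of r] r that by simp
    moreover have "int r = int ((n + p - 2) choose (n - 1)) - int ((n + p - 4) choose (n - 1))
               - int ((u * p + 2) choose (n - 1)) + int ((u * p) choose (n - 1))"
      if "p > 2" "u > 0 \<and> [u = n + 1] (mod 2) \<and> n - 3 \<le> u * p \<and> u * p \<le> p + n - 5" for u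
    proof -
      interpret o: quadric_odd scale Q e1 e2 S p t n by unfold_locales (use that p q t cV in auto)
      show ?thesis using o.rank_odd(1)[OF r n4] that by blast
    qed
    moreover have "int r = int ((n + p - 2) choose (n - 1)) - int ((n + p - 4) choose (n - 1))"
      if "p > 2" "\<nexists>u::nat. u > 0 \<and> [u = n + 1] (mod 2) \<and> n - 3 \<le> u * p \<and> u * p \<le> p + n - 5"
    proof -
      interpret o: quadric_odd scale Q e1 e2 S p t n by unfold_locales (use that p q t cV in auto)
      show ?thesis using o.rank_odd(2)[OF r n4] that by blast
    qed
    ultimately show ?thesis using mr by (intro exI[of _ r]) simp
  next
    case False
    \<comment> \<open>From dimension 5 on, the complement of a hyperbolic pair has dimension at
      least 3 and contains a nonzero singular vector.\<close>
    have n: "n = 4"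
    proof (rule ccontr)
      assume "n \<noteq> 4"
      have "CARD('a)\<^sup>2 * CARD('a) ^ 3 \<le> CARD('a) ^ n"
        using finite_field_card_pos[OF finF] n4 \<open>n \<noteq> 4\<close>
        by (simp only: power_add[symmetric]) (intro power_increasing, auto)
      then have "CARD('a)\<^sup>2 * CARD('a) ^ 3 \<le> CARD('a)\<^sup>2 * card (hperp x y)"
        using card_hperp[OF x(2) y] cV by simp
      then have "CARD('a) ^ 3 \<le> card (hperp x y)"
        using finite_field_card_pos[OF finF] by (simp only: mult_le_cancel1) simp
      from exists_singular[OF subspace_hperp this] False x y show False by blast
    qed
    have "has_rank X X (\<lambda>x y. 1 - B x y ^ (CARD('a) - 1)) (Suc (CARD('a)\<^sup>2))"
      by (rule has_rank_ovoid[OF _ x(2) y]) (use cV n False in auto)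
    then have "R = Suc (CARD('a)\<^sup>2)" by (rule unique)
    then have R: "R = 1 + (p\<^sup>2) ^ t" by (simp add: q power_mult[symmetric] mult.commute)
    \<comment> \<open>For n = 4 the upper bound is p-1, so no positive u qualifies and the shorter
      formula is the relevant one.\<close>
    have "\<not> u * p \<le> p + n - 5" if "u > 0" for u
    proof -
      have "p \<le> u * p" using that by simp
      then show ?thesis using n p0 by linarith
    qed
    moreover have "int (p\<^sup>2) = int ((n + p - 2) choose (n - 1)) - int ((n + p - 4) choose (n - 1))"
      using choose_3_diff[of p] by (simp add: n add.commute)
    ultimately show ?thesis using mr R n by (intro exI[of _ "p\<^sup>2"]) auto
  qed
qed

theorem theorem1p6:
  fixes p t n :: nat
    and scale :: "'a::field \<Rightarrow> 'v::ab_group_add \<Rightarrow> 'v"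
    and Q :: "'v \<Rightarrow> 'a"
    and Ps Hs :: "'v set list"
    and A11 :: "'k::field mat"
  assumes "prime p" and "t \<ge> 1" and "CARD('a) = p ^ t"
    and "vector_space scale" and "vector_space.dim scale UNIV = n" and "n \<ge> 4"
    and "quadratic_form scale Q" and "nondegenerate Q"
    and "distinct Ps" and "set Ps = singular_points scale Q"
    and "distinct Hs" and "set Hs = polar_hyperplanes scale Q"
    and "CARD('k) = p"
    and "A11 = incidence_mat Ps Hs"
  shows "(p = 2 \<longrightarrow> mat_rank A11 = (if even n then 1 + n ^ t else 1 + (n - 1) ^ t)) \<and>
      (p > 2 \<longrightarrow>
      (\<forall>u::nat. u > 0 \<and> [u = n + 1] (mod 2) \<and> n - 3 \<le> u * p \<and> u * p \<le> p + n - 5 \<longrightarrow>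
        int (mat_rank A11) =
          1 + (int ((n + p - 2) choose (n - 1)) - int ((n + p - 4) choose (n - 1))
               - int ((u * p + 2) choose (n - 1)) + int ((u * p) choose (n - 1))) ^ t) \<and>
      ((\<nexists>u::nat. u > 0 \<and> [u = n + 1] (mod 2) \<and> n - 3 \<le> u * p \<and> u * p \<le> p + n - 5) \<longrightarrow>
        int (mat_rank A11) =
          1 + (int ((n + p - 2) choose (n - 1)) - int ((n + p - 4) choose (n - 1))) ^ t))"
proof -
  from incidence_rank[OF assms(1-13)] obtain r where
    r: "mat_rank A11 = 1 + r ^ t" "p = 2 \<longrightarrow> r = (if even n then n else n - 1)"
    and odd1: "p > 2 \<longrightarrow> (\<forall>u::nat. u > 0 \<and> [u = n + 1] (mod 2) \<and> n - 3 \<le> u * p \<and> u * p \<le> p + n - 5 \<longrightarrow>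
        int r = int ((n + p - 2) choose (n - 1)) - int ((n + p - 4) choose (n - 1))
               - int ((u * p + 2) choose (n - 1)) + int ((u * p) choose (n - 1)))"
    and odd2: "p > 2 \<longrightarrow> (\<nexists>u::nat. u > 0 \<and> [u = n + 1] (mod 2) \<and> n - 3 \<le> u * p \<and> u * p \<le> p + n - 5) \<longrightarrow>
        int r = int ((n + p - 2) choose (n - 1)) - int ((n + p - 4) choose (n - 1))"
    unfolding assms(14) by blast
  have ir: "int (mat_rank A11) = 1 + int r ^ t" using r(1) by simp
  show ?thesis
    unfolding ir using r odd1 odd2 by auto
qed

end
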